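(* Let $H$ be a semisimple finite dimensional Hopf algebra over a field $k$, and let $A$ be an $H$-semiprime $H$-module algebra which has a right artinian classical right quotient ring $Q$; equip $Q$ with the unique $H$-module algebra structure extending that of $A$. Let $I$ be an $H$-stable right ideal of $A$, and let $I^H=I\cap A^H$. (i) If $I^H=0$ then $I=0$. (ii) If $I$ is an essential right ideal of $A$ then $Q^HI^H=Q^H$ and $I^HQ^H=Q^H$.
   Context: All algebras are associative and unital. An $H$-module algebra is a $k$-algebra $A$ with a left $H$-module structure such that the multiplication map $A\otimes_k A\to A$ is $H$-linear, where $H$ acts on $A\otimes_k A$ via its comultiplication. Its subalgebra of invariants is $A^H=\{a\in A\mid ha=\varepsilon(h)a \text{ for all } h\in H\}$, where $\varepsilon$ is the counit of $H$. $A$ is $H$-semiprime if it contains no nonzero nilpotent $H$-stable two-sided ideals. An element of a ring is regular if it is neither a left nor a right zero divisor. A classical right quotient ring of a ring $R$ is a ring $Q$ containing $R$ as a subring such that all regular elements of $R$ are invertible in $Q$ and each $q\in Q$ can be written as $q=as^{-1}$ with $a,s\in R$, $s$ regular. It is known that if $A$ has a right artinian classical right quotient ring $Q$, then the $H$-module structure on $A$ extends uniquely to $Q$ so that $Q$ becomes an $H$-module algebra. A right ideal of a ring is essential if it has nonzero intersection with each nonzero right ideal of the ring. $Q^HI^H$ (respectively $I^HQ^H$) is the additive subgroup generated by all products $qx$ (respectively $xq$) with $q\in Q^H$, $x\in I^H$. *)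

theory Defs
  imports
    Complex_Main
    "HOL-Library.Poly_Mapping"
    "HOL-Computational_Algebra.Group_Closure"
begin

section \<open>Algebras over a field\<close>

text \<open>The sort \<open>{ring, monoid_mult}\<close> is that of associative unital rings; unlike \<open>ring_1\<close> it
  does not exclude the zero ring.\<close>

locale k_algebra = vector_space scale
  for scale :: "'k::field \<Rightarrow> 'a::{ring,monoid_mult} \<Rightarrow> 'a" +
  assumes scale_mult_left: "scale c (a * b) = scale c a * b"
    and scale_mult_right: "scale c (a * b) = a * scale c b"

definition finite_dimensional :: "('k::field \<Rightarrow> 'v::ab_group_add \<Rightarrow> 'v) \<Rightarrow> bool"
  where "finite_dimensional scale \<longleftrightarrow> (\<exists>B. finite B \<and> module.span scale B = UNIV)"


section \<open>Tensor powers\<close>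

text \<open>\<open>'x \<Rightarrow>\<^sub>0 'k\<close> is the vector space with basis \<open>'x\<close>.  The space \<open>V \<otimes> V\<close> is the quotient of
  \<open>'v \<times> 'v \<Rightarrow>\<^sub>0 'k\<close> by the subspace making \<open>single (v, w) 1\<close> linear in \<open>v\<close> and in \<open>w\<close>; similarly
  for \<open>V \<otimes> V \<otimes> V\<close>.  Instead of forming the quotient, elements of the tensor powers are
  represented by elements of the free space, and equality of tensors is congruence
  modulo that subspace.\<close>

definition free_scale :: "'k::field \<Rightarrow> ('x \<Rightarrow>\<^sub>0 'k) \<Rightarrow> ('x \<Rightarrow>\<^sub>0 'k)"
  where "free_scale c u = Poly_Mapping.map ((*) c) u"

text \<open>Linear extension to the free space of a function given on its basis.\<close>

definition free_extend ::
    "('k::field \<Rightarrow> 'v::ab_group_add \<Rightarrow> 'v) \<Rightarrow> ('x \<Rightarrow> 'v) \<Rightarrow> ('x \<Rightarrow>\<^sub>0 'k) \<Rightarrow> 'v"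
  where "free_extend scale f u = (\<Sum>x\<in>Poly_Mapping.keys u. scale (Poly_Mapping.lookup u x) (f x))"

definition linearity_relations ::
    "('k::field \<Rightarrow> 'v::ab_group_add \<Rightarrow> 'v) \<Rightarrow> ('v \<Rightarrow> 'x) \<Rightarrow> ('x \<Rightarrow>\<^sub>0 'k) set"
  where "linearity_relations scale e =
    {Poly_Mapping.single (e (v + w)) 1 - Poly_Mapping.single (e v) 1 - Poly_Mapping.single (e w) 1
      | v w. True} \<union>
    {Poly_Mapping.single (e (scale c v)) 1 - Poly_Mapping.single (e v) c | c v. True}"

definition tensor2_eq ::
    "('k::field \<Rightarrow> 'v::ab_group_add \<Rightarrow> 'v) \<Rightarrow> ('v \<times> 'v \<Rightarrow>\<^sub>0 'k) \<Rightarrow> ('v \<times> 'v \<Rightarrow>\<^sub>0 'k) \<Rightarrow> bool"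
  where "tensor2_eq scale s t \<longleftrightarrow> s - t \<in> module.span free_scale
    ((\<Union>y. linearity_relations scale (\<lambda>x. (x, y))) \<union>
     (\<Union>x. linearity_relations scale (\<lambda>y. (x, y))))"

definition tensor3_eq ::
    "('k::field \<Rightarrow> 'v::ab_group_add \<Rightarrow> 'v) \<Rightarrow>
      ('v \<times> 'v \<times> 'v \<Rightarrow>\<^sub>0 'k) \<Rightarrow> ('v \<times> 'v \<times> 'v \<Rightarrow>\<^sub>0 'k) \<Rightarrow> bool"
  where "tensor3_eq scale s t \<longleftrightarrow> s - t \<in> module.span free_scale
    ((\<Union>y z. linearity_relations scale (\<lambda>x. (x, y, z))) \<union>
     (\<Union>x z. linearity_relations scale (\<lambda>y. (x, y, z))) \<union>
     (\<Union>x y. linearity_relations scale (\<lambda>z. (x, y, z))))"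

definition tensor_mult ::
    "('v::times \<times> 'v \<Rightarrow>\<^sub>0 'k::field) \<Rightarrow> ('v \<times> 'v \<Rightarrow>\<^sub>0 'k) \<Rightarrow> ('v \<times> 'v \<Rightarrow>\<^sub>0 'k)"
  where "tensor_mult s t =
    free_extend free_scale (\<lambda>(a, b).
      free_extend free_scale (\<lambda>(c, d). Poly_Mapping.single (a * c, b * d) 1) t) s"


section \<open>Hopf algebras and module algebras\<close>

text \<open>\<open>comult h\<close> is a representative of \<open>\<Delta>(h) \<in> H \<otimes> H\<close>, so it is only required to be linear,
  multiplicative and coassociative up to equality of tensors.\<close>

locale hopf_algebra = k_algebra scale
  for scale :: "'k::field \<Rightarrow> 'h::ring_1 \<Rightarrow> 'h" +
  fixes comult :: "'h \<Rightarrow> ('h \<times> 'h \<Rightarrow>\<^sub>0 'k)"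
    and counit :: "'h \<Rightarrow> 'k"
    and antipode :: "'h \<Rightarrow> 'h"
  assumes comult_add: "tensor2_eq scale (comult (x + y)) (comult x + comult y)"
    and comult_scale: "tensor2_eq scale (comult (scale c x)) (free_scale c (comult x))"
    and comult_mult: "tensor2_eq scale (comult (x * y)) (tensor_mult (comult x) (comult y))"
    and comult_one: "tensor2_eq scale (comult 1) (Poly_Mapping.single (1, 1) 1)"
    and coassoc: "tensor3_eq scale
      (free_extend free_scale (\<lambda>(a, b).
        free_extend free_scale (\<lambda>(a1, a2). Poly_Mapping.single (a1, a2, b) 1) (comult a)) (comult x))
      (free_extend free_scale (\<lambda>(a, b).
        free_extend free_scale (\<lambda>(b1, b2). Poly_Mapping.single (a, b1, b2) 1) (comult b)) (comult x))"
    and counit_linear: "Vector_Spaces.linear scale (*) counit"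
    and counit_mult: "counit (x * y) = counit x * counit y"
    and counit_one: "counit 1 = 1"
    and counit_left: "free_extend scale (\<lambda>(a, b). scale (counit a) b) (comult x) = x"
    and counit_right: "free_extend scale (\<lambda>(a, b). scale (counit b) a) (comult x) = x"
    and antipode_linear: "Vector_Spaces.linear scale scale antipode"
    and antipode_left: "free_extend scale (\<lambda>(a, b). antipode a * b) (comult x) = scale (counit x) 1"
    and antipode_right: "free_extend scale (\<lambda>(a, b). a * antipode b) (comult x) = scale (counit x) 1"

text \<open>That \<open>h1 = \<epsilon>(h)1\<close> is not part of the definition; it follows from the other
  conditions since \<open>H\<close> has an antipode.\<close>

locale module_algebra = H: hopf_algebra scaleH comult counit antipode + A: k_algebra scaleA
  for scaleH :: "'k::field \<Rightarrow> 'h::ring_1 \<Rightarrow> 'h"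
    and comult :: "'h \<Rightarrow> ('h \<times> 'h \<Rightarrow>\<^sub>0 'k)"
    and counit :: "'h \<Rightarrow> 'k"
    and antipode :: "'h \<Rightarrow> 'h"
    and scaleA :: "'k \<Rightarrow> 'a::{ring,monoid_mult} \<Rightarrow> 'a" +
  fixes act :: "'h \<Rightarrow> 'a \<Rightarrow> 'a"
  assumes act_add_left: "act (g + h) a = act g a + act h a"
    and act_add_right: "act h (a + b) = act h a + act h b"
    and act_scale_left: "act (scaleH c h) a = scaleA c (act h a)"
    and act_scale_right: "act h (scaleA c a) = scaleA c (act h a)"
    and act_mult: "act (g * h) a = act g (act h a)"
    and act_one: "act 1 a = a"
    and act_product:
      "act h (a * b) = free_extend scaleA (\<lambda>(h1, h2). act h1 a * act h2 b) (comult h)"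

definition invariants ::
    "('h \<Rightarrow> 'k) \<Rightarrow> ('k \<Rightarrow> 'a \<Rightarrow> 'a) \<Rightarrow> ('h \<Rightarrow> 'a \<Rightarrow> 'a) \<Rightarrow> 'a set"
  where "invariants counit scale act = {a. \<forall>h. act h a = scale (counit h) a}"


section \<open>Ideals and quotient rings\<close>

definition right_ideal :: "'a::{ring,monoid_mult} set \<Rightarrow> bool"
  where "right_ideal I \<longleftrightarrow> 0 \<in> I \<and> (\<forall>x\<in>I. \<forall>y\<in>I. x + y \<in> I) \<and> (\<forall>x\<in>I. \<forall>r. x * r \<in> I)"

definition left_ideal :: "'a::{ring,monoid_mult} set \<Rightarrow> bool"
  where "left_ideal I \<longleftrightarrow> 0 \<in> I \<and> (\<forall>x\<in>I. \<forall>y\<in>I. x + y \<in> I) \<and> (\<forall>x\<in>I. \<forall>r. r * x \<in> I)"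

definition H_stable :: "('h \<Rightarrow> 'a \<Rightarrow> 'a) \<Rightarrow> 'a set \<Rightarrow> bool"
  where "H_stable act I \<longleftrightarrow> (\<forall>h. \<forall>x\<in>I. act h x \<in> I)"

definition set_product :: "'a::{ring,monoid_mult} set \<Rightarrow> 'a set \<Rightarrow> 'a set"
  where "set_product S T = group_closure {x * y | x y. x \<in> S \<and> y \<in> T}"

primrec ideal_power :: "'a::{ring,monoid_mult} set \<Rightarrow> nat \<Rightarrow> 'a set"
  where "ideal_power I 0 = UNIV"
  | "ideal_power I (Suc n) = set_product (ideal_power I n) I"

definition H_semiprime :: "('h \<Rightarrow> 'a::{ring,monoid_mult} \<Rightarrow> 'a) \<Rightarrow> bool"
  where "H_semiprime act \<longleftrightarrow>
    (\<forall>I. left_ideal I \<and> right_ideal I \<and> H_stable act I \<and> (\<exists>n. ideal_power I n = {0}) \<longrightarrow> I = {0})"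

text \<open>Semisimplicity of the left regular module: every left ideal of the ring is a direct
  summand.\<close>

definition semisimple_ring :: "'a::{ring,monoid_mult} itself \<Rightarrow> bool"
  where "semisimple_ring _ \<longleftrightarrow>
    (\<forall>L :: 'a set. left_ideal L \<longrightarrow>
      (\<exists>M. left_ideal M \<and> L \<inter> M = {0} \<and> (\<forall>x. \<exists>a\<in>L. \<exists>b\<in>M. x = a + b)))"

definition right_artinian :: "'a::{ring,monoid_mult} itself \<Rightarrow> bool"
  where "right_artinian _ \<longleftrightarrow>
    (\<forall>I :: nat \<Rightarrow> 'a set. (\<forall>n. right_ideal (I n)) \<and> decseq I \<longrightarrow> (\<exists>n. \<forall>m\<ge>n. I m = I n))"

definition essential_right_ideal :: "'a::{ring,monoid_mult} set \<Rightarrow> bool"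
  where "essential_right_ideal I \<longleftrightarrow>
    right_ideal I \<and> (\<forall>J. right_ideal J \<and> J \<noteq> {0} \<longrightarrow> I \<inter> J \<noteq> {0})"

definition regular :: "'a::{ring,monoid_mult} \<Rightarrow> bool"
  where "regular s \<longleftrightarrow> (\<forall>x. s * x = 0 \<longrightarrow> x = 0) \<and> (\<forall>x. x * s = 0 \<longrightarrow> x = 0)"

text \<open>The inclusion of \<open>R\<close> as a subring of \<open>Q\<close> is an injective homomorphism \<open>\<iota>\<close> of unital
  rings; in the last condition \<open>t\<close> is the inverse of \<open>s\<close> in \<open>Q\<close>.\<close>

definition classical_right_quotient_ring ::
    "('r::{ring,monoid_mult} \<Rightarrow> 'q::{ring,monoid_mult}) \<Rightarrow> bool"
  where "classical_right_quotient_ring \<iota> \<longleftrightarrow>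
    inj \<iota> \<and> \<iota> 1 = 1 \<and> (\<forall>a b. \<iota> (a + b) = \<iota> a + \<iota> b) \<and> (\<forall>a b. \<iota> (a * b) = \<iota> a * \<iota> b) \<and>
    (\<forall>s. regular s \<longrightarrow> (\<exists>t. \<iota> s * t = 1 \<and> t * \<iota> s = 1)) \<and>
    (\<forall>q. \<exists>a s t. regular s \<and> \<iota> s * t = 1 \<and> t * \<iota> s = 1 \<and> q = \<iota> a * t)"

end

theory Submission
  imports Defs
begin

text \<open>Write \<open>T q = t q\<close> for a left integral \<open>t\<close> with \<open>\<epsilon>(t) = 1\<close>.  The main point is that every
  \<open>H\<close>-stable right ideal \<open>X\<close> of \<open>Q\<close> is generated by an idempotent of \<open>Q\<^sup>H\<close>.  For this, let
  \<open>M\<close> be an \<open>H\<close>-equivariant finitely generated right \<open>Q\<close>-module.  If \<open>M\<close> is generated by \<open>r\<close> elements, then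
  the ideal generated by the coefficients of all relations between them is \<open>H\<close>-stable (an argument of Skryabin),
  and for a suitable power \<open>M\<^sup>n\<close> and suitable generators, whose number is the maximum of the ranks of
  \<open>M\<^sup>n\<close> at the maximal ideals of \<open>Q\<close>, it is a proper ideal.
  Hence \<open>Q / (X + C)\<close> is projective over \<open>Q / C\<close> for each maximal \<open>H\<close>-stable ideal \<open>C\<close>; moreover the
  intersection of all such \<open>C\<close> is nilpotent and thus zero.  Left multiplication by some \<open>g \<in> X\<close> is therefore a
  projection onto \<open>X\<close>, and so is left multiplication by \<open>T g \<in> Q\<^sup>H\<close>.

  To descend to \<open>A\<close>, let \<open>K\<close> be an \<open>H\<close>-stable right ideal of \<open>A\<close> which contains a regular element.  If
  \<open>c T(K) g = 0\<close> with \<open>c\<close> and \<open>g\<close> in \<open>Q\<^sup>H\<close>, then \<open>c g = 0\<close>, because \<open>Q\<close> satisfies the descending chain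
  condition on right \<open>Q\<^sup>H\<close>-submodules.  All claims follow from this, as \<open>T(I) \<subseteq> I\<^sup>H\<close>.\<close>

section \<open>One-sided ideals\<close>

text \<open>\<open>Q\<close> need not be semiprime: in characteristic \<open>p\<close> the algebra
  \<open>k[x]/(x^p - 1)\<close>, graded by the integers modulo \<open>p\<close>, is
  \<open>H\<close>-semiprime with nonzero radical. So idempotents cannot be taken from
  semisimplicity of \<open>Q\<close>. Its maximal ideals \<open>P\<close> are in general not
  \<open>H\<close>-stable, and the ranks at different \<open>P\<close> may differ. Taking as many
  generators as the largest rank keeps them independent at a \<open>P\<close> where it is attained,
  so all coefficients of relations lie in that \<open>P\<close>; one generator more would make the
  relation ideal everything. Powers of the module are taken because over a matrix ring of size
  \<open>l\<close> ranks are multiples of \<open>1/l\<close>. In the descent, denominators of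
  elements of \<open>Q\<^sup>H\<close> need not be invariant and \<open>T\<close> is not
  multiplicative; single denominators are therefore replaced by \<open>H\<close>-stable right ideals
  containing regular elements.\<close>

lemma right_idealD:
  assumes "right_ideal I"
  shows right_ideal_zero: "0 \<in> I"
    and right_ideal_add: "x \<in> I \<Longrightarrow> y \<in> I \<Longrightarrow> x + y \<in> I"
    and right_ideal_mult: "x \<in> I \<Longrightarrow> x * r \<in> I"
  using assms by (auto simp: right_ideal_def)

lemma right_ideal_uminus: "right_ideal I \<Longrightarrow> x \<in> I \<Longrightarrow> - x \<in> I"
  using right_ideal_mult[of I x "-1"] by simp

lemma right_ideal_diff: "right_ideal I \<Longrightarrow> x \<in> I \<Longrightarrow> y \<in> I \<Longrightarrow> x - y \<in> I"
  using right_ideal_add[of I x "-y"] right_ideal_uminus[of I y] by simp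

lemma right_ideal_sum: "right_ideal I \<Longrightarrow> (\<And>i. i \<in> F \<Longrightarrow> f i \<in> I) \<Longrightarrow> sum f F \<in> I"
  by (induction F rule: infinite_finite_induct) (auto simp: right_ideal_zero right_ideal_add)

lemma right_ideal_trans: "right_ideal I \<Longrightarrow> x - y \<in> I \<Longrightarrow> y - z \<in> I \<Longrightarrow> x - z \<in> I"
  using right_ideal_add[of I "x - y" "y - z"] by simp

lemma right_ideal_iff_diff: "right_ideal I \<Longrightarrow> x - y \<in> I \<Longrightarrow> x \<in> I \<longleftrightarrow> y \<in> I"
  using right_ideal_add[of I "x - y" y] right_ideal_diff[of I x "x - y"] by auto

lemma right_ideal_eq_UNIV: "right_ideal I \<Longrightarrow> 1 \<in> I \<Longrightarrow> x \<in> I"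
  using right_ideal_mult[of I 1 x] by simp

lemma right_idealI_diff:
  assumes "0 \<in> I" "\<And>x y. x \<in> I \<Longrightarrow> y \<in> I \<Longrightarrow> x - y \<in> I" "\<And>x r. x \<in> I \<Longrightarrow> x * r \<in> I"
  shows "right_ideal I"
proof -
  have "x + y \<in> I" if "x \<in> I" "y \<in> I" for x y
    using assms(2)[OF that(1) assms(2)[OF assms(1) that(2)]] by simp
  then show ?thesis
    using assms by (auto simp: right_ideal_def)
qed

lemma left_idealD:
  assumes "left_ideal I"
  shows left_ideal_zero: "0 \<in> I"
    and left_ideal_add: "x \<in> I \<Longrightarrow> y \<in> I \<Longrightarrow> x + y \<in> I"
    and left_ideal_mult: "x \<in> I \<Longrightarrow> r * x \<in> I"
  using assms by (auto simp: left_ideal_def)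

lemma left_ideal_diff: "left_ideal I \<Longrightarrow> x \<in> I \<Longrightarrow> y \<in> I \<Longrightarrow> x - y \<in> I"
  using left_ideal_add[of I x "-y"] left_ideal_mult[of I y "-1"] by simp

lemma left_idealI_diff:
  assumes "0 \<in> I" "\<And>x y. x \<in> I \<Longrightarrow> y \<in> I \<Longrightarrow> x - y \<in> I" "\<And>x r. x \<in> I \<Longrightarrow> r * x \<in> I"
  shows "left_ideal I"
proof -
  have "x + y \<in> I" if "x \<in> I" "y \<in> I" for x y
    using assms(2)[OF that(1) assms(2)[OF assms(1) that(2)]] by simp
  then show ?thesis
    using assms by (auto simp: left_ideal_def)
qed

definition two_sided_ideal :: "'a::{ring,monoid_mult} set \<Rightarrow> bool"
  where "two_sided_ideal I \<longleftrightarrow> left_ideal I \<and> right_ideal I"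

lemma two_sided_ideal_left: "two_sided_ideal I \<Longrightarrow> left_ideal I"
  and two_sided_ideal_right: "two_sided_ideal I \<Longrightarrow> right_ideal I"
  by (auto simp: two_sided_ideal_def)

definition ideal_sum :: "'a::{ring,monoid_mult} set \<Rightarrow> 'a set \<Rightarrow> 'a set"
  where "ideal_sum I J = {x + y | x y. x \<in> I \<and> y \<in> J}"

lemma ideal_sumI: "x \<in> I \<Longrightarrow> y \<in> J \<Longrightarrow> x + y \<in> ideal_sum I J"
  by (auto simp: ideal_sum_def)

lemma right_ideal_ideal_sum:
  assumes "right_ideal I" "right_ideal J"
  shows "right_ideal (ideal_sum I J)"
proof (rule right_idealI_diff)
  show "0 \<in> ideal_sum I J"
    using ideal_sumI[of 0 I 0 J] assms by (simp add: right_ideal_zero)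
next
  fix x y assume "x \<in> ideal_sum I J" "y \<in> ideal_sum I J"
  then obtain a b c d where "x = a + b" "y = c + d" "a \<in> I" "b \<in> J" "c \<in> I" "d \<in> J"
    by (auto simp: ideal_sum_def)
  moreover have "x - y = (a - c) + (b - d)"
    using calculation by simp
  ultimately show "x - y \<in> ideal_sum I J"
    using assms by (metis ideal_sumI right_ideal_diff)
next
  fix x r assume "x \<in> ideal_sum I J"
  then show "x * r \<in> ideal_sum I J"
    using assms by (fastforce simp: ideal_sum_def distrib_right intro: right_ideal_mult)
qed

lemma left_ideal_ideal_sum:
  assumes "left_ideal I" "left_ideal J"
  shows "left_ideal (ideal_sum I J)"
proof (rule left_idealI_diff)
  show "0 \<in> ideal_sum I J"
    using ideal_sumI[of 0 I 0 J] assms by (simp add: left_ideal_zero)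
next
  fix x y assume "x \<in> ideal_sum I J" "y \<in> ideal_sum I J"
  then obtain a b c d where "x = a + b" "y = c + d" "a \<in> I" "b \<in> J" "c \<in> I" "d \<in> J"
    by (auto simp: ideal_sum_def)
  moreover have "x - y = (a - c) + (b - d)"
    using calculation by simp
  ultimately show "x - y \<in> ideal_sum I J"
    using assms by (metis ideal_sumI left_ideal_diff)
next
  fix x r assume "x \<in> ideal_sum I J"
  then show "r * x \<in> ideal_sum I J"
    using assms by (fastforce simp: ideal_sum_def distrib_left intro: left_ideal_mult)
qed

lemma ideal_sum_left: "right_ideal J \<Longrightarrow> I \<subseteq> ideal_sum I J"
  using ideal_sumI[of _ I 0 J] by (auto simp: right_ideal_zero)

lemma ideal_sum_right: "right_ideal I \<Longrightarrow> J \<subseteq> ideal_sum I J"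
  using ideal_sumI[of 0 I _ J] by (auto simp: right_ideal_zero)

lemma set_product_intro: "x \<in> S \<Longrightarrow> y \<in> T \<Longrightarrow> x * y \<in> set_product S T"
  unfolding set_product_def by (rule group_closure.base) auto

lemma set_product_zero [simp]: "0 \<in> set_product S T"
  by (simp add: set_product_def)

lemma set_product_diff: "a \<in> set_product S T \<Longrightarrow> b \<in> set_product S T \<Longrightarrow> a - b \<in> set_product S T"
  unfolding set_product_def by (rule group_closure.diff)

lemma set_product_add: "a \<in> set_product S T \<Longrightarrow> b \<in> set_product S T \<Longrightarrow> a + b \<in> set_product S T"
  unfolding set_product_def by (rule group_closure_add)

lemma set_product_induct [consumes 1, case_names zero mult diff]:
  assumes "z \<in> set_product S T" "P 0" "\<And>x y. x \<in> S \<Longrightarrow> y \<in> T \<Longrightarrow> P (x * y)"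
    and "\<And>a b. P a \<Longrightarrow> P b \<Longrightarrow> P (a - b)"
  shows "P z"
  using assms(1) unfolding set_product_def
  by (induction rule: group_closure.induct) (use assms in auto)

lemma set_product_mono: "S \<subseteq> S' \<Longrightarrow> T \<subseteq> T' \<Longrightarrow> set_product S T \<subseteq> set_product S' T'"
proof
  fix z assume "z \<in> set_product S T" "S \<subseteq> S'" "T \<subseteq> T'"
  then show "z \<in> set_product S' T'"
    by (induction rule: set_product_induct) (auto intro: set_product_diff set_product_intro)
qed

lemma right_ideal_set_product:
  assumes "right_ideal T"
  shows "right_ideal (set_product S T)"
proof (rule right_idealI_diff)
  fix x r assume "x \<in> set_product S T"
  then show "x * r \<in> set_product S T"
    by (induction rule: set_product_induct)
      (simp_all add: mult.assoc left_diff_distrib set_product_intro set_product_diff right_ideal_mult assms)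
qed (auto intro: set_product_diff)

lemma left_ideal_set_product:
  assumes "left_ideal S"
  shows "left_ideal (set_product S T)"
proof (rule left_idealI_diff)
  fix x r assume "x \<in> set_product S T"
  then show "r * x \<in> set_product S T"
    by (induction rule: set_product_induct)
      (simp_all add: mult.assoc[symmetric] right_diff_distrib set_product_intro set_product_diff left_ideal_mult assms)
qed (auto intro: set_product_diff)

lemma set_product_subset_right_ideal:
  assumes "right_ideal S"
  shows "set_product S T \<subseteq> S"
proof
  fix z assume "z \<in> set_product S T"
  then show "z \<in> S"
    by (induction rule: set_product_induct)
      (use assms in \<open>auto intro: right_ideal_zero right_ideal_mult right_ideal_diff\<close>)
qed

lemma set_product_subset_left_ideal:
  assumes "left_ideal T"
  shows "set_product S T \<subseteq> T"
proof
  fix z assume "z \<in> set_product S T"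
  then show "z \<in> T"
    by (induction rule: set_product_induct)
      (use assms in \<open>auto intro: left_ideal_zero left_ideal_mult left_ideal_diff\<close>)
qed

lemma set_product_assoc: "set_product (set_product R S) T = set_product R (set_product S T)"
proof (rule antisym; rule subsetI)
  fix z assume "z \<in> set_product (set_product R S) T"
  then show "z \<in> set_product R (set_product S T)"
  proof (induction rule: set_product_induct)
    case (mult x y)
    then show ?case
      by (induction rule: set_product_induct)
        (auto simp: mult.assoc left_diff_distrib intro: set_product_diff set_product_intro)
  qed (auto intro: set_product_diff)
next
  fix z assume "z \<in> set_product R (set_product S T)"
  then show "z \<in> set_product (set_product R S) T"
  proof (induction rule: set_product_induct)
    case (mult x y)
    from mult(2,1) show ?case
      by (induction rule: set_product_induct)
        (auto simp: mult.assoc[symmetric] right_diff_distrib intro: set_product_diff set_product_intro)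
  qed (auto intro: set_product_diff)
qed

lemma set_product_UNIV_right: "right_ideal S \<Longrightarrow> set_product S UNIV = S"
  using set_product_subset_right_ideal[of S UNIV] set_product_intro[of _ S 1 UNIV] by fastforce

lemma set_product_UNIV_left: "left_ideal T \<Longrightarrow> set_product UNIV T = T"
  using set_product_subset_left_ideal[of T UNIV] set_product_intro[of 1 UNIV _ T] by fastforce

section \<open>Right artinian rings\<close>

text \<open>Dependent choice turns a family without minimal member into a strictly decreasing
  sequence. The family is arbitrary because it will also consist of right
  \<open>Q\<^sup>H\<close>-submodules, not only of right ideals.\<close>

lemma dcc_minimal:
  assumes dcc: "\<And>I::nat \<Rightarrow> 'x set. (\<And>n. I n \<in> \<S>) \<Longrightarrow> decseq I \<Longrightarrow> \<exists>n. \<forall>m\<ge>n. I m = I n"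
    and "\<S> \<noteq> {}"
  shows "\<exists>M\<in>\<S>. \<forall>N\<in>\<S>. N \<subseteq> M \<longrightarrow> N = M"
proof (rule ccontr)
  assume "\<not> ?thesis"
  then have step: "\<exists>N\<in>\<S>. N \<subset> M" if "M \<in> \<S>" for M
    using that by blast
  obtain M0 where "M0 \<in> \<S>"
    using assms by blast
  have "\<exists>f. \<forall>n. f n \<in> \<S> \<and> f (Suc n) \<subset> f n"
    by (rule dependent_nat_choice) (use \<open>M0 \<in> \<S>\<close> step in auto)
  then obtain f where f: "\<And>n. f n \<in> \<S>" "\<And>n. f (Suc n) \<subset> f n"
    by blast
  have "decseq f"
    using f(2) by (intro decseq_SucI) auto
  from dcc[OF f(1) this] obtain n where n: "\<forall>m\<ge>n. f m = f n"
    by (elim exE)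
  have "f (Suc n) = f n"
    by (rule n[rule_format]) simp
  with f(2)[of n] show False
    by simp
qed

lemma right_artinian_minimal:
  fixes \<S> :: "'q::{ring,monoid_mult} set set"
  assumes "right_artinian TYPE('q)" "\<S> \<noteq> {}" "\<And>I. I \<in> \<S> \<Longrightarrow> right_ideal I"
  shows "\<exists>M\<in>\<S>. \<forall>N\<in>\<S>. N \<subseteq> M \<longrightarrow> N = M"
  by (rule dcc_minimal) (use assms in \<open>auto simp: right_artinian_def\<close>)

text \<open>The descending chain condition for functions from a finite set \<open>B\<close> to
  \<open>Q\<close>, by induction on \<open>B\<close> as for an extension of artinian modules. Only
  values on \<open>B\<close> are compared, so that functions on all of \<open>H\<close> can be used
  without restricting them first.\<close>

lemma right_artinian_functions:
  fixes N :: "nat \<Rightarrow> ('i \<Rightarrow> 'q::{ring,monoid_mult}) set"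
  assumes art: "right_artinian TYPE('q)" and "finite B" and dec: "decseq N"
    and zero: "\<And>n. (\<lambda>_. 0) \<in> N n"
    and add: "\<And>n f g. f \<in> N n \<Longrightarrow> g \<in> N n \<Longrightarrow> (\<lambda>i. f i + g i) \<in> N n"
    and mult: "\<And>n f q. f \<in> N n \<Longrightarrow> (\<lambda>i. f i * q) \<in> N n"
  shows "\<exists>n. \<forall>m\<ge>n. \<forall>f\<in>N n. \<exists>g\<in>N m. \<forall>b\<in>B. f b = g b"
  using \<open>finite B\<close>
proof (induction B)
  case empty
  then show ?case
    using zero by blast
next
  case (insert b B)
  then obtain n1 where n1: "\<And>m f. m \<ge> n1 \<Longrightarrow> f \<in> N n1 \<Longrightarrow> \<exists>g\<in>N m. \<forall>b\<in>B. f b = g b"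
    by blast
  \<comment> \<open>Values at \<open>b\<close> of the functions that vanish on \<open>B\<close>: the
    new layer of the extension. Its stabilisation corrects at \<open>b\<close> a function that
    already agrees on \<open>B\<close>.\<close>
  define R where "R n = {f b | f. f \<in> N n \<and> (\<forall>c\<in>B. f c = 0)}" for n
  have "right_ideal (R n)" for n
    unfolding right_ideal_def
  proof (intro conjI ballI allI)
    show "0 \<in> R n"
      unfolding R_def using zero[of n] by force
    show "x + y \<in> R n" if "x \<in> R n" "y \<in> R n" for x y
    proof -
      from that obtain f g where "x = f b" "y = g b" "f \<in> N n" "g \<in> N n"
        "\<forall>c\<in>B. f c = 0" "\<forall>c\<in>B. g c = 0"
        by (auto simp: R_def)
      then show ?thesis
        unfolding R_def using add[of f n g]
        by (intro CollectI exI[of _ "\<lambda>i. f i + g i"]) auto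
    qed
    show "x * r \<in> R n" if "x \<in> R n" for x r
    proof -
      from that obtain f where "x = f b" "f \<in> N n" "\<forall>c\<in>B. f c = 0"
        by (auto simp: R_def)
      then show ?thesis
        unfolding R_def using mult[of f n r]
        by (intro CollectI exI[of _ "\<lambda>i. f i * r"]) auto
    qed
  qed
  moreover have "decseq R"
    using dec by (fastforce simp: decseq_def R_def)
  ultimately obtain n2 where n2: "\<And>m. m \<ge> n2 \<Longrightarrow> R m = R n2"
    using art unfolding right_artinian_def by blast
  define n where "n = max n1 n2"
  show ?case
  proof (intro exI[of _ n] allI impI ballI)
    fix m f assume m: "m \<ge> n" and f: "f \<in> N n"
    have "f \<in> N n1"
      using f decseqD[OF dec, of n1 n] by (auto simp: n_def)
    then obtain g where g: "g \<in> N m" "\<forall>c\<in>B. f c = g c"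
      using n1[of m f] m by (auto simp: n_def)
    have "g \<in> N n"
      using g decseqD[OF dec m] by auto
    have "(\<lambda>i. f i + g i * (-1)) \<in> N n"
      by (intro add f mult \<open>g \<in> N n\<close>)
    then have "f b - g b \<in> R n"
      using g unfolding R_def by (intro CollectI exI[of _ "\<lambda>i. f i + g i * (-1)"]) auto
    moreover have "R n = R m"
      using n2[of n] n2[of m] m by (auto simp: n_def)
    ultimately have "f b - g b \<in> R m"
      by simp
    then obtain g' where g': "g' \<in> N m" "\<forall>c\<in>B. g' c = 0" "f b - g b = g' b"
      by (auto simp: R_def)
    show "\<exists>g\<in>N m. \<forall>c\<in>insert b B. f c = g c"
      using g g' add[of g m g'] by (intro bexI[of _ "\<lambda>i. g i + g' i"]) (auto simp: algebra_simps)
  qed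
qed

section \<open>Maximal right ideals, their cores and matrix units\<close>

definition maximal_right_ideal :: "'q::{ring,monoid_mult} set \<Rightarrow> bool"
  where "maximal_right_ideal M \<longleftrightarrow> right_ideal M \<and> 1 \<notin> M \<and>
    (\<forall>N. right_ideal N \<longrightarrow> M \<subseteq> N \<longrightarrow> 1 \<notin> N \<longrightarrow> N = M)"

lemma chain_Union_right_ideal:
  assumes "\<C> \<noteq> {}" "\<And>X Y. X \<in> \<C> \<Longrightarrow> Y \<in> \<C> \<Longrightarrow> X \<subseteq> Y \<or> Y \<subseteq> X" "\<And>X. X \<in> \<C> \<Longrightarrow> right_ideal X"
  shows "right_ideal (\<Union>\<C>)"
  unfolding right_ideal_def
proof (intro conjI ballI allI)
  show "0 \<in> \<Union>\<C>"
    using assms right_ideal_zero by blast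
  show "x + y \<in> \<Union>\<C>" if xy: "x \<in> \<Union>\<C>" "y \<in> \<Union>\<C>" for x y
  proof -
    obtain X Y where "X \<in> \<C>" "Y \<in> \<C>" "x \<in> X" "y \<in> Y"
      using xy by blast
    then show ?thesis
      using assms(2)[of X Y] assms(3) right_ideal_add by blast
  qed
  show "x * r \<in> \<Union>\<C>" if "x \<in> \<Union>\<C>" for x r
    using that assms(3) right_ideal_mult by blast
qed

lemma maximal_right_ideal_exists:
  assumes "right_ideal N" "1 \<notin> N"
  shows "\<exists>M. maximal_right_ideal M \<and> N \<subseteq> M"
proof -
  let ?A = "{X. right_ideal X \<and> 1 \<notin> X \<and> N \<subseteq> X}"
  have "\<exists>M\<in>?A. \<forall>X\<in>?A. M \<subseteq> X \<longrightarrow> X = M"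
  proof (rule subset_Zorn_nonempty)
    show "?A \<noteq> {}"
      using assms by blast
    fix \<C> assume C: "\<C> \<noteq> {}" "subset.chain ?A \<C>"
    then have "right_ideal (\<Union>\<C>)"
      by (intro chain_Union_right_ideal) (auto simp: subset.chain_def)
    then show "\<Union>\<C> \<in> ?A"
      using C unfolding subset.chain_def by blast
  qed
  then obtain M where M: "right_ideal M" "1 \<notin> M" "N \<subseteq> M"
    and max: "\<And>X. right_ideal X \<Longrightarrow> 1 \<notin> X \<Longrightarrow> N \<subseteq> X \<Longrightarrow> M \<subseteq> X \<Longrightarrow> X = M"
    by auto
  have "maximal_right_ideal M"
    unfolding maximal_right_ideal_def using M max[OF _ _ order.trans] by simp
  then show ?thesis
    using M by blast
qed

text \<open>The annihilator of the right module \<open>Q / M\<close>; for maximal \<open>M\<close> a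
  primitive ideal.\<close>

definition core :: "'q::{ring,monoid_mult} set \<Rightarrow> 'q set"
  where "core M = {q. \<forall>x. x * q \<in> M}"

definition maximal_ideal :: "'q::{ring,monoid_mult} set \<Rightarrow> bool"
  where "maximal_ideal P \<longleftrightarrow> two_sided_ideal P \<and> 1 \<notin> P \<and>
    (\<forall>N. two_sided_ideal N \<longrightarrow> P \<subseteq> N \<longrightarrow> 1 \<notin> N \<longrightarrow> N = P)"

text \<open>Matrix units \<open>e u w\<close> of \<open>Q/P\<close> for which the corner \<open>e 0 0 * (Q/P) * e 0 0\<close> is a division ring.\<close>

definition matrix_units :: "'q::{ring,monoid_mult} set \<Rightarrow> nat \<Rightarrow> (nat \<Rightarrow> nat \<Rightarrow> 'q) \<Rightarrow> bool"
  where "matrix_units P l e \<longleftrightarrow> 0 < l \<and>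
    (\<forall>u<l. \<forall>w<l. \<forall>y<l. \<forall>z<l. e u w * e y z - (if w = y then e u z else 0) \<in> P) \<and>
    1 - (\<Sum>u<l. e u u) \<in> P \<and>
    (\<forall>d. e 0 0 * d * e 0 0 \<notin> P \<longrightarrow> (\<exists>d'. e 0 0 * d * e 0 0 * d' - e 0 0 \<in> P))"

lemma two_sided_ideal_core:
  assumes "right_ideal M"
  shows "two_sided_ideal (core M)"
  using assms unfolding two_sided_ideal_def left_ideal_def right_ideal_def core_def
  by (auto simp: distrib_left mult.assoc[symmetric])

text \<open>\<open>Q / M\<close> is simple: the right ideal \<open>x Q + M\<close>, here
  \<open>?N\<close>, properly contains \<open>M\<close>.\<close>

lemma maximal_right_ideal_solve:
  assumes M: "maximal_right_ideal M" and "x \<notin> M"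
  shows "\<exists>q. x * q - y \<in> M"
proof -
  have rM: "right_ideal M"
    using M by (simp add: maximal_right_ideal_def)
  let ?N = "{z. \<exists>q. x * q - z \<in> M}"
  have "right_ideal ?N"
  proof (rule right_idealI_diff)
    show "0 \<in> ?N"
      using right_ideal_zero[OF rM] by (auto intro: exI[of _ 0])
    fix a b assume "a \<in> ?N" "b \<in> ?N"
    then obtain q r where "x * q - a \<in> M" "x * r - b \<in> M"
      by auto
    then have "x * (q - r) - (a - b) \<in> M"
      using right_ideal_diff[OF rM, of "x * q - a" "x * r - b"] by (simp add: algebra_simps)
    then show "a - b \<in> ?N"
      by blast
  next
    fix a r assume "a \<in> ?N"
    then obtain q where "x * q - a \<in> M"
      by auto
    then have "x * (q * r) - a * r \<in> M"
      using right_ideal_mult[OF rM, of "x * q - a" r] by (simp add: algebra_simps)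
    then show "a * r \<in> ?N"
      by blast
  qed
  moreover have "M \<subseteq> ?N"
    using right_ideal_uminus[OF rM] by (auto intro!: exI[of _ 0])
  moreover have "x \<in> ?N"
    using right_ideal_zero[OF rM] by (auto intro!: exI[of _ 1])
  ultimately have "1 \<in> ?N"
    using M \<open>x \<notin> M\<close> unfolding maximal_right_ideal_def by blast
  then show ?thesis
    using right_ideal_eq_UNIV[OF \<open>right_ideal ?N\<close>] by blast
qed

text \<open>Wedderburn's theorem by coordinates. The chain condition embeds
  \<open>Q / core M\<close> into a finite power of the simple module \<open>Q / M\<close> by the
  coordinates \<open>v x * q\<close>. For the least number \<open>l\<close> of coordinates this is
  onto, and \<open>e u w\<close> is the element with coordinate \<open>v w\<close> at
  \<open>u\<close> and zero elsewhere.\<close>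

lemma matrix_units_exist:
  fixes M :: "'q::{ring,monoid_mult} set"
  assumes art: "right_artinian TYPE('q)" and M: "maximal_right_ideal M"
  shows "\<exists>l e. matrix_units (core M) l e"
proof -
  have rM: "right_ideal M" and M1: "1 \<notin> M"
    using M by (auto simp: maximal_right_ideal_def)
  define ann where "ann F = {q. \<forall>v\<in>F. v * q \<in> M}" for F
  have r_ann: "right_ideal (ann F)" for F
    using rM unfolding right_ideal_def ann_def by (auto simp: distrib_left mult.assoc[symmetric])
  have "\<exists>F. finite F \<and> ann F = core M"
  proof -
    have "\<exists>A\<in>ann ` {F. finite F}. \<forall>N\<in>ann ` {F. finite F}. N \<subseteq> A \<longrightarrow> N = A"
      by (rule right_artinian_minimal[OF art]) (use r_ann in auto)
    then obtain F where F: "finite F" "\<And>G. finite G \<Longrightarrow> ann G \<subseteq> ann F \<Longrightarrow> ann G = ann F"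
      by auto
    have "ann (insert v F) = ann F" for v
      by (rule F(2)) (use F(1) in \<open>auto simp: ann_def\<close>)
    then have "ann F \<subseteq> core M"
      by (auto simp: core_def ann_def)
    then show ?thesis
      using F by (intro exI[of _ F]) (auto simp: core_def ann_def)
  qed
  then obtain F0 where F0: "finite F0 \<and> ann F0 = core M"
    by (elim exE)
  obtain F where F: "finite F" "ann F = core M"
      and Fmin: "\<And>G. finite G \<Longrightarrow> ann G = core M \<Longrightarrow> card F \<le> card G"
    using ex_has_least_nat[of "\<lambda>F. finite F \<and> ann F = core M", OF F0, of card] by auto
  define l where "l = card F"
  obtain v where v: "bij_betw v {..<l} F"
    using F(1) l_def ex_bij_betw_nat_finite[of F] by (auto simp: atLeast0LessThan)
  have core_iff: "q \<in> core M \<longleftrightarrow> (\<forall>x<l. v x * q \<in> M)" for q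
    unfolding F(2)[symmetric] ann_def using v by (auto simp: bij_betw_def)
  \<comment> \<open>If coordinate \<open>u\<close> could be dropped, \<open>l\<close> would not be
    least; so some \<open>a\<close> outside \<open>core M\<close> has only this coordinate, and
    simplicity moves it to \<open>v w\<close>.\<close>
  have ex: "\<exists>a. (\<forall>x<l. x \<noteq> u \<longrightarrow> v x * a \<in> M) \<and> v u * a - v w \<in> M" if u: "u < l" for u w
  proof -
    have vu: "v u \<in> F"
      using v u by (auto simp: bij_betw_def)
    have "ann (F - {v u}) \<noteq> core M"
      using Fmin[of "F - {v u}"] F(1) vu by (metis card_Diff1_less finite_Diff not_le)
    moreover have "core M \<subseteq> ann (F - {v u})"
      by (auto simp: core_def ann_def)
    ultimately obtain a where a: "a \<in> ann (F - {v u})" "a \<notin> core M"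
      by blast
    have a0: "v x * a \<in> M" if "x < l" "x \<noteq> u" for x
    proof -
      have "v x \<in> F - {v u}"
        using v that u by (auto simp: bij_betw_def inj_on_def)
      then show ?thesis
        using a(1) by (auto simp: ann_def)
    qed
    then have "v u * a \<notin> M"
      using a(2) core_iff by blast
    then obtain q where "v u * a * q - v w \<in> M"
      using maximal_right_ideal_solve[OF M] by blast
    then show ?thesis
      using a0 right_ideal_mult[OF rM] by (intro exI[of _ "a * q"]) (auto simp: mult.assoc[symmetric])
  qed
  then obtain e where e1: "\<And>u w x. u < l \<Longrightarrow> x < l \<Longrightarrow> x \<noteq> u \<Longrightarrow> v x * e u w \<in> M"
      and e2: "\<And>u w. u < l \<Longrightarrow> v u * e u w - v w \<in> M"
    by metis
  have "1 \<notin> core M"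
    using M1 by (auto simp: core_def intro: exI[of _ 1])
  then have l0: "0 < l"
    using core_iff[of 1] by (cases l) auto
  have prod: "e u w * e y z - (if w = y then e u z else 0) \<in> core M"
    if "u < l" "w < l" "y < l" "z < l" for u w y z
    unfolding core_iff
  proof (intro allI impI)
    fix x assume x: "x < l"
    show "v x * (e u w * e y z - (if w = y then e u z else 0)) \<in> M"
    proof (cases "x = u")
      case False
      then show ?thesis
        using e1[OF \<open>u < l\<close> x] right_ideal_mult[OF rM]
        by (auto simp: right_diff_distrib mult.assoc[symmetric] intro!: right_ideal_diff[OF rM])
    next
      case True
      have A: "v u * e u w * e y z - v w * e y z \<in> M"
        using right_ideal_mult[OF rM e2[OF \<open>u < l\<close>, of w], of "e y z"] by (simp add: left_diff_distrib)
      show ?thesis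
      proof (cases "w = y")
        case True
        have "v u * e u w * e y z - v z \<in> M"
          using right_ideal_trans[OF rM A, of "v z"] e2[OF \<open>w < l\<close>, of z] True by simp
        then have "v u * e u w * e y z - v u * e u z \<in> M"
          using right_ideal_diff[OF rM _ e2[OF \<open>u < l\<close>, of z]] by force
        then show ?thesis
          using True \<open>x = u\<close> by (simp add: right_diff_distrib mult.assoc)
      next
        case False
        then have "v w * e y z \<in> M"
          using e1[OF \<open>y < l\<close> \<open>w < l\<close>] by blast
        then have "v u * e u w * e y z \<in> M"
          using right_ideal_iff_diff[OF rM A] by blast
        then show ?thesis
          using False \<open>x = u\<close> by (simp add: mult.assoc)
      qed
    qed
  qed
  have one: "1 - (\<Sum>u<l. e u u) \<in> core M"
    unfolding core_iff
  proof (intro allI impI)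
    fix x assume x: "x < l"
    have "v x * (1 - (\<Sum>u<l. e u u)) = v x - (\<Sum>u<l. v x * e u u)"
      by (simp add: right_diff_distrib sum_distrib_left)
    also have "\<dots> = - (v x * e x x - v x) - (\<Sum>u\<in>{..<l} - {x}. v x * e u u)"
      using x by (subst sum.remove[of _ x]) auto
    also have "\<dots> \<in> M"
      by (rule right_ideal_diff[OF rM right_ideal_uminus[OF rM e2[OF x]] right_ideal_sum[OF rM]])
        (use e1 x in auto)
    finally show "v x * (1 - (\<Sum>u<l. e u u)) \<in> M" .
  qed
  \<comment> \<open>Elements \<open>e 0 0 * d * e 0 0\<close> have only coordinate \<open>0\<close>;
    if it is nonzero, simplicity carries it back to \<open>v 0\<close>.\<close>
  have div: "\<exists>d'. e 0 0 * d * e 0 0 * d' - e 0 0 \<in> core M" if d: "e 0 0 * d * e 0 0 \<notin> core M" for d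
  proof -
    let ?D = "e 0 0 * d * e 0 0"
    have D0: "v x * ?D \<in> M" if "x < l" "x \<noteq> 0" for x
      using right_ideal_mult[OF rM e1[OF l0 that(1) that(2)], of 0 "d * e 0 0"] by (simp add: mult.assoc)
    then have "v 0 * ?D \<notin> M"
      using d core_iff by metis
    then obtain q where q: "v 0 * ?D * q - v 0 \<in> M"
      using maximal_right_ideal_solve[OF M] by blast
    have "?D * q - e 0 0 \<in> core M"
      unfolding core_iff
    proof (intro allI impI)
      fix x assume x: "x < l"
      show "v x * (?D * q - e 0 0) \<in> M"
      proof (cases "x = 0")
        case True
        then show ?thesis
          using right_ideal_diff[OF rM q e2[OF l0, of 0]] by (simp add: right_diff_distrib mult.assoc)
      next
        case False
        then show ?thesis
          using right_ideal_diff[OF rM right_ideal_mult[OF rM D0[OF x False]] e1[OF l0 x False]]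
          by (simp add: right_diff_distrib mult.assoc)
      qed
    qed
    then show ?thesis
      by blast
  qed
  show ?thesis
    unfolding matrix_units_def using l0 prod one div by blast
qed

text \<open>Simplicity of a matrix ring over a division ring: an element of \<open>N\<close> outside
  \<open>P\<close> has an entry outside \<open>P\<close>, which is moved to the corner and inverted
  there. This puts \<open>e 0 0\<close>, then all \<open>e v v\<close>, then \<open>1\<close> into
  \<open>N\<close>.\<close>

lemma matrix_units_maximal_ideal:
  assumes mu: "matrix_units P l e" and P: "two_sided_ideal P" "1 \<notin> P"
  shows "maximal_ideal P"
  unfolding maximal_ideal_def
proof (intro conjI allI impI P)
  have l0: "0 < l"
    and prod: "\<And>u w y z. u < l \<Longrightarrow> w < l \<Longrightarrow> y < l \<Longrightarrow> z < l \<Longrightarrow>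
      e u w * e y z - (if w = y then e u z else 0) \<in> P"
    and one: "1 - (\<Sum>u<l. e u u) \<in> P"
    and div: "\<And>d. e 0 0 * d * e 0 0 \<notin> P \<Longrightarrow> \<exists>d'. e 0 0 * d * e 0 0 * d' - e 0 0 \<in> P"
    using mu by (auto simp: matrix_units_def)
  note rP = two_sided_ideal_right[OF P(1)] and lP = two_sided_ideal_left[OF P(1)]
  fix N assume N: "two_sided_ideal N" "P \<subseteq> N" "1 \<notin> N"
  note rN = two_sided_ideal_right[OF N(1)] and lN = two_sided_ideal_left[OF N(1)]
  have "x \<in> P" if x: "x \<in> N" for x
  proof (rule ccontr)
    assume xP: "x \<notin> P"
    have ee: "e u u * x * e w w \<in> P" if u: "u < l" and w: "w < l" for u w
    proof (rule ccontr)
      assume nP: "e u u * x * e w w \<notin> P"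
      have c1: "e u u - e u 0 * e 0 u \<in> P" if "u < l" for u
        using right_ideal_uminus[OF rP prod[OF that l0 l0 that]] by simp
      let ?y = "e 0 u * x * e w 0"
      have y_N: "?y \<in> N"
        using x by (intro right_ideal_mult[OF rN] left_ideal_mult[OF lN])
      have "e 0 0 * ?y * e 0 0 - ?y \<in> P"
      proof -
        have "e 0 0 * ?y * e 0 0 - ?y = (e 0 0 * e 0 u - e 0 u) * (x * e w 0 * e 0 0)
            + e 0 u * x * (e w 0 * e 0 0 - e w 0)"
          by (simp add: algebra_simps)
        also have "\<dots> \<in> P"
          using prod[OF l0 l0 l0 u] prod[OF w l0 l0 l0]
          by (intro right_ideal_add[OF rP] right_ideal_mult[OF rP] left_ideal_mult[OF lP]) auto
        finally show ?thesis .
      qed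
      moreover have "?y \<notin> P"
      proof
        assume "?y \<in> P"
        then have "e u 0 * ?y * e 0 w \<in> P"
          using right_ideal_mult[OF rP left_ideal_mult[OF lP]] by blast
        moreover have "e u u * x * e w w - e u 0 * ?y * e 0 w \<in> P"
        proof -
          have "e u u * x * e w w - e u 0 * ?y * e 0 w = (e u u - e u 0 * e 0 u) * (x * e w w)
              + e u 0 * e 0 u * x * (e w w - e w 0 * e 0 w)"
            by (simp add: algebra_simps)
          also have "\<dots> \<in> P"
            using c1 u w
            by (intro right_ideal_add[OF rP] right_ideal_mult[OF rP] left_ideal_mult[OF lP]) auto
          finally show ?thesis .
        qed
        ultimately show False
          using nP right_ideal_iff_diff[OF rP] by blast
      qed
      ultimately have "e 0 0 * ?y * e 0 0 \<notin> P"
        using right_ideal_iff_diff[OF rP] by blast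
      then obtain d' where "e 0 0 * ?y * e 0 0 * d' - e 0 0 \<in> P"
        using div by blast
      moreover have "e 0 0 * ?y * e 0 0 * d' \<in> N"
        by (intro right_ideal_mult[OF rN] left_ideal_mult[OF lN] y_N)
      ultimately have e00: "e 0 0 \<in> N"
        using N(2) right_ideal_iff_diff[OF rN] by blast
      have "e v v \<in> N" if v: "v < l" for v
      proof -
        have "e v 0 * e 0 0 * e 0 v \<in> N"
          by (intro right_ideal_mult[OF rN] left_ideal_mult[OF lN] e00)
        moreover have "e v v - e v 0 * e 0 0 * e 0 v \<in> P"
        proof -
          have "e v v - e v 0 * e 0 0 * e 0 v = (e v v - e v 0 * e 0 v) - (e v 0 * e 0 0 - e v 0) * e 0 v"
            by (simp add: algebra_simps)
          also have "\<dots> \<in> P"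
            using right_ideal_diff[OF rP c1[OF v] right_ideal_mult[OF rP, of "e v 0 * e 0 0 - e v 0"]]
              prod[OF v l0 l0 l0] by simp
          finally show ?thesis .
        qed
        ultimately show ?thesis
          using N(2) right_ideal_iff_diff[OF rN] by blast
      qed
      then have "(\<Sum>v<l. e v v) \<in> N"
        by (intro right_ideal_sum[OF rN]) auto
      then have "1 \<in> N"
        using one N(2) right_ideal_iff_diff[OF rN] by blast
      then show False
        using N by blast
    qed
    let ?s = "\<Sum>u<l. e u u"
    have "x - ?s * x * ?s = (1 - ?s) * x + ?s * x * (1 - ?s)"
      by (simp add: algebra_simps)
    also have "\<dots> \<in> P"
      using one by (intro right_ideal_add[OF rP] right_ideal_mult[OF rP] left_ideal_mult[OF lP])
    finally have "x - ?s * x * ?s \<in> P" .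
    moreover have "?s * x * ?s \<in> P"
      using ee by (auto simp: sum_distrib_left sum_distrib_right intro!: right_ideal_sum[OF rP])
    ultimately show False
      using xP right_ideal_iff_diff[OF rP] by blast
  qed
  then show "N = P"
    using N by blast
qed

lemma core_maximal_ideal:
  fixes M :: "'q::{ring,monoid_mult} set"
  assumes "right_artinian TYPE('q)" "maximal_right_ideal M"
  shows "maximal_ideal (core M)"
proof -
  obtain l e where "matrix_units (core M) l e"
    using matrix_units_exist assms by blast
  moreover have "1 \<notin> core M"
    using assms by (metis (mono_tags, lifting) core_def maximal_right_ideal_def mem_Collect_eq mult_1)
  ultimately show ?thesis
    using assms two_sided_ideal_core matrix_units_maximal_ideal by (metis maximal_right_ideal_def)
qed

text \<open>Nilpotency of the radical, in a form suited to induction over finitely many maximal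
  ideals. A minimal product \<open>W\<close> of cores satisfies \<open>W W = W = P W\<close>, hence
  lies in every core. Were it nonzero, a right ideal \<open>U\<close> minimal with
  \<open>U W\<close> nonzero would equal \<open>u W\<close>, so that \<open>u = u * w'\<close>; then
  \<open>1 - w'\<close> and \<open>w'\<close> would both lie in a maximal right ideal above the
  annihilator of \<open>u\<close>.\<close>

lemma product_of_cores_zero:
  assumes art: "right_artinian TYPE('q::{ring,monoid_mult})"
  shows "\<exists>Ps::'q set list. (\<forall>P\<in>set Ps. P \<in> core ` Collect maximal_right_ideal) \<and>
    foldr set_product Ps UNIV = {0}"
proof -
  let ?C = "core ` Collect maximal_right_ideal :: 'q set set"
  let ?f = "\<lambda>Ps. foldr set_product Ps (UNIV :: 'q set)"
  let ?S = "?f ` {Ps. set Ps \<subseteq> ?C}"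
  have U: "two_sided_ideal (UNIV :: 'q set)"
    by (auto simp: two_sided_ideal_def left_ideal_def right_ideal_def)
  have cores: "two_sided_ideal P" if "P \<in> ?C" for P
    using that two_sided_ideal_core by (auto simp: maximal_right_ideal_def)
  have ideal: "two_sided_ideal (?f Ps)" if "set Ps \<subseteq> ?C" for Ps
    using that
    by (induction Ps) (use U cores left_ideal_set_product right_ideal_set_product in
      \<open>auto simp: two_sided_ideal_def\<close>)
  have fold: "foldr set_product Ps V = set_product (?f Ps) V" if "left_ideal V" for Ps V
    by (induction Ps) (auto simp: set_product_assoc set_product_UNIV_left that)
  have "\<exists>A\<in>?S. \<forall>N\<in>?S. N \<subseteq> A \<longrightarrow> N = A"
    by (rule right_artinian_minimal[OF art]) (use ideal two_sided_ideal_right in \<open>auto intro: exI[of _ "[]"]\<close>)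
  then obtain Ps where Ps: "set Ps \<subseteq> ?C" and
      min: "\<And>Qs. set Qs \<subseteq> ?C \<Longrightarrow> ?f Qs \<subseteq> ?f Ps \<Longrightarrow> ?f Qs = ?f Ps"
    by auto
  define W where "W = ?f Ps"
  have W: "left_ideal W" "right_ideal W"
    using ideal[OF Ps] by (auto simp: W_def two_sided_ideal_def)
  have WW: "set_product W W = W"
  proof -
    have "?f (Ps @ Ps) = set_product W W"
      using fold[OF W(1), of Ps] by (simp add: W_def)
    then show ?thesis
      using min[of "Ps @ Ps"] Ps set_product_subset_right_ideal[OF W(2), of W] by (simp add: W_def)
  qed
  have PW: "W \<subseteq> P" if P: "P \<in> ?C" for P
  proof -
    have "?f (P # Ps) = set_product P W"
      by (simp add: W_def)
    then have "set_product P W = W"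
      using min[of "P # Ps"] Ps P set_product_subset_left_ideal[OF W(1), of P] by (simp add: W_def)
    then show ?thesis
      using set_product_subset_right_ideal[OF two_sided_ideal_right[OF cores[OF P]], of W] by simp
  qed
  have "W = {0}"
  proof (rule ccontr)
    assume nz: "W \<noteq> {0}"
    define T where "T = {U. right_ideal U \<and> (\<exists>u\<in>U. \<exists>w\<in>W. u * w \<noteq> 0)}"
    obtain w0 where "w0 \<in> W" "w0 \<noteq> 0"
      using nz right_ideal_zero[OF W(2)] by blast
    then have "UNIV \<in> T"
      using U two_sided_ideal_right by (auto simp: T_def intro!: exI[of _ 1] bexI[of _ w0])
    then have "\<exists>U\<in>T. \<forall>N\<in>T. N \<subseteq> U \<longrightarrow> N = U"
      by (intro right_artinian_minimal[OF art]) (auto simp: T_def)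
    then obtain U where "U \<in> T" and Umin: "\<forall>N\<in>T. N \<subseteq> U \<longrightarrow> N = U"
      by (elim bexE)
    then have U: "right_ideal U" "\<exists>u\<in>U. \<exists>w\<in>W. u * w \<noteq> 0"
      by (auto simp: T_def)
    then obtain u w where u: "u \<in> U" "w \<in> W" "u * w \<noteq> 0"
      by blast
    let ?N = "(*) u ` W"
    have rN: "right_ideal ?N"
    proof (rule right_idealI_diff)
      show "0 \<in> ?N"
        using right_ideal_zero[OF W(2)] by (auto intro: image_eqI[of _ _ 0])
      fix x y assume "x \<in> ?N" "y \<in> ?N"
      then obtain a b where "x = u * a" "y = u * b" "a \<in> W" "b \<in> W"
        by auto
      then show "x - y \<in> ?N"
        using right_ideal_diff[OF W(2)] by (auto simp: right_diff_distrib[symmetric])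
    next
      fix x r assume "x \<in> ?N"
      then show "x * r \<in> ?N"
        using right_ideal_mult[OF W(2)] by (auto simp: mult.assoc)
    qed
    have "\<exists>x\<in>?N. \<exists>w\<in>W. x * w \<noteq> 0"
    proof (rule ccontr)
      assume no: "\<not> ?thesis"
      have "u * z = 0" if "z \<in> set_product W W" for z
        using that by (induction rule: set_product_induct)
          (use no in \<open>auto simp: mult.assoc[symmetric] right_diff_distrib\<close>)
      then show False
        using u WW by blast
    qed
    moreover have "?N \<subseteq> U"
      using right_ideal_mult[OF U(1) u(1)] by auto
    ultimately have "?N = U"
      using Umin rN by (auto simp: T_def simp del: image_subset_iff)
    then have "u \<in> ?N"
      using u by simp
    then obtain w' where w': "w' \<in> W" "u = u * w'"
      by blast
    let ?A = "{q. u * q = 0}"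
    have "right_ideal ?A" "1 \<notin> ?A"
      using u by (auto simp: right_ideal_def distrib_left mult.assoc[symmetric])
    then obtain M where M: "maximal_right_ideal M" "?A \<subseteq> M"
      using maximal_right_ideal_exists by blast
    have "w' \<in> core M"
      using PW[of "core M"] M w' by blast
    then have "1 * w' \<in> M"
      unfolding core_def by blast
    moreover have "1 - w' \<in> M"
      using M w' by (auto simp: right_diff_distrib)
    ultimately show False
      using M right_ideal_add[of M "1 - w'" w'] by (simp add: maximal_right_ideal_def)
  qed
  then show ?thesis
    using Ps unfolding W_def by blast
qed

text \<open>Distinct maximal ideals have sum \<open>Q\<close>, so each \<open>P'\<close> contains
  some \<open>y\<close> congruent to \<open>1\<close> modulo \<open>P\<close>;
  \<open>\<epsilon>\<close> is a product of such \<open>y\<close>. It serves to glue data given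
  separately at each \<open>P\<close>.\<close>

lemma maximal_ideals_crt:
  assumes "finite \<P>" "\<And>P. P \<in> \<P> \<Longrightarrow> maximal_ideal P" and P: "P \<in> \<P>"
  shows "\<exists>\<epsilon>. \<epsilon> - 1 \<in> P \<and> (\<forall>P'\<in>\<P> - {P}. \<epsilon> \<in> P')"
proof -
  have maxP: "maximal_ideal P"
    using assms by blast
  then have rP: "right_ideal P" and lP: "left_ideal P"
    by (auto simp: maximal_ideal_def two_sided_ideal_def)
  have "\<exists>\<epsilon>. \<epsilon> - 1 \<in> P \<and> (\<forall>P'\<in>\<G>. \<epsilon> \<in> P')" if "finite \<G>" "\<G> \<subseteq> \<P> - {P}" for \<G>
    using that
  proof (induction \<G>)
    case empty
    show ?case
      using right_ideal_zero[OF rP] by (intro exI[of _ 1]) auto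
  next
    case (insert P' \<G>)
    then obtain \<epsilon> where \<epsilon>: "\<epsilon> - 1 \<in> P" "\<forall>P'\<in>\<G>. \<epsilon> \<in> P'"
      by blast
    have maxP': "maximal_ideal P'" "P' \<noteq> P"
      using insert assms by auto
    then have rP': "right_ideal P'" and lP': "left_ideal P'"
      by (auto simp: maximal_ideal_def two_sided_ideal_def)
    have sum: "two_sided_ideal (ideal_sum P P')"
      using rP lP rP' lP' by (simp add: two_sided_ideal_def right_ideal_ideal_sum left_ideal_ideal_sum)
    have "1 \<in> ideal_sum P P'"
    proof (rule ccontr)
      assume "1 \<notin> ideal_sum P P'"
      then have "ideal_sum P P' = P" "ideal_sum P P' = P'"
        using maxP maxP' sum ideal_sum_left[OF rP', of P] ideal_sum_right[OF rP, of P']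
        unfolding maximal_ideal_def by blast+
      with maxP' show False
        by simp
    qed
    then obtain p y where py: "p \<in> P" "y \<in> P'" "1 = p + y"
      by (auto simp: ideal_sum_def)
    have "y - 1 \<in> P"
      using right_ideal_uminus[OF rP py(1)] unfolding py(3) by simp
    have "\<epsilon> * y - 1 = (\<epsilon> - 1) * y + (y - 1)"
      by (simp add: algebra_simps)
    also have "\<dots> \<in> P"
      by (intro right_ideal_add[OF rP] right_ideal_mult[OF rP] \<epsilon> \<open>y - 1 \<in> P\<close>)
    finally have "\<epsilon> * y - 1 \<in> P" .
    moreover have "\<epsilon> * y \<in> P''" if "P'' \<in> insert P' \<G>" for P''
    proof (cases "P'' = P'")
      case True
      then show ?thesis
        using left_ideal_mult[OF lP' py(2)] by simp
    next
      case False
      then have "P'' \<in> \<G>" "P'' \<in> \<P>"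
        using that insert by auto
      then have "right_ideal P''"
        using assms by (auto simp: maximal_ideal_def two_sided_ideal_def)
      then show ?thesis
        using \<epsilon>(2) \<open>P'' \<in> \<G>\<close> right_ideal_mult by blast
    qed
    ultimately show ?case
      by blast
  qed
  from this[of "\<P> - {P}"] show ?thesis
    using assms by blast
qed

section \<open>Simultaneous generation modulo the maximal ideals\<close>

text \<open>The \<open>m j\<close> are \<open>r\<close> vectors of length \<open>n\<close>. When
  their entries lie in \<open>X\<close> and \<open>Z \<subseteq> X\<close>, they are to generate the
  \<open>n\<close>-th power of the right module \<open>X / Z\<close>.\<close>

definition generates_mod ::
    "'q::{ring,monoid_mult} set \<Rightarrow> 'q set \<Rightarrow> nat \<Rightarrow> nat \<Rightarrow> (nat \<Rightarrow> nat \<Rightarrow> 'q) \<Rightarrow> bool"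
  where "generates_mod X Z n r m \<longleftrightarrow>
    (\<forall>y. (\<forall>u<n. y u \<in> X) \<longrightarrow> (\<exists>a. \<forall>u<n. y u - (\<Sum>j<r. m j u * a j) \<in> Z))"

text \<open>For \<open>Z = X P + X'\<close>, this and generation together say that the
  \<open>m j\<close> form a basis over \<open>Q / P\<close>; for \<open>Z = X'\<close> it bounds the
  coefficients of all relations by \<open>P\<close>.\<close>

definition independent_mod ::
    "'q::{ring,monoid_mult} set \<Rightarrow> 'q set \<Rightarrow> nat \<Rightarrow> nat \<Rightarrow> (nat \<Rightarrow> nat \<Rightarrow> 'q) \<Rightarrow> bool"
  where "independent_mod Z P n r m \<longleftrightarrow>
    (\<forall>a. (\<forall>u<n. (\<Sum>j<r. m j u * a j) \<in> Z) \<longrightarrow> (\<forall>j<r. a j \<in> P))"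

lemma matrix_units_decomposition:
  assumes mu: "matrix_units P l e" and P: "two_sided_ideal P"
  shows "1 - (\<Sum>u<l. e u 0 * e 0 0 * e 0 u) \<in> P"
proof -
  have l0: "0 < l"
    and prod: "\<And>u w y z. u < l \<Longrightarrow> w < l \<Longrightarrow> y < l \<Longrightarrow> z < l \<Longrightarrow>
      e u w * e y z - (if w = y then e u z else 0) \<in> P"
    and one: "1 - (\<Sum>u<l. e u u) \<in> P"
    using mu by (auto simp: matrix_units_def)
  note rP = two_sided_ideal_right[OF P]
  have "(e u 0 * e 0 0 - e u 0) * e 0 u + (e u 0 * e 0 u - e u u) \<in> P" if "u < l" for u
    using right_ideal_add[OF rP right_ideal_mult[OF rP, of "e u 0 * e 0 0 - e u 0"]]
      prod[OF that l0 l0 l0] prod[OF that l0 l0 that] by simp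
  then have "e u 0 * e 0 0 * e 0 u - e u u \<in> P" if "u < l" for u
    using that by (simp add: algebra_simps)
  then have "(\<Sum>u<l. e u 0 * e 0 0 * e 0 u - e u u) \<in> P"
    by (intro right_ideal_sum[OF rP]) auto
  from right_ideal_diff[OF rP one this] show ?thesis
    by (simp add: sum_subtractf)
qed

text \<open>Put \<open>f = e 0 0\<close>. Modulo \<open>P\<close>, \<open>(X / X') f\<close> is a
  finite dimensional vector space over the corner division ring, so \<open>X / X'\<close> becomes a
  sum of \<open>r\<close> copies of the simple module \<open>f Q\<close>. Since \<open>l\<close>
  copies of the latter make up \<open>Q / P\<close>, it is the \<open>l\<close>-th power of
  \<open>X / X'\<close> that is free, of rank \<open>r\<close>, with basis vectors
  \<open>V j * e 0 u\<close> for a basis \<open>V\<close> of the corner part.\<close>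

lemma generates_independent_block:
  fixes X :: "'q::{ring,monoid_mult} set" and N :: nat
  assumes mu: "matrix_units P l e" and P: "two_sided_ideal P"
    and X: "right_ideal X" and X': "right_ideal X'"
    and x: "\<And>i. i < N \<Longrightarrow> x i \<in> X" and gen: "\<And>y. y \<in> X \<Longrightarrow> \<exists>a. y - (\<Sum>i<N. x i * a i) \<in> X'"
  defines "Z \<equiv> ideal_sum (set_product X P) X'"
  shows "\<exists>r m. (\<forall>j<r. \<forall>u<l. m j u \<in> X) \<and> generates_mod X Z l r m \<and> independent_mod Z P l r m"
proof -
  have l0: "0 < l"
    and prod: "\<And>u w y z. u < l \<Longrightarrow> w < l \<Longrightarrow> y < l \<Longrightarrow> z < l \<Longrightarrow>
      e u w * e y z - (if w = y then e u z else 0) \<in> P"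
    and div: "\<And>d. e 0 0 * d * e 0 0 \<notin> P \<Longrightarrow> \<exists>d'. e 0 0 * d * e 0 0 * d' - e 0 0 \<in> P"
    using mu by (auto simp: matrix_units_def)
  note rP = two_sided_ideal_right[OF P] and lP = two_sided_ideal_left[OF P]
  define f where "f = e 0 0"
  define t where "t = (\<Sum>u<l. e u 0 * f * e 0 u)"
  have t: "1 - t \<in> P"
    unfolding t_def f_def by (rule matrix_units_decomposition[OF mu P])
  have rZ: "right_ideal Z"
    unfolding Z_def by (intro right_ideal_ideal_sum right_ideal_set_product rP X')
  have XP: "y * p \<in> Z" if "y \<in> X" "p \<in> P" for y p
    unfolding Z_def using ideal_sum_left[OF X'] set_product_intro[OF that] by blast
  have X'Z: "y \<in> Z" if "y \<in> X'" for y
    unfolding Z_def using ideal_sum_right[OF right_ideal_set_product[OF rP]] that by blast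
  define w where "w = (\<lambda>(i, u). x i * e u 0)"
  define K where "K = {..<N} \<times> {..<l}"
  have wX: "w k \<in> X" if "k \<in> K" for k
    using that x right_ideal_mult[OF X] by (auto simp: w_def K_def)
  \<comment> \<open>The \<open>w k\<close> with \<open>k \<in> I\<close> span the corner part. A
    spanning set of least size takes the place of a basis.\<close>
  define G where "G I \<longleftrightarrow> I \<subseteq> K \<and> (\<forall>y\<in>X. \<exists>c. y * f - (\<Sum>k\<in>I. w k * f * c k * f) \<in> Z)" for I
  have "G K"
    unfolding G_def
  proof (intro conjI ballI order_refl)
    fix y assume "y \<in> X"
    then obtain a where a: "y - (\<Sum>i<N. x i * a i) \<in> X'"
      using gen by blast
    have summand: "x i * a i * f - (\<Sum>u<l. x i * e u 0 * f * (e 0 u * a i) * f) \<in> Z" if "i < N" for i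
    proof -
      have "x i * ((1 - t) * (a i * f)) \<in> Z"
        using that by (intro XP x right_ideal_mult[OF rP] t)
      also have "x i * ((1 - t) * (a i * f)) = x i * a i * f - (\<Sum>u<l. x i * e u 0 * f * (e 0 u * a i) * f)"
        by (simp add: t_def algebra_simps sum_distrib_left sum_distrib_right)
      finally show ?thesis .
    qed
    have "(y - (\<Sum>i<N. x i * a i)) * f + (\<Sum>i<N. x i * a i * f - (\<Sum>u<l. x i * e u 0 * f * (e 0 u * a i) * f)) \<in> Z"
      by (rule right_ideal_add[OF rZ right_ideal_mult[OF rZ X'Z[OF a]] right_ideal_sum[OF rZ]])
        (use summand in auto)
    also have "(y - (\<Sum>i<N. x i * a i)) * f + (\<Sum>i<N. x i * a i * f - (\<Sum>u<l. x i * e u 0 * f * (e 0 u * a i) * f))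
        = y * f - (\<Sum>(i,u)\<in>K. x i * e u 0 * f * (e 0 u * a i) * f)"
      by (simp add: K_def sum_subtractf sum.cartesian_product left_diff_distrib sum_distrib_right)
    finally show "\<exists>c. y * f - (\<Sum>k\<in>K. w k * f * c k * f) \<in> Z"
      by (intro exI[of _ "\<lambda>(i, u). e 0 u * a i"]) (simp add: w_def case_prod_unfold)
  qed
  then obtain I where I: "G I" and Imin: "\<And>J. G J \<Longrightarrow> card I \<le> card J"
    using ex_has_least_nat[of G K card] by auto
  have IK: "I \<subseteq> K"
    using I by (simp add: G_def)
  have "finite K"
    unfolding K_def by (intro finite_cartesian_product) auto
  then have finI: "finite I"
    using IK finite_subset by blast
  \<comment> \<open>A coefficient outside \<open>P\<close> is invertible in the corner; solving for
    \<open>w k0\<close> would give a smaller spanning set.\<close>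
  have indep: "f * c k0 * f \<in> P" if c: "(\<Sum>k\<in>I. w k * f * c k * f) \<in> Z" and k0: "k0 \<in> I" for c k0
  proof (rule ccontr)
    assume "f * c k0 * f \<notin> P"
    then obtain d where d: "f * c k0 * f * d - f \<in> P"
      using div unfolding f_def by blast
    have "G (I - {k0})"
      unfolding G_def
    proof (intro conjI ballI)
      show "I - {k0} \<subseteq> K"
        using IK by blast
      fix y assume "y \<in> X"
      then obtain b where b: "y * f - (\<Sum>k\<in>I. w k * f * b k * f) \<in> Z"
        using I by (auto simp: G_def)
      let ?s = "(\<Sum>k\<in>I. w k * f * c k * f) * (d * b k0 * f)"
      have "w k0 * ((f * c k0 * f * d - f) * (b k0 * f)) \<in> Z"
        using k0 IK by (intro XP wX right_ideal_mult[OF rP] d) auto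
      then have "(y * f - (\<Sum>k\<in>I. w k * f * b k * f)) - w k0 * ((f * c k0 * f * d - f) * (b k0 * f)) + ?s \<in> Z"
        by (rule right_ideal_add[OF rZ right_ideal_diff[OF rZ b] right_ideal_mult[OF rZ c]])
      also have "(y * f - (\<Sum>k\<in>I. w k * f * b k * f)) - w k0 * ((f * c k0 * f * d - f) * (b k0 * f)) + ?s
          = y * f - (\<Sum>k\<in>I - {k0}. w k * f * (b k - c k * f * d * b k0) * f)"
        using sum.remove[OF finI k0, of "\<lambda>k. w k * f * b k * f"]
          sum.remove[OF finI k0, of "\<lambda>k. w k * f * c k * f"]
        by (simp add: algebra_simps sum_subtractf sum_distrib_right)
      finally show "\<exists>c. y * f - (\<Sum>k\<in>I - {k0}. w k * f * c k * f) \<in> Z"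
        by (rule exI[of _ "\<lambda>k. b k - c k * f * d * b k0"])
    qed
    then have "card I \<le> card (I - {k0})"
      by (rule Imin)
    then show False
      using card_Diff1_less[OF finI k0] by simp
  qed
  define r where "r = card I"
  obtain b where b: "bij_betw b {..<r} I"
    using finI r_def ex_bij_betw_nat_finite[of I] by (auto simp: atLeast0LessThan)
  have bI: "b j \<in> I" if "j < r" for j
    using b that by (auto simp: bij_betw_def)
  have sum_I: "(\<Sum>k\<in>I. g k) = (\<Sum>j<r. g (b j))" for g :: "nat \<times> nat \<Rightarrow> 'q"
    using sum.reindex_bij_betw[OF b, of g] by simp
  define V where "V j = w (b j) * f" for j
  have VX: "V j \<in> X" if "j < r" for j
    unfolding V_def using bI[OF that] IK by (intro right_ideal_mult[OF X] wX) auto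
  have m_gen: "generates_mod X Z l r (\<lambda>j u. V j * e 0 u)"
    unfolding generates_mod_def
  proof (intro allI impI)
    fix y assume y: "\<forall>u<l. y u \<in> X"
    have "\<exists>c. y u * e v 0 * f - (\<Sum>j<r. V j * c j * f) \<in> Z" if u: "u < l" for u v
    proof -
      have "y u * e v 0 \<in> X"
        using y u right_ideal_mult[OF X] by blast
      then obtain c where "y u * e v 0 * f - (\<Sum>k\<in>I. w k * f * c k * f) \<in> Z"
        using I unfolding G_def by blast
      then have "y u * e v 0 * f - (\<Sum>j<r. V j * c (b j) * f) \<in> Z"
        by (simp add: sum_I V_def)
      then show ?thesis
        by (rule exI[of _ "\<lambda>j. c (b j)"])
    qed
    then obtain c where c: "\<And>u v. u < l \<Longrightarrow> y u * e v 0 * f - (\<Sum>j<r. V j * c u v j * f) \<in> Z"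
      by metis
    \<comment> \<open>As \<open>e 0 u * e u' 0\<close> is \<open>f\<close> for \<open>u = u'\<close>
      and zero otherwise modulo \<open>P\<close>, the factor \<open>e u 0\<close> lets one
      coefficient \<open>a j\<close> serve all components \<open>u\<close>. The sum over
      \<open>v\<close> reassembles \<open>y u\<close> from its parts
      \<open>y u * e v 0 * f\<close>.\<close>
    define a where "a j = (\<Sum>u<l. \<Sum>v<l. e u 0 * c u v j * f * e 0 v)" for j
    show "\<exists>a. \<forall>u<l. y u - (\<Sum>j<r. V j * e 0 u * a j) \<in> Z"
    proof (intro exI[of _ a] allI impI)
      fix u assume u: "u < l"
      have yt: "y u * (1 - t) \<in> Z"
        using y u by (intro XP t) auto
      have s1: "(\<Sum>v<l. (y u * e v 0 * f - (\<Sum>j<r. V j * c u v j * f)) * e 0 v) \<in> Z"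
        by (intro right_ideal_sum[OF rZ] right_ideal_mult[OF rZ] c u)
      have Vj: "V j * (\<Sum>v<l. c u v j * f * e 0 v) - V j * e 0 u * a j \<in> Z" if j: "j < r" for j
      proof -
        let ?h = "\<lambda>u'. \<Sum>v<l. c u' v j * f * e 0 v"
        have "V j * ?h u - V j * e 0 u * e u 0 * ?h u \<in> Z"
        proof -
          have "w (b j) * ((f * f - f) * ?h u) \<in> Z" "V j * ((e 0 u * e u 0 - f) * ?h u) \<in> Z"
            using bI[OF j] IK VX[OF j] prod[OF l0 l0 l0 l0] prod[OF l0 u u l0] unfolding f_def
            by (intro XP wX right_ideal_mult[OF rP]; auto)+
          from right_ideal_add[OF rZ this] show ?thesis
            using right_ideal_uminus[OF rZ] by (fastforce simp: V_def algebra_simps)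
        qed
        moreover have "V j * e 0 u * e u' 0 * ?h u' \<in> Z" if "u' \<in> {..<l} - {u}" for u'
        proof -
          have "V j * ((e 0 u * e u' 0) * ?h u') \<in> Z"
            by (rule XP[OF VX[OF j] right_ideal_mult[OF rP]])
              (use that prod[OF l0 u _ l0, of u'] in auto)
          then show ?thesis
            by (simp add: mult.assoc)
        qed
        ultimately have "V j * ?h u - V j * e 0 u * e u 0 * ?h u - (\<Sum>u'\<in>{..<l} - {u}. V j * e 0 u * e u' 0 * ?h u') \<in> Z"
          by (intro right_ideal_diff[OF rZ _ right_ideal_sum[OF rZ]])
        moreover have "V j * e 0 u * a j = (\<Sum>u'<l. V j * e 0 u * e u' 0 * ?h u')"
          by (simp add: a_def sum_distrib_left mult.assoc)
        ultimately show ?thesis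
          using u by (simp add: sum.remove[of "{..<l}" u] diff_diff_eq)
      qed
      have "y u * (1 - t) + (\<Sum>v<l. (y u * e v 0 * f - (\<Sum>j<r. V j * c u v j * f)) * e 0 v)
          + (\<Sum>j<r. V j * (\<Sum>v<l. c u v j * f * e 0 v) - V j * e 0 u * a j) \<in> Z"
        using Vj by (intro right_ideal_add[OF rZ] yt s1 right_ideal_sum[OF rZ]) auto
      also have "y u * (1 - t) + (\<Sum>v<l. (y u * e v 0 * f - (\<Sum>j<r. V j * c u v j * f)) * e 0 v)
          + (\<Sum>j<r. V j * (\<Sum>v<l. c u v j * f * e 0 v) - V j * e 0 u * a j)
          = y u - (\<Sum>j<r. V j * e 0 u * a j)"
      proof -
        have "(\<Sum>v<l. (\<Sum>j<r. V j * c u v j * f) * e 0 v) = (\<Sum>j<r. V j * (\<Sum>v<l. c u v j * f * e 0 v))"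
          by (simp add: sum_distrib_left sum_distrib_right mult.assoc) (rule sum.swap)
        then show ?thesis
          by (simp add: t_def right_diff_distrib left_diff_distrib sum_subtractf sum_distrib_left mult.assoc)
      qed
      finally show "y u - (\<Sum>j<r. V j * e 0 u * a j) \<in> Z" .
    qed
  qed
  have m_indep: "independent_mod Z P l r (\<lambda>j u. V j * e 0 u)"
    unfolding independent_mod_def
  proof (intro allI impI)
    fix a j assume a: "\<forall>u<l. (\<Sum>j<r. V j * e 0 u * a j) \<in> Z" and j: "j < r"
    have cP: "f * (e 0 u * a j * e v 0) * f \<in> P" if u: "u < l" for u v
    proof -
      define c where "c k = e 0 u * a (inv_into {..<r} b k) * e v 0" for k
      have cb: "c (b i) = e 0 u * a i * e v 0" if "i < r" for i
        using b that by (simp add: c_def bij_betw_inv_into_left)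
      have "(\<Sum>j<r. V j * e 0 u * a j) * (e v 0 * f) \<in> Z"
        using a u right_ideal_mult[OF rZ] by blast
      also have "(\<Sum>j<r. V j * e 0 u * a j) * (e v 0 * f) = (\<Sum>k\<in>I. w k * f * c k * f)"
        by (simp add: sum_I cb V_def sum_distrib_right mult.assoc)
      finally have "f * c (b j) * f \<in> P"
        using indep bI[OF j] by blast
      then show ?thesis
        by (simp add: cb j)
    qed
    have "t * a j * t = (\<Sum>u<l. \<Sum>v<l. e u 0 * (f * (e 0 u * a j * e v 0) * f) * e 0 v)"
      by (simp add: t_def sum_distrib_left sum_distrib_right mult.assoc) (rule sum.swap)
    also have "\<dots> \<in> P"
      by (intro right_ideal_sum[OF rP] right_ideal_mult[OF rP left_ideal_mult[OF lP cP]]) auto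
    finally have "t * a j * t \<in> P" .
    moreover have "a j - t * a j * t = (1 - t) * a j + t * a j * (1 - t)"
      by (simp add: algebra_simps)
    moreover have "\<dots> \<in> P"
      by (rule right_ideal_add[OF rP right_ideal_mult[OF rP t] left_ideal_mult[OF lP t]])
    ultimately show "a j \<in> P"
      using right_ideal_iff_diff[OF rP] by metis
  qed
  show ?thesis
    using VX right_ideal_mult[OF X] m_gen m_indep by (intro exI[of _ r] exI[of _ "\<lambda>j u. V j * e 0 u"]) auto
qed

lemma block_sum:
  fixes g :: "nat \<Rightarrow> 'q::comm_monoid_add"
  assumes "q < s"
  shows "(\<Sum>j<r * s. if j div r = q then g j else 0) = (\<Sum>b<r. g (r * q + b))"
proof (cases "r = 0")
  case False
  have "{j \<in> {..<r * s}. j div r = q} = (\<lambda>b. r * q + b) ` {..<r}"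
  proof (rule set_eqI, rule iffI)
    fix j assume "j \<in> {j \<in> {..<r * s}. j div r = q}"
    then have "j = r * q + j mod r" "j mod r < r"
      using False by auto
    then show "j \<in> (\<lambda>b. r * q + b) ` {..<r}"
      by blast
  next
    fix j assume "j \<in> (\<lambda>b. r * q + b) ` {..<r}"
    then obtain b where b: "b < r" "j = r * q + b"
      by auto
    have "r * (q + 1) \<le> r * s"
      using assms by (intro mult_le_mono) auto
    then show "j \<in> {j \<in> {..<r * s}. j div r = q}"
      using b by auto
  qed
  then have "(\<Sum>j<r * s. if j div r = q then g j else 0) = sum g ((\<lambda>b. r * q + b) ` {..<r})"
    by (simp add: sum.If_cases Int_def)
  also have "\<dots> = (\<Sum>b<r. g (r * q + b))"
    by (subst sum.reindex) (auto simp: inj_on_def)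
  finally show ?thesis .
qed simp

text \<open>A block diagonal matrix of \<open>s\<close> copies of \<open>m\<close>, of rank
  \<open>r * s\<close>; \<open>j div r\<close> and \<open>u div n\<close> number the blocks.\<close>

lemma generates_independent_multiple:
  fixes X :: "'q::{ring,monoid_mult} set"
  assumes "\<forall>j<r. \<forall>u<n. m j u \<in> X" "generates_mod X Z n r m" "independent_mod Z P n r m"
    and "right_ideal X" "0 < n"
  shows "\<exists>r' m'. (\<forall>j<r'. \<forall>u<n * s. m' j u \<in> X) \<and> generates_mod X Z (n * s) r' m' \<and>
    independent_mod Z P (n * s) r' m'"
proof -
  define m' where "m' j u = (if j div r = u div n then m (j mod r) (u mod n) else 0)" for j u
  have div_less: "u div n < s" if "u < n * s" for u
    using that by (simp add: less_mult_imp_div_less mult.commute)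
  have sum_m': "(\<Sum>j<r * s. m' j u * a j) = (\<Sum>b<r. m b (u mod n) * a (r * (u div n) + b))"
    if "u < n * s" for u a
  proof -
    have "(\<Sum>j<r * s. m' j u * a j) = (\<Sum>j<r * s. if j div r = u div n then m (j mod r) (u mod n) * a j else 0)"
      by (intro sum.cong) (auto simp: m'_def)
    also have "\<dots> = (\<Sum>b<r. m ((r * (u div n) + b) mod r) (u mod n) * a (r * (u div n) + b))"
      by (rule block_sum[OF div_less[OF that]])
    finally show ?thesis
      by simp
  qed
  have pos: "n * q + u < n * s" "(n * q + u) div n = q" "(n * q + u) mod n = u" if "u < n" "q < s" for u q
  proof -
    have "n * (q + 1) \<le> n * s"
      using that by (intro mult_le_mono) auto
    then show "n * q + u < n * s"
      using that by simp
  qed (use that in auto)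
  have m'X: "m' j u \<in> X" if "j < r * s" "u < n * s" for j u
  proof -
    have "0 < r"
      using that by (cases r) auto
    then show ?thesis
      using assms(1,5) right_ideal_zero[OF assms(4)] unfolding m'_def by simp
  qed
  have "generates_mod X Z (n * s) (r * s) m'"
    unfolding generates_mod_def
  proof (intro allI impI)
    fix y assume y: "\<forall>u<n * s. y u \<in> X"
    have "\<exists>a. \<forall>u<n. y (n * q + u) - (\<Sum>j<r. m j u * a j) \<in> Z" if "q < s" for q
      using assms(2)[unfolded generates_mod_def, rule_format, of "\<lambda>u. y (n * q + u)"] y pos(1)[OF _ that]
      by simp
    then obtain a where a: "\<And>q u. q < s \<Longrightarrow> u < n \<Longrightarrow> y (n * q + u) - (\<Sum>j<r. m j u * a q j) \<in> Z"
      by metis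
    show "\<exists>a. \<forall>u<n * s. y u - (\<Sum>j<r * s. m' j u * a j) \<in> Z"
    proof (intro exI[of _ "\<lambda>j. a (j div r) (j mod r)"] allI impI)
      fix u assume u: "u < n * s"
      have "(\<Sum>j<r * s. m' j u * a (j div r) (j mod r)) = (\<Sum>j<r. m j (u mod n) * a (u div n) j)"
        unfolding sum_m'[OF u] by (intro sum.cong) auto
      then show "y u - (\<Sum>j<r * s. m' j u * a (j div r) (j mod r)) \<in> Z"
        using a[OF div_less[OF u], of "u mod n"] \<open>0 < n\<close> by simp
    qed
  qed
  moreover have "independent_mod Z P (n * s) (r * s) m'"
    unfolding independent_mod_def
  proof (intro allI impI)
    fix a j assume a: "\<forall>u<n * s. (\<Sum>j<r * s. m' j u * a j) \<in> Z" and j: "j < r * s"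
    define q where "q = j div r"
    have q: "q < s" and "0 < r"
      using j by (auto simp: q_def less_mult_imp_div_less mult.commute intro: Nat.gr0I)
    have "\<forall>u<n. (\<Sum>b<r. m b u * a (r * q + b)) \<in> Z"
    proof (intro allI impI)
      fix u assume "u < n"
      then show "(\<Sum>b<r. m b u * a (r * q + b)) \<in> Z"
        using a[rule_format, OF pos(1)[OF _ q]] sum_m'[OF pos(1)[OF _ q]] pos(2,3)[OF _ q] by simp
    qed
    then have "a (r * q + j mod r) \<in> P"
      using assms(3)[unfolded independent_mod_def, rule_format, of "\<lambda>b. a (r * q + b)" "j mod r"] \<open>0 < r\<close>
      by simp
    then show "a j \<in> P"
      by (simp add: q_def)
  qed
  ultimately show ?thesis
    using m'X by blast
qed

text \<open>Nakayama's lemma with a vanishing product of ideals in place of the radical. Generation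
  modulo \<open>X P\<close> and modulo \<open>X W\<close> gives generation modulo
  \<open>X P W\<close>: an error \<open>x * c\<close> with \<open>c \<in> W\<close> is reduced by
  expressing \<open>x\<close> modulo \<open>X P\<close>. Along the whole list the error
  disappears.\<close>

lemma generates_mod_nakayama:
  fixes X :: "'q::{ring,monoid_mult} set"
  assumes X: "right_ideal X" and X': "right_ideal X'"
    and Ps: "foldr set_product Ps UNIV = {0}"
    and ideals: "\<And>P. P \<in> set Ps \<Longrightarrow> two_sided_ideal P"
    and gen: "\<And>P. P \<in> set Ps \<Longrightarrow> generates_mod X (ideal_sum (set_product X P) X') n r m"
  shows "generates_mod X X' n r m"
proof -
  let ?Z = "\<lambda>W. ideal_sum (set_product X W) X'"
  have step: "generates_mod X (?Z (set_product P W)) n r m"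
    if P: "two_sided_ideal P" "generates_mod X (?Z P) n r m" and W: "right_ideal W" "generates_mod X (?Z W) n r m" for P W
  proof -
    let ?Y = "?Z (set_product P W)"
    have rY: "right_ideal ?Y"
      by (intro right_ideal_ideal_sum right_ideal_set_product W X')
    define H where "H = {z. \<exists>a. \<forall>u<n. z u - (\<Sum>j<r. m j u * a j) \<in> ?Y}"
    have H_diff: "(\<lambda>u. z u - z' u) \<in> H" if zz': "z \<in> H" "z' \<in> H" for z z'
    proof -
      obtain a a' where a: "\<forall>u<n. z u - (\<Sum>j<r. m j u * a j) \<in> ?Y"
        "\<forall>u<n. z' u - (\<Sum>j<r. m j u * a' j) \<in> ?Y"
        using zz' unfolding H_def by blast
      have "\<forall>u<n. (z u - z' u) - (\<Sum>j<r. m j u * (a j - a' j)) \<in> ?Y"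
      proof (intro allI impI)
        fix u assume "u < n"
        then have "(z u - (\<Sum>j<r. m j u * a j)) - (z' u - (\<Sum>j<r. m j u * a' j)) \<in> ?Y"
          using a by (simp only: right_ideal_diff[OF rY])
        then show "(z u - z' u) - (\<Sum>j<r. m j u * (a j - a' j)) \<in> ?Y"
          by (simp add: right_diff_distrib sum_subtractf algebra_simps)
      qed
      then show ?thesis
        unfolding H_def by (intro CollectI exI[of _ "\<lambda>j. a j - a' j"])
    qed
    have H_Y: "z \<in> H" if "\<forall>u<n. z u \<in> ?Y" for z
      using that by (auto simp: H_def intro!: exI[of _ "\<lambda>_. 0"])
    have H_add: "(\<lambda>u. z u + z' u) \<in> H" if "z \<in> H" "z' \<in> H" for z z'
      using H_diff[OF that(1) H_diff[OF H_Y[of "\<lambda>_. 0"] that(2)]] right_ideal_zero[OF rY] by simp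
    have ZW_H: "(\<lambda>v. if v = u then z else 0) \<in> H" if z: "z \<in> ?Z W" and u: "u < n" for z u
    proof -
      have "(\<lambda>v. if v = u then z else 0) \<in> H" if "z \<in> set_product X W" for z
        using that
      proof (induction rule: set_product_induct)
        case zero
        show ?case
          by (rule H_Y) (use right_ideal_zero[OF rY] in auto)
      next
        case (mult x c)
        have "\<exists>a. \<forall>v<n. (if v = u then x else 0) - (\<Sum>j<r. m j v * a j) \<in> ?Z P"
          by (rule P(2)[unfolded generates_mod_def, rule_format])
            (use mult right_ideal_zero[OF X] in auto)
        then obtain a where a: "\<And>v. v < n \<Longrightarrow> (if v = u then x else 0) - (\<Sum>j<r. m j v * a j) \<in> ?Z P"
          by blast
        have ZP: "z * c \<in> ?Y" if z: "z \<in> ?Z P" for z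
        proof -
          obtain s x' where sx: "z = s + x'" "s \<in> set_product X P" "x' \<in> X'"
            using z by (auto simp: ideal_sum_def)
          then have "s * c \<in> set_product (set_product X P) W"
            using mult by (intro set_product_intro)
          then show ?thesis
            using sx right_ideal_mult[OF X'] by (simp add: distrib_right set_product_assoc ideal_sumI)
        qed
        have "(if v = u then x * c else 0) - (\<Sum>j<r. m j v * (a j * c)) \<in> ?Y" if "v < n" for v
          using ZP[OF a[OF that]] by (simp add: left_diff_distrib sum_distrib_right mult.assoc if_distrib[of "\<lambda>x. x * c"] cong: if_cong)
        then show ?case
          unfolding H_def by (intro CollectI exI[of _ "\<lambda>j. a j * c"]) blast
      next
        case (diff a b)
        have "(\<lambda>v. (if v = u then a else 0) - (if v = u then b else 0)) = (\<lambda>v. if v = u then a - b else 0)"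
          by auto
        then show ?case
          using H_diff[OF diff] by simp
      qed
      moreover obtain s x' where sx: "z = s + x'" "s \<in> set_product X W" "x' \<in> X'"
        using z by (auto simp: ideal_sum_def)
      moreover have "x' \<in> ?Y"
        using ideal_sum_right[OF right_ideal_set_product[OF right_ideal_set_product[OF W(1)]]] sx by blast
      then have "(\<lambda>v. if v = u then x' else 0) \<in> H"
        by (intro H_Y) (use right_ideal_zero[OF rY] in auto)
      ultimately have "(\<lambda>v. (if v = u then s else 0) + (if v = u then x' else 0)) \<in> H"
        by (intro H_add)
      moreover have "(\<lambda>v. (if v = u then s else 0) + (if v = u then x' else 0)) = (\<lambda>v. if v = u then z else 0)"
        using sx by auto
      ultimately show ?thesis
        by simp
    qed
    have H_sum: "(\<lambda>v. \<Sum>u<k. if v = u then z u else 0) \<in> H" if "\<forall>u<n. z u \<in> ?Z W" "k \<le> n" for z k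
      using that(2)
    proof (induction k)
      case 0
      show ?case
        by (rule H_Y) (use right_ideal_zero[OF rY] in auto)
    next
      case (Suc k)
      then show ?case
        using H_add[OF Suc.IH ZW_H[of "z k" k]] that(1) by simp
    qed
    show ?thesis
      unfolding generates_mod_def
    proof (intro allI impI)
      fix y assume y: "\<forall>u<n. y u \<in> X"
      obtain a where a: "\<forall>u<n. y u - (\<Sum>j<r. m j u * a j) \<in> ?Z W"
        using W(2) y unfolding generates_mod_def by blast
      from H_sum[OF this order_refl] obtain a' where
        "\<forall>v<n. (\<Sum>u<n. if v = u then y u - (\<Sum>j<r. m j u * a j) else 0) - (\<Sum>j<r. m j v * a' j) \<in> ?Y"
        by (auto simp: H_def)
      then have "\<forall>v<n. y v - (\<Sum>j<r. m j v * (a j + a' j)) \<in> ?Y"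
        by (simp add: distrib_left sum.distrib diff_diff_eq)
      then show "\<exists>a. \<forall>u<n. y u - (\<Sum>j<r. m j u * a j) \<in> ?Y"
        by (rule exI[of _ "\<lambda>j. a j + a' j"])
    qed
  qed
  have "generates_mod X (?Z (foldr set_product Qs UNIV)) n r m \<and> right_ideal (foldr set_product Qs (UNIV :: 'q set))"
    if "set Qs \<subseteq> set Ps" for Qs
    using that
  proof (induction Qs)
    case Nil
    have "y \<in> ?Z UNIV" if "y \<in> X" for y
      using ideal_sum_left[OF X'] that by (auto simp: set_product_UNIV_right[OF X])
    then show ?case
      by (auto simp: generates_mod_def right_ideal_def intro!: exI[of _ "\<lambda>_. 0"])
  next
    case (Cons P Qs)
    then show ?case
      using step[of P "foldr set_product Qs UNIV"] ideals gen right_ideal_set_product by auto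
  qed
  from this[of Ps] have "generates_mod X (?Z {0}) n r m"
    by (simp add: Ps)
  moreover have "?Z {0} = X'"
  proof -
    have "set_product X {0} = {0}"
    proof (rule antisym)
      show "set_product X {0} \<subseteq> {0}"
        by (rule set_product_subset_left_ideal) (auto simp: left_ideal_def)
    qed simp
    then show ?thesis
      by (auto simp: ideal_sum_def)
  qed
  ultimately show ?thesis
    by simp
qed

text \<open>If \<open>n\<close> is divisible by the sizes of all matrix rings \<open>Q / P\<close>, then \<open>(X / X')\<^sup>n\<close> becomes free modulo each
  maximal ideal \<open>P\<close>.  The relations have coefficients in a \<open>P\<close> at which the rank is maximal.\<close>

theorem generators_with_proper_relations:
  fixes X :: "'q::{ring,monoid_mult} set" and N :: nat
  assumes art: "right_artinian TYPE('q)" and nontriv: "(1::'q) \<noteq> 0"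
    and X: "right_ideal X" and X': "right_ideal X'"
    and x: "\<And>i. i < N \<Longrightarrow> x i \<in> X" and gen: "\<And>y. y \<in> X \<Longrightarrow> \<exists>a. y - (\<Sum>i<N. x i * a i) \<in> X'"
  shows "\<exists>n>0. \<exists>r m P. (\<forall>j<r. \<forall>u<n. m j u \<in> X) \<and> generates_mod X X' n r m \<and>
    independent_mod X' P n r m \<and> maximal_ideal P"
proof -
  let ?Z = "\<lambda>P. ideal_sum (set_product X P) X'"
  obtain Ps :: "'q set list" where Ps: "set Ps \<subseteq> core ` Collect maximal_right_ideal"
      and Ps0: "foldr set_product Ps UNIV = {0}"
    using product_of_cores_zero[OF art] by blast
  have max: "maximal_ideal P" if "P \<in> set Ps" for P
    using that Ps core_maximal_ideal[OF art] by auto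
  have ideals: "two_sided_ideal P" if "P \<in> set Ps" for P
    using max[OF that] by (simp add: maximal_ideal_def)
  have "Ps \<noteq> []"
  proof
    assume "Ps = []"
    then have "(1::'q) \<in> {0}"
      using Ps0 by (metis UNIV_I foldr_Nil id_apply)
    with nontriv show False
      by simp
  qed
  have "\<exists>l e. matrix_units P l e" if "P \<in> set Ps" for P
    using that Ps matrix_units_exist[OF art] by auto
  then obtain l e where mu: "\<And>P. P \<in> set Ps \<Longrightarrow> matrix_units P (l P) (e P)"
    by metis
  have l0: "0 < l P" if "P \<in> set Ps" for P
    using mu[OF that] by (auto simp: matrix_units_def)
  define n where "n = (\<Prod>P\<in>set Ps. l P)"
  have "0 < n"
    using l0 by (auto simp: n_def intro: prod_pos)
  have "\<exists>r m. (\<forall>j<r. \<forall>u<n. m j u \<in> X) \<and> generates_mod X (?Z P) n r m \<and> independent_mod (?Z P) P n r m"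
    if P: "P \<in> set Ps" for P
  proof -
    have "l P dvd n"
      unfolding n_def by (rule dvd_prodI) (use P in auto)
    then obtain s where s: "n = l P * s"
      by blast
    obtain r m where rm: "\<forall>j<r. \<forall>u<l P. m j u \<in> X" "generates_mod X (?Z P) (l P) r m"
        "independent_mod (?Z P) P (l P) r m"
      using generates_independent_block[OF mu[OF P] ideals[OF P] X X' x gen] by blast
    show ?thesis
      unfolding s by (rule generates_independent_multiple[OF rm X l0[OF P]])
  qed
  then obtain r m where m: "\<And>P j u. P \<in> set Ps \<Longrightarrow> j < r P \<Longrightarrow> u < n \<Longrightarrow> m P j u \<in> X"
      and m_gen: "\<And>P. P \<in> set Ps \<Longrightarrow> generates_mod X (?Z P) n (r P) (m P)"
      and m_ind: "\<And>P. P \<in> set Ps \<Longrightarrow> independent_mod (?Z P) P n (r P) (m P)"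
    by metis
  define R where "R = Max (r ` set Ps)"
  have rR: "r P \<le> R" if "P \<in> set Ps" for P
    using that by (auto simp: R_def)
  obtain P0 where P0: "P0 \<in> set Ps" "r P0 = R"
  proof -
    have "R \<in> r ` set Ps"
      unfolding R_def by (rule Max_in) (use \<open>Ps \<noteq> []\<close> in auto)
    then show thesis
      using that by blast
  qed
  have "\<exists>\<epsilon>. \<epsilon> - 1 \<in> P \<and> (\<forall>P'\<in>set Ps - {P}. \<epsilon> \<in> P')" if "P \<in> set Ps" for P
    using maximal_ideals_crt[of "set Ps" P] max that by auto
  then obtain \<epsilon> where \<epsilon>1: "\<And>P. P \<in> set Ps \<Longrightarrow> \<epsilon> P - 1 \<in> P"
      and \<epsilon>0: "\<And>P P'. P \<in> set Ps \<Longrightarrow> P' \<in> set Ps \<Longrightarrow> P' \<noteq> P \<Longrightarrow> \<epsilon> P \<in> P'"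
    by (metis Diff_iff empty_iff insert_iff)
  \<comment> \<open>Zero vectors pad each list to the common length \<open>R\<close>, and gluing
    with \<open>\<epsilon>\<close> makes \<open>M\<close> congruent to the padded list at every
    \<open>P\<close>. At \<open>P0\<close> there is no padding, so independence survives
    there.\<close>
  define c where "c P j u = (if j < r P then m P j u else 0)" for P j u
  define M where "M j u = (\<Sum>P\<in>set Ps. c P j u * \<epsilon> P)" for j u
  have cX: "c P j u \<in> X" if "P \<in> set Ps" "u < n" for P j u
    using m that right_ideal_zero[OF X] by (simp add: c_def)
  have MX: "M j u \<in> X" if "u < n" for j u
    unfolding M_def using that cX by (intro right_ideal_sum[OF X] right_ideal_mult[OF X]) auto
  have rZ: "right_ideal (?Z P)" if "P \<in> set Ps" for P
    by (rule right_ideal_ideal_sum[OF right_ideal_set_product[OF two_sided_ideal_right[OF ideals[OF that]]] X'])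
  have M_c: "M j u - c P j u \<in> ?Z P" if P: "P \<in> set Ps" and u: "u < n" for P j u
  proof -
    have XP: "y * p \<in> ?Z P" if "y \<in> X" "p \<in> P" for y p
      using ideal_sum_left[OF X'] set_product_intro[OF that] by blast
    have "M j u - c P j u = c P j u * (\<epsilon> P - 1) + (\<Sum>P'\<in>set Ps - {P}. c P' j u * \<epsilon> P')"
      unfolding M_def using P by (subst sum.remove[of _ P]) (auto simp: algebra_simps)
    also have "\<dots> \<in> ?Z P"
      using P u by (intro right_ideal_add[OF rZ[OF P]] right_ideal_sum[OF rZ[OF P]] XP cX \<epsilon>1 \<epsilon>0) auto
    finally show ?thesis .
  qed
  have sum_M: "(\<Sum>j<R. M j u * a j) - (\<Sum>j<r P. m P j u * a j) \<in> ?Z P"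
    if P: "P \<in> set Ps" and u: "u < n" for P u a
  proof -
    have "(\<Sum>j<r P. m P j u * a j) = (\<Sum>j<R. c P j u * a j)"
      using rR[OF P] by (intro sum.mono_neutral_cong_left) (auto simp: c_def)
    then have "(\<Sum>j<R. M j u * a j) - (\<Sum>j<r P. m P j u * a j) = (\<Sum>j<R. (M j u - c P j u) * a j)"
      by (simp add: left_diff_distrib sum_subtractf)
    also have "\<dots> \<in> ?Z P"
      using M_c[OF P u] by (intro right_ideal_sum[OF rZ[OF P]] right_ideal_mult[OF rZ[OF P]])
    finally show ?thesis .
  qed
  have "generates_mod X X' n R M"
  proof (rule generates_mod_nakayama[OF X X' Ps0 ideals])
    fix P assume P: "P \<in> set Ps"
    show "generates_mod X (?Z P) n R M"
      unfolding generates_mod_def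
    proof (intro allI impI)
      fix y assume "\<forall>u<n. y u \<in> X"
      then obtain a where a: "\<forall>u<n. y u - (\<Sum>j<r P. m P j u * a j) \<in> ?Z P"
        using m_gen[OF P] unfolding generates_mod_def by blast
      have "y u - (\<Sum>j<R. M j u * a j) \<in> ?Z P" if "u < n" for u
        using right_ideal_diff[OF rZ[OF P] a[rule_format, OF that] sum_M[OF P that, of a]]
        by (simp add: algebra_simps)
      then show "\<exists>a. \<forall>u<n. y u - (\<Sum>j<R. M j u * a j) \<in> ?Z P"
        by blast
    qed
  qed
  moreover have "independent_mod X' P0 n R M"
    unfolding independent_mod_def
  proof (intro allI impI)
    fix a j assume a: "\<forall>u<n. (\<Sum>j<R. M j u * a j) \<in> X'" and j: "j < R"
    have "(\<Sum>j<R. M j u * a j) \<in> ?Z P0" if "u < n" for u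
      using a that ideal_sum_right[OF right_ideal_set_product[OF two_sided_ideal_right[OF ideals[OF P0(1)]]]]
      by blast
    then have "\<forall>u<n. (\<Sum>j<r P0. m P0 j u * a j) \<in> ?Z P0"
      using right_ideal_iff_diff[OF rZ[OF P0(1)] sum_M[OF P0(1)]] by blast
    then show "a j \<in> P0"
      using m_ind[OF P0(1)] P0(2) j unfolding independent_mod_def by simp
  qed
  ultimately show ?thesis
    using \<open>0 < n\<close> MX max[OF P0(1)] by blast
qed

section \<open>Sweedler sums\<close>

text \<open>Bare linearity, without vector space assumptions on the scalings: it unfolds into two
  equations that rewriting can settle even for nested Sweedler sums.\<close>

definition lin :: "('k \<Rightarrow> 'v::ab_group_add \<Rightarrow> 'v) \<Rightarrow> ('k \<Rightarrow> 'w::ab_group_add \<Rightarrow> 'w) \<Rightarrow> ('v \<Rightarrow> 'w) \<Rightarrow> bool"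
  where "lin s1 s2 f \<longleftrightarrow> (\<forall>x y. f (x + y) = f x + f y) \<and> (\<forall>c x. f (s1 c x) = s2 c (f x))"

lemma lin_add: "lin s1 s2 f \<Longrightarrow> f (x + y) = f x + f y"
  and lin_scale: "lin s1 s2 f \<Longrightarrow> f (s1 c x) = s2 c (f x)"
  by (auto simp: lin_def)

lemma linI: "(\<And>x y. f (x + y) = f x + f y) \<Longrightarrow> (\<And>c x. f (s1 c x) = s2 c (f x)) \<Longrightarrow> lin s1 s2 f"
  by (auto simp: lin_def)

lemma lin_zero: "lin s1 s2 f \<Longrightarrow> f 0 = 0"
  using lin_add[of s1 s2 f 0 0] by simp

lemma lin_sum: "lin s1 s2 f \<Longrightarrow> f (sum g F) = (\<Sum>i\<in>F. f (g i))"
  by (induction F rule: infinite_finite_induct) (auto simp: lin_zero lin_add)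

lemma lin_diff: "lin s1 s2 f \<Longrightarrow> f (x - y) = f x - f y"
  using lin_add[of s1 s2 f "x - y" y] by (simp add: algebra_simps)

definition bilin :: "('k \<Rightarrow> 'v::ab_group_add \<Rightarrow> 'v) \<Rightarrow> ('k \<Rightarrow> 'w::ab_group_add \<Rightarrow> 'w) \<Rightarrow> ('v \<Rightarrow> 'v \<Rightarrow> 'w) \<Rightarrow> bool"
  where "bilin s1 s2 \<beta> \<longleftrightarrow> (\<forall>y. lin s1 s2 (\<lambda>x. \<beta> x y)) \<and> (\<forall>x. lin s1 s2 (\<lambda>y. \<beta> x y))"

definition trilin :: "('k \<Rightarrow> 'v::ab_group_add \<Rightarrow> 'v) \<Rightarrow> ('k \<Rightarrow> 'w::ab_group_add \<Rightarrow> 'w) \<Rightarrow> ('v \<Rightarrow> 'v \<Rightarrow> 'v \<Rightarrow> 'w) \<Rightarrow> bool"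
  where "trilin s1 s2 \<tau> \<longleftrightarrow> (\<forall>y z. lin s1 s2 (\<lambda>x. \<tau> x y z)) \<and> (\<forall>x z. lin s1 s2 (\<lambda>y. \<tau> x y z)) \<and>
    (\<forall>x y. lin s1 s2 (\<lambda>z. \<tau> x y z))"

lemma lookup_free_scale [simp]: "Poly_Mapping.lookup (free_scale c u) x = c * Poly_Mapping.lookup u x"
  unfolding free_scale_def by (simp add: map.rep_eq when_def)

lemma vector_space_free_scale: "vector_space (free_scale :: 'k::field \<Rightarrow> ('x \<Rightarrow>\<^sub>0 'k) \<Rightarrow> _)"
  by unfold_locales (auto intro!: poly_mapping_eqI simp: lookup_add algebra_simps)

context vector_space
begin

lemma free_extend_superset:
  assumes "finite K" "Poly_Mapping.keys u \<subseteq> K"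
  shows "free_extend scale f u = (\<Sum>x\<in>K. scale (Poly_Mapping.lookup u x) (f x))"
  unfolding free_extend_def using assms
  by (intro sum.mono_neutral_left) (auto simp: in_keys_iff)

lemma free_extend_single [simp]: "free_extend scale f (Poly_Mapping.single x c) = scale c (f x)"
  by (subst free_extend_superset[of "{x}"]) auto

lemma free_extend_add: "free_extend scale f (u + v) = free_extend scale f u + free_extend scale f v"
proof -
  let ?K = "Poly_Mapping.keys u \<union> Poly_Mapping.keys v"
  have "Poly_Mapping.keys (u + v) \<subseteq> ?K"
    by (rule Poly_Mapping.keys_add)
  then show ?thesis
    using free_extend_superset[of ?K] by (simp add: lookup_add scale_left_distrib sum.distrib)
qed

lemma free_extend_scale: "free_extend scale f (free_scale c u) = scale c (free_extend scale f u)"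
proof -
  have "Poly_Mapping.keys (free_scale c u) \<subseteq> Poly_Mapping.keys u"
    by (auto simp: in_keys_iff)
  then show ?thesis
    using free_extend_superset[of "Poly_Mapping.keys u"] by (simp add: scale_sum_right)
qed

lemma free_extend_lin: "lin free_scale scale (free_extend scale f)"
  by (simp add: lin_def free_extend_add free_extend_scale)

lemma free_extend_compose:
  "free_extend scale f (free_extend free_scale g u) = free_extend scale (\<lambda>x. free_extend scale f (g x)) u"
  by (subst (2) free_extend_def)
    (simp add: lin_sum[OF free_extend_lin] free_extend_scale, simp add: free_extend_def)

lemma lin_free_extend:
  assumes "lin scale s2 \<phi>"
  shows "\<phi> (free_extend scale f u) = free_extend s2 (\<lambda>x. \<phi> (f x)) u"
  by (simp add: free_extend_def lin_sum[OF assms] lin_scale[OF assms])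

lemma free_extend_span_zero:
  assumes "u \<in> module.span free_scale R" "\<And>r. r \<in> R \<Longrightarrow> free_extend scale f r = 0"
  shows "free_extend scale f u = 0"
proof -
  interpret F: vector_space "free_scale :: 'a \<Rightarrow> ('c \<Rightarrow>\<^sub>0 'a) \<Rightarrow> _"
    by (rule vector_space_free_scale)
  have "F.subspace {u. free_extend scale f u = 0}"
    by (auto simp: F.subspace_def free_extend_add free_extend_scale lin_zero[OF free_extend_lin])
  then have "F.span R \<subseteq> {u. free_extend scale f u = 0}"
    using assms(2) by (intro F.span_minimal) auto
  then show ?thesis
    using assms(1) by blast
qed

lemma free_extend_linearity_relations:
  assumes "lin s1 scale (\<lambda>v. f (e v))" "r \<in> linearity_relations s1 e"
  shows "free_extend scale f r = 0"
  using assms(2) unfolding linearity_relations_def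
  by (auto simp: lin_diff[OF free_extend_lin] lin_add[OF assms(1)] lin_scale[OF assms(1)])

text \<open>Universal property of the tensor product: a bilinear map kills the relations by which
  congruence of tensors is defined.\<close>

lemma tensor2_eq_free_extend:
  assumes "tensor2_eq s1 s t" "bilin s1 scale \<beta>"
  shows "free_extend scale (\<lambda>(x, y). \<beta> x y) s = free_extend scale (\<lambda>(x, y). \<beta> x y) t"
proof -
  have "free_extend scale (\<lambda>(x, y). \<beta> x y) (s - t) = 0"
  proof (rule free_extend_span_zero[OF assms(1)[unfolded tensor2_eq_def]])
    fix r assume "r \<in> (\<Union>y. linearity_relations s1 (\<lambda>x. (x, y))) \<union> (\<Union>x. linearity_relations s1 (Pair x))"
    then show "free_extend scale (\<lambda>(x, y). \<beta> x y) r = 0"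
      using assms(2) by (auto simp: bilin_def intro: free_extend_linearity_relations[of s1, rotated])
  qed
  then show ?thesis
    by (simp add: lin_diff[OF free_extend_lin])
qed

lemma tensor3_eq_free_extend:
  assumes "tensor3_eq s1 s t" "trilin s1 scale \<tau>"
  shows "free_extend scale (\<lambda>(x, y, z). \<tau> x y z) s = free_extend scale (\<lambda>(x, y, z). \<tau> x y z) t"
proof -
  have "free_extend scale (\<lambda>(x, y, z). \<tau> x y z) (s - t) = 0"
  proof (rule free_extend_span_zero[OF assms(1)[unfolded tensor3_eq_def]])
    fix r assume "r \<in> (\<Union>y z. linearity_relations s1 (\<lambda>x. (x, y, z))) \<union>
      (\<Union>x z. linearity_relations s1 (\<lambda>y. (x, y, z))) \<union> (\<Union>x y. linearity_relations s1 (\<lambda>z. (x, y, z)))"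
    then show "free_extend scale (\<lambda>(x, y, z). \<tau> x y z) r = 0"
      using assms(2) by (auto simp: trilin_def intro: free_extend_linearity_relations[of s1, rotated])
  qed
  then show ?thesis
    by (simp add: lin_diff[OF free_extend_lin])
qed

end

section \<open>Sweedler calculus, integrals and the antipode of \<open>H\<close>\<close>

context hopf_algebra
begin

text \<open>Sweedler notation: the sum of \<open>\<beta> h1 h2\<close> over the representative
  \<open>comult h\<close>. For bilinear \<open>\<beta>\<close> it depends only on the class of the
  tensor; hence the bilinearity premises below.\<close>

definition sw :: "('k \<Rightarrow> 'v::ab_group_add \<Rightarrow> 'v) \<Rightarrow> ('h \<Rightarrow> 'h \<Rightarrow> 'v) \<Rightarrow> 'h \<Rightarrow> 'v"
  where "sw sc \<beta> h = free_extend sc (\<lambda>(x, y). \<beta> x y) (comult h)"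

lemma counit_lin: "lin scale (*) counit"
  using counit_linear by (simp add: lin_def Vector_Spaces.linear_iff)

lemma antipode_lin: "lin scale scale antipode"
  using antipode_linear by (simp add: lin_def Vector_Spaces.linear_iff)

lemma scale_as_mult: "scale c x = scale c 1 * x"
  using scale_mult_left[of c 1 x] by simp

context
  fixes sc :: "'k \<Rightarrow> 'v::ab_group_add \<Rightarrow> 'v"
  assumes V: "vector_space sc"
begin

interpretation V: vector_space sc
  by (rule V)

lemma sw_lin:
  assumes "bilin scale sc \<beta>"
  shows "lin scale sc (sw sc \<beta>)"
  unfolding sw_def
  by (rule linI) (use V.tensor2_eq_free_extend[OF comult_add assms] V.tensor2_eq_free_extend[OF comult_scale assms] in
      \<open>simp_all add: V.free_extend_add V.free_extend_scale\<close>)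

lemma sw_add_fun: "sw sc (\<lambda>x y. \<beta> x y + \<gamma> x y) h = sw sc \<beta> h + sw sc \<gamma> h"
  by (simp add: sw_def free_extend_def case_prod_unfold V.scale_right_distrib sum.distrib)

lemma sw_scale_fun: "sw sc (\<lambda>x y. sc c (\<beta> x y)) h = sc c (sw sc \<beta> h)"
  by (simp add: sw_def free_extend_def case_prod_unfold V.scale_sum_right mult.commute)

lemma sw_sum_fun: "sw sc (\<lambda>x y. \<Sum>i\<in>F. \<beta> i x y) h = (\<Sum>i\<in>F. sw sc (\<beta> i) h)"
  unfolding sw_def free_extend_def case_prod_unfold V.scale_sum_right by (rule sum.swap)

lemma sw_diff_fun: "sw sc (\<lambda>x y. \<beta> x y - \<gamma> x y) h = sw sc \<beta> h - sw sc \<gamma> h"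
  by (simp add: sw_def free_extend_def case_prod_unfold V.scale_right_diff_distrib sum_subtractf)

lemma lin_sw:
  assumes "lin sc s2 \<phi>"
  shows "\<phi> (sw sc \<beta> h) = sw s2 (\<lambda>x y. \<phi> (\<beta> x y)) h"
  unfolding sw_def V.lin_free_extend[OF assms] by (simp add: case_prod_unfold)

lemma sw_closed:
  assumes "0 \<in> J" "\<And>x y. x \<in> J \<Longrightarrow> y \<in> J \<Longrightarrow> x + y \<in> J" "\<And>c x. x \<in> J \<Longrightarrow> sc c x \<in> J"
    and "\<And>x y. \<beta> x y \<in> J"
  shows "sw sc \<beta> h \<in> J"
proof -
  have "sum g F \<in> J" if "\<And>i. g i \<in> J" for g :: "'h \<times> 'h \<Rightarrow> 'v" and F
    by (induction F rule: infinite_finite_induct) (use assms that in auto)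
  then show ?thesis
    unfolding sw_def free_extend_def using assms by (auto simp: case_prod_unfold)
qed

lemma sw_counit_left:
  assumes \<phi>: "lin scale sc \<phi>"
  shows "sw sc (\<lambda>x y. sc (counit x) (\<phi> y)) h = \<phi> h"
proof -
  have "\<phi> h = \<phi> (free_extend scale (\<lambda>(a, b). scale (counit a) b) (comult h))"
    by (simp only: counit_left)
  then show ?thesis
    by (simp add: lin_free_extend[OF \<phi>] sw_def case_prod_unfold lin_scale[OF \<phi>])
qed

lemma sw_counit_right:
  assumes \<phi>: "lin scale sc \<phi>"
  shows "sw sc (\<lambda>x y. sc (counit y) (\<phi> x)) h = \<phi> h"
proof -
  have "\<phi> h = \<phi> (free_extend scale (\<lambda>(a, b). scale (counit b) a) (comult h))"
    by (simp only: counit_right)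
  then show ?thesis
    by (simp add: lin_free_extend[OF \<phi>] sw_def case_prod_unfold lin_scale[OF \<phi>])
qed

lemma sw_antipode_left: "lin scale sc \<phi> \<Longrightarrow> sw sc (\<lambda>x y. \<phi> (antipode x * y)) h = sc (counit h) (\<phi> 1)"
  unfolding lin_scale[symmetric, of scale sc \<phi>] antipode_left[symmetric]
  by (simp add: lin_free_extend sw_def case_prod_unfold)

lemma sw_antipode_right: "lin scale sc \<phi> \<Longrightarrow> sw sc (\<lambda>x y. \<phi> (x * antipode y)) h = sc (counit h) (\<phi> 1)"
  unfolding lin_scale[symmetric, of scale sc \<phi>] antipode_right[symmetric]
  by (simp add: lin_free_extend sw_def case_prod_unfold)

lemma sw_coassoc:
  assumes "trilin scale sc \<tau>"
  shows "sw sc (\<lambda>a b. sw sc (\<lambda>p q. \<tau> p q b) a) h = sw sc (\<lambda>a b. sw sc (\<lambda>p q. \<tau> a p q) b) h"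
  using V.tensor3_eq_free_extend[OF coassoc assms, of h]
  by (simp add: sw_def V.free_extend_compose case_prod_unfold)

lemma sw_mult:
  assumes "bilin scale sc \<beta>"
  shows "sw sc \<beta> (x * y) = sw sc (\<lambda>a b. sw sc (\<lambda>c d. \<beta> (a * c) (b * d)) y) x"
  using V.tensor2_eq_free_extend[OF comult_mult assms, of x y]
  by (simp add: sw_def tensor_mult_def V.free_extend_compose case_prod_unfold)

text \<open>In tensors, \<open>t1 \<otimes> g t2 = S(g) t1 \<otimes> t2\<close>. Both sides are
  contractions of \<open>S(g1) g2 t1 \<otimes> g3 t2\<close>: either \<open>S(g1) g2\<close>
  collapses to a counit, or \<open>g2 t1 \<otimes> g3 t2\<close> does, being the coproduct of a
  multiple of \<open>t\<close>.\<close>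

lemma sw_left_integral:
  assumes t: "\<And>h. h * t = scale (counit h) t" and \<beta>: "bilin scale sc \<beta>"
  shows "sw sc (\<lambda>x y. \<beta> x (g * y)) t = sw sc (\<lambda>x y. \<beta> (antipode g * x) y) t"
proof -
  have \<beta>s: "\<beta> (x + x') y = \<beta> x y + \<beta> x' y" "\<beta> x (y + y') = \<beta> x y + \<beta> x y'"
    "\<beta> (scale c x) y = sc c (\<beta> x y)" "\<beta> x (scale c y) = sc c (\<beta> x y)" for x x' y y' c
    using \<beta> by (simp_all add: bilin_def lin_def)
  have \<beta>e: "\<beta> (x + x') = (\<lambda>y. \<beta> x y + \<beta> x' y)" "\<beta> (scale c x) = (\<lambda>y. sc c (\<beta> x y))" for x x' c
    using \<beta>s by auto
  note simps = \<beta>s(2,4) \<beta>e sw_add_fun sw_scale_fun distrib_left distrib_right lin_add[OF antipode_lin] lin_scale[OF antipode_lin]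
    scale_mult_left[symmetric] scale_mult_right[symmetric]
  let ?\<Phi> = "\<lambda>p q r. sw sc (\<lambda>x y. \<beta> (antipode p * q * x) (r * y)) t"
  have "trilin scale sc ?\<Phi>"
    by (simp add: trilin_def lin_def simps)
  from sw_coassoc[OF this, of g]
  have "sw sc (\<lambda>a b. sw sc (\<lambda>p q. ?\<Phi> p q b) a) g = sw sc (\<lambda>a b. sw sc (\<lambda>p q. ?\<Phi> a p q) b) g" .
  moreover have "sw sc (\<lambda>p q. ?\<Phi> p q b) a = sc (counit a) (sw sc (\<lambda>x y. \<beta> x (b * y)) t)" for a b
    using sw_antipode_left[of "\<lambda>z. sw sc (\<lambda>x y. \<beta> (z * x) (b * y)) t" a]
    by (simp add: lin_def simps)
  moreover have "sw sc (\<lambda>p q. ?\<Phi> a p q) b = sc (counit b) (sw sc (\<lambda>x y. \<beta> (antipode a * x) y) t)" for a b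
  proof -
    have bil: "bilin scale sc (\<lambda>x y. \<beta> (antipode a * x) y)"
      by (simp add: bilin_def lin_def simps)
    show ?thesis
      using sw_mult[OF bil, of b t] lin_scale[OF sw_lin[OF bil]] by (simp add: t mult.assoc)
  qed
  moreover have "sw sc (\<lambda>a b. sc (counit a) (sw sc (\<lambda>x y. \<beta> x (b * y)) t)) g = sw sc (\<lambda>x y. \<beta> x (g * y)) t"
    by (rule sw_counit_left) (simp add: lin_def simps)
  moreover have "sw sc (\<lambda>a b. sc (counit b) (sw sc (\<lambda>x y. \<beta> (antipode a * x) y) t)) g =
      sw sc (\<lambda>x y. \<beta> (antipode g * x) y) t"
    by (rule sw_counit_right) (simp add: lin_def simps)
  ultimately show ?thesis
    by simp
qed

end

text \<open>The augmentation ideal has a complementary left ideal \<open>M\<close>; \<open>t\<close>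
  is the component of \<open>1\<close> in \<open>M\<close>. Since \<open>h - \<epsilon>(h)\<close>
  sends \<open>t\<close> into both summands, it kills \<open>t\<close>.\<close>

lemma left_integral_exists:
  assumes "semisimple_ring TYPE('h)"
  shows "\<exists>t. (\<forall>h. h * t = scale (counit h) t) \<and> counit t = 1"
proof -
  let ?L = "{h. counit h = 0}"
  have "left_ideal ?L"
    using lin_zero[OF counit_lin] by (auto simp: left_ideal_def lin_add[OF counit_lin] counit_mult)
  from assms[unfolded semisimple_ring_def, rule_format, OF this]
  obtain M where M: "left_ideal M" "?L \<inter> M = {0}" "\<And>x. \<exists>a\<in>?L. \<exists>b\<in>M. x = a + b"
    by (elim exE conjE) simp
  obtain a t where at: "counit a = 0" "t \<in> M" "1 = a + t"
    using M(3)[of 1] by blast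
  then have "counit t = 1"
    using counit_one lin_add[OF counit_lin, of a t] by simp
  moreover have "h * t = scale (counit h) t" for h
  proof -
    have "(h - scale (counit h) 1) * t \<in> M"
      using M(1) at(2) by (rule left_ideal_mult)
    moreover have "counit ((h - scale (counit h) 1) * t) = 0"
      by (simp add: counit_mult lin_diff[OF counit_lin] lin_scale[OF counit_lin] counit_one)
    ultimately have "(h - scale (counit h) 1) * t \<in> ?L \<inter> M"
      by simp
    then have "(h - scale (counit h) 1) * t = 0"
      using M(2) by blast
    then show ?thesis
      by (simp add: left_diff_distrib scale_as_mult[symmetric])
  qed
  ultimately show ?thesis
    by blast
qed

text \<open>A dual basis. Coefficients chosen for the elements of \<open>B\<close> extend by
  \<open>cf\<close> to coefficients linear in \<open>h\<close>, and a linear map on \<open>H\<close>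
  is determined by finitely many values.\<close>

definition coordinates :: "'h set \<Rightarrow> ('h \<Rightarrow> 'h \<Rightarrow> 'k) \<Rightarrow> bool"
  where "coordinates B cf \<longleftrightarrow> finite B \<and> (\<forall>b. lin scale (*) (\<lambda>h. cf h b)) \<and>
    (\<forall>h. h = (\<Sum>b\<in>B. scale (cf h b) b))"

lemma finite_basis_exists:
  assumes "finite_dimensional scale"
  shows "\<exists>B. finite B \<and> independent B \<and> span B = UNIV"
proof -
  obtain F where F: "finite F" "span F = UNIV"
    using assms unfolding finite_dimensional_def by blast
  obtain B where B: "B \<subseteq> F" "independent B" "F \<subseteq> span B"
    using maximal_independent_subset[of F] by blast
  then have "span B = UNIV"
    using F span_mono[of F "span B"] by (simp add: span_span top.extremum_unique)
  moreover have "finite B"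
    by (rule finite_subset[OF B(1) F(1)])
  ultimately show ?thesis
    using B(2) by (intro exI[of _ B]) simp
qed

lemma coordinates_exist:
  assumes "finite_dimensional scale"
  shows "\<exists>B cf. coordinates B cf"
proof -
  obtain B where B: "finite B" "independent B" "span B = UNIV"
    using finite_basis_exists[OF assms] by blast
  have "lin scale (*) (\<lambda>h. representation B h b)" for b
    by (rule linI) (simp_all add: representation_add representation_scale B(2,3))
  moreover have "h = (\<Sum>b\<in>B. scale (representation B h b) b)" for h
    using sum_representation_eq[OF B(2), of h B] B by simp
  ultimately show ?thesis
    unfolding coordinates_def using B(1) by blast
qed

text \<open>There is a linear form \<open>\<lambda>\<close> with \<open>\<Sum> \<lambda>(t\<^sub>1) t\<^sub>2 = 1\<close>; then \<open>h = \<Sum> \<lambda>(t\<^sub>1) h t\<^sub>2 = \<Sum> \<lambda>(S(h) t\<^sub>1) t\<^sub>2\<close> depends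
  only on \<open>S(h)\<close>.\<close>

lemma antipode_surj:
  assumes fd: "finite_dimensional scale" and ss: "semisimple_ring TYPE('h)"
  shows "surj antipode"
proof -
  have V: "vector_space scale" ..
  obtain t where t: "\<And>h. h * t = scale (counit h) t" "counit t = 1"
    using left_integral_exists[OF ss] by blast
  obtain B cf where B: "coordinates B cf"
    using coordinates_exist[OF fd] by blast
  then have cf: "lin scale (*) (\<lambda>h. cf h b)" and rep: "(\<Sum>b\<in>B. scale (cf h b) b) = h" for b h
    by (auto simp: coordinates_def)
  note simps = distrib_left distrib_right lin_add[OF cf] lin_scale[OF cf] scale_left_distrib scale_right_distrib
     lin_add[OF antipode_lin] lin_scale[OF antipode_lin] scale_mult_left[symmetric] scale_mult_right[symmetric]
     scale_left_commute sum.distrib scale_sum_right sum_distrib_left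
  \<comment> \<open>The trace of the linear map sending \<open>y\<close> to
    \<open>S(S(y)) x\<close>. It arises by expanding \<open>S(t1)\<close> in
    \<open>1 = S(t1) t2\<close> along \<open>B\<close> and moving each \<open>S(b)\<close> to the
    other leg by the integral identity.\<close>
  define lam where "lam x = (\<Sum>b\<in>B. cf (antipode (antipode b) * x) b)" for x
  have lam: "lin scale (*) lam"
    unfolding lam_def by (rule linI) (simp_all add: simps)
  have "1 = sw scale (\<lambda>x y. antipode x * y) t"
    using sw_antipode_left[OF V, of id t] t(2) by (simp add: lin_def)
  also have "(\<lambda>x y. antipode x * y) = (\<lambda>x y. \<Sum>b\<in>B. scale (cf x b) (antipode b * y))"
  proof (intro ext)
    fix x y
    have "antipode x = (\<Sum>b\<in>B. scale (cf x b) (antipode b))"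
      using lin_sum[OF antipode_lin, of "\<lambda>b. scale (cf x b) b" B]
      by (simp add: rep lin_scale[OF antipode_lin])
    then show "antipode x * y = (\<Sum>b\<in>B. scale (cf x b) (antipode b * y))"
      by (simp add: sum_distrib_right scale_mult_left)
  qed
  also have "sw scale (\<lambda>x y. \<Sum>b\<in>B. scale (cf x b) (antipode b * y)) t =
      (\<Sum>b\<in>B. sw scale (\<lambda>x y. scale (cf x b) (antipode b * y)) t)"
    by (rule sw_sum_fun[OF V])
  also have "\<dots> = (\<Sum>b\<in>B. sw scale (\<lambda>x y. scale (cf (antipode (antipode b) * x) b) y) t)"
    by (intro sum.cong refl sw_left_integral[OF V t(1), of "\<lambda>x y. scale (cf x _) y"])
      (simp add: bilin_def lin_def simps)
  also have "\<dots> = sw scale (\<lambda>x y. scale (lam x) y) t"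
    by (simp add: sw_sum_fun[OF V, symmetric] lam_def scale_sum_left)
  finally have one: "sw scale (\<lambda>x y. scale (lam x) y) t = 1" ..
  have bil: "bilin scale scale (\<lambda>x y. scale (lam x) y)"
    by (simp add: bilin_def lin_def simps lin_add[OF lam] lin_scale[OF lam])
  have eq: "h = sw scale (\<lambda>x y. scale (lam (antipode h * x)) y) t" for h
  proof -
    have "h = h * sw scale (\<lambda>x y. scale (lam x) y) t"
      by (simp add: one)
    also have "\<dots> = sw scale (\<lambda>x y. scale (lam x) (h * y)) t"
      using lin_sw[OF V, of scale "\<lambda>y. h * y"] by (simp add: lin_def simps)
    also have "\<dots> = sw scale (\<lambda>x y. scale (lam (antipode h * x)) y) t"
      by (rule sw_left_integral[OF V t(1) bil])
    finally show ?thesis .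
  qed
  have "inj antipode"
    by (rule injI) (metis eq)
  obtain C where C: "finite C" "independent C" "span C = UNIV"
    using finite_basis_exists[OF fd] by blast
  interpret fd: finite_dimensional_vector_space_pair scale C scale C
    by unfold_locales (rule C)+
  show ?thesis
    by (rule fd.linear_injective_imp_surjective[OF antipode_linear \<open>inj antipode\<close> refl])
qed

end

section \<open>Module algebras\<close>

definition relation_ideal :: "'q::{ring,monoid_mult} set \<Rightarrow> nat \<Rightarrow> nat \<Rightarrow> (nat \<Rightarrow> nat \<Rightarrow> 'q) \<Rightarrow> 'q set"
  where "relation_ideal X n r m =
    set_product UNIV {a j | a j. j < r \<and> (\<forall>u<n. (\<Sum>j<r. m j u * a j) \<in> X)}"

lemma relation_idealI:
  assumes "\<And>u. u < n \<Longrightarrow> (\<Sum>j<r. m j u * a j) \<in> X" "j < r"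
  shows "a j \<in> relation_ideal X n r m"
proof -
  have "1 * a j \<in> relation_ideal X n r m"
    unfolding relation_ideal_def
    by (rule set_product_intro, simp, intro CollectI exI[of _ a] exI[of _ j]) (use assms in auto)
  then show ?thesis
    by simp
qed

text \<open>The definition closes up under left multiples only; on the right, a multiple of a
  relation is again a relation.\<close>

lemma two_sided_ideal_relation_ideal:
  assumes "right_ideal X"
  shows "two_sided_ideal (relation_ideal X n r m)"
  unfolding two_sided_ideal_def
proof
  let ?J = "relation_ideal X n r m"
  show "left_ideal ?J"
    unfolding relation_ideal_def by (rule left_ideal_set_product) (simp add: left_ideal_def)
  show "right_ideal ?J"
  proof (rule right_idealI_diff)
    fix x s assume "x \<in> ?J"
    then show "x * s \<in> ?J"
      unfolding relation_ideal_def
    proof (induction rule: set_product_induct)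
      case (mult x y)
      then obtain a j where a: "y = a j" "j < r" "\<forall>u<n. (\<Sum>j<r. m j u * a j) \<in> X"
        by auto
      have "(\<Sum>j<r. m j u * (a j * s)) \<in> X" if "u < n" for u
        using right_ideal_mult[OF assms a(3)[rule_format, OF that], of s]
        by (simp add: sum_distrib_right mult.assoc)
      then show ?case
        unfolding a(1) mult.assoc by (intro set_product_intro) (use a(2) in \<open>auto intro!: exI[of _ "\<lambda>j. a j * s"]\<close>)
    qed (auto simp: left_diff_distrib intro: set_product_diff)
  qed (auto simp: relation_ideal_def intro: set_product_diff)
qed

lemma relation_ideal_subset:
  assumes "independent_mod X P n r m" "left_ideal P"
  shows "relation_ideal X n r m \<subseteq> P"
proof
  fix x assume "x \<in> relation_ideal X n r m"
  then show "x \<in> P"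
    unfolding relation_ideal_def
    by (induction rule: set_product_induct)
      (use assms in \<open>auto simp: independent_mod_def left_ideal_zero left_ideal_diff intro: left_ideal_mult\<close>)
qed

context module_algebra
begin

abbreviation (input) sw :: "('h \<Rightarrow> 'h \<Rightarrow> 'a) \<Rightarrow> 'h \<Rightarrow> 'a"
  where "sw \<equiv> H.sw scaleA"

lemma VA: "vector_space scaleA"
  ..

lemma act_lin: "lin scaleA scaleA (act h)"
  by (simp add: lin_def act_add_right act_scale_right)

lemma act_lin_left: "lin scaleH scaleA (\<lambda>h. act h a)"
  by (simp add: lin_def act_add_left act_scale_left)

lemmas act_zero = lin_zero[OF act_lin]
lemmas act_sum = lin_sum[OF act_lin]
lemmas act_diff = lin_diff[OF act_lin]

lemmas sw_add_fun = H.sw_add_fun[OF VA]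
lemmas sw_diff_fun = H.sw_diff_fun[OF VA]
lemmas sw_sum_fun = H.sw_sum_fun[OF VA]
lemmas sw_scale_fun = H.sw_scale_fun[OF VA]
lemmas sw_coassoc = H.sw_coassoc[OF VA]

lemma act_mult_sw: "act h (a * b) = sw (\<lambda>x y. act x a * act y b) h"
  by (simp add: act_product H.sw_def)

lemma sw_mult_left: "a * sw \<beta> h = sw (\<lambda>x y. a * \<beta> x y) h"
  by (rule H.lin_sw[OF VA]) (simp add: lin_def distrib_left A.scale_mult_right)

lemma sw_mult_right: "sw \<beta> h * a = sw (\<lambda>x y. \<beta> x y * a) h"
  by (rule H.lin_sw[OF VA, of _ "\<lambda>x. x * a"]) (simp add: lin_def distrib_right A.scale_mult_left)

lemma act_sw: "act g (sw \<beta> h) = sw (\<lambda>x y. act g (\<beta> x y)) h"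
  by (rule H.lin_sw[OF VA act_lin])

lemma right_ideal_scale: "right_ideal I \<Longrightarrow> x \<in> I \<Longrightarrow> scaleA c x \<in> I"
  using right_ideal_mult[of I x "scaleA c 1"] A.scale_mult_right[of c x 1] by simp

lemma sw_in_right_ideal: "right_ideal I \<Longrightarrow> (\<And>x y. \<beta> x y \<in> I) \<Longrightarrow> sw \<beta> h \<in> I"
  by (rule H.sw_closed[OF VA]) (auto intro: right_ideal_zero right_ideal_add right_ideal_scale)

lemmas lin_simps = lin_def bilin_def trilin_def distrib_left distrib_right
  A.scale_mult_left[symmetric] A.scale_mult_right[symmetric]
  act_add_left act_add_right act_scale_left act_scale_right sw_add_fun sw_scale_fun
  H.scale_mult_left[symmetric] H.scale_mult_right[symmetric]
  lin_add[OF H.antipode_lin] lin_scale[OF H.antipode_lin]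
  lin_add[OF H.counit_lin] lin_scale[OF H.counit_lin]
  A.scale_left_distrib A.scale_right_distrib A.scale_sum_right sum.distrib

lemma sw_counit: "lin scaleH scaleA \<phi> \<Longrightarrow> sw (\<lambda>x y. scaleA (counit x) (\<phi> y)) h = \<phi> h"
  by (rule H.sw_counit_left[OF VA])

text \<open>It suffices to choose the coefficients for \<open>h \<in> B\<close>. Their linearity in
  \<open>h\<close> is what allows coassociativity to be applied to them.\<close>

lemma lift_to_generators:
  assumes B: "H.coordinates B cf" and X': "right_ideal X'" and gen: "generates_mod X X' n r m"
    and g: "\<And>u. u < n \<Longrightarrow> lin scaleH scaleA (\<lambda>h. g h u)" "\<And>u h. u < n \<Longrightarrow> g h u \<in> X"
  shows "\<exists>c. (\<forall>i. lin scaleH scaleA (c i)) \<and> (\<forall>h. \<forall>u<n. g h u - (\<Sum>i<r. m i u * c i h) \<in> X')"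
proof -
  have fin: "finite B" and cf: "lin scaleH (*) (\<lambda>h. cf h b)" and rep: "h = (\<Sum>b\<in>B. scaleH (cf h b) b)" for b h
    using B by (auto simp: H.coordinates_def)
  have "\<exists>a. \<forall>u<n. g b u - (\<Sum>i<r. m i u * a i) \<in> X'" for b
    using gen[unfolded generates_mod_def, rule_format, of "g b"] g(2) by blast
  then obtain a where a: "\<And>b u. u < n \<Longrightarrow> g b u - (\<Sum>i<r. m i u * a b i) \<in> X'"
    by metis
  define c where "c i h = (\<Sum>b\<in>B. scaleA (cf h b) (a b i))" for i h
  have "lin scaleH scaleA (c i)" for i
    unfolding c_def by (rule linI) (simp_all add: lin_add[OF cf] lin_scale[OF cf] lin_simps)
  moreover have "g h u - (\<Sum>i<r. m i u * c i h) \<in> X'" if u: "u < n" for h u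
  proof -
    have "g h u = (\<Sum>b\<in>B. scaleA (cf h b) (g b u))"
      by (subst rep[of h]) (simp add: lin_sum[OF g(1)[OF u]] lin_scale[OF g(1)[OF u]])
    moreover have "(\<Sum>i<r. m i u * c i h) = (\<Sum>b\<in>B. scaleA (cf h b) (\<Sum>i<r. m i u * a b i))"
      by (simp add: c_def sum_distrib_left A.scale_sum_right A.scale_mult_right) (rule sum.swap)
    ultimately have "g h u - (\<Sum>i<r. m i u * c i h) = (\<Sum>b\<in>B. scaleA (cf h b) (g b u - (\<Sum>i<r. m i u * a b i)))"
      by (simp add: A.scale_right_diff_distrib sum_subtractf)
    also have "\<dots> \<in> X'"
      using a[OF u] by (intro right_ideal_sum[OF X'] right_ideal_scale[OF X'])
    finally show ?thesis .
  qed
  ultimately show ?thesis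
    by blast
qed

text \<open>\<open>Hom(H, A)\<close> is a ring under convolution, and \<open>a \<mapsto> (\<lambda>h. act h a)\<close> is a ring homomorphism into it.
  The action on the generators is given by a matrix \<open>c\<close> over this ring which sends relations
  to relations; \<open>d\<close> gives a right inverse of \<open>c\<close> modulo the relation ideal.  As the ring is right artinian,
  \<open>c\<close> is then also left invertible modulo that ideal.\<close>

theorem H_stable_relation_ideal:
  assumes fd: "finite_dimensional scaleH" and art: "right_artinian TYPE('a)"
    and X: "H_stable act X" and X': "right_ideal X'" "H_stable act X'"
    and m: "\<And>j u. j < r \<Longrightarrow> u < n \<Longrightarrow> m j u \<in> X" and gen: "generates_mod X X' n r m"
  shows "H_stable act (relation_ideal X' n r m)"
proof -
  define J where "J = relation_ideal X' n r m"
  have lJ: "left_ideal J" and rJ: "right_ideal J"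
    using two_sided_ideal_relation_ideal[OF X'(1)] by (auto simp: J_def two_sided_ideal_def)
  have JI: "a j \<in> J" if "\<And>u. u < n \<Longrightarrow> (\<Sum>j<r. m j u * a j) \<in> X'" "j < r" for a j
    unfolding J_def using that by (rule relation_idealI)
  obtain B cf where B: "H.coordinates B cf"
    using H.coordinates_exist[OF fd] by blast
  have "\<forall>j. j < r \<longrightarrow> (\<exists>c. (\<forall>i. lin scaleH scaleA (c i)) \<and> (\<forall>h. \<forall>u<n. act h (m j u) - (\<Sum>i<r. m i u * c i h) \<in> X'))"
    using m X by (intro allI impI lift_to_generators[OF B X'(1) gen]) (auto simp: act_lin_left H_stable_def)
  then obtain c0 where c0: "\<And>j i. j < r \<Longrightarrow> lin scaleH scaleA (c0 j i)"
      "\<And>j h u. j < r \<Longrightarrow> u < n \<Longrightarrow> act h (m j u) - (\<Sum>i<r. m i u * c0 j i h) \<in> X'"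
    by metis
  have "\<forall>j. j < r \<longrightarrow> (\<exists>c. (\<forall>i. lin scaleH scaleA (c i)) \<and>
      (\<forall>h. \<forall>u<n. act (antipode h) (m j u) - (\<Sum>i<r. m i u * c i h) \<in> X'))"
    using m X by (intro allI impI lift_to_generators[OF B X'(1) gen]) (auto simp: H_stable_def lin_simps)
  then obtain d0 where d0: "\<And>j i. j < r \<Longrightarrow> lin scaleH scaleA (d0 j i)"
      "\<And>j h u. j < r \<Longrightarrow> u < n \<Longrightarrow> act (antipode h) (m j u) - (\<Sum>i<r. m i u * d0 j i h) \<in> X'"
    by metis
  \<comment> \<open>\<open>c\<close> is the matrix of the action of \<open>h\<close> on the vectors
    \<open>m j\<close>, and \<open>d\<close> that of \<open>S(h)\<close>. The value zero for
    \<open>j \<ge> r\<close> makes both linear in \<open>h\<close> for all indices.\<close>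
  define c where "c i j h = (if j < r then c0 j i h else 0)" for i j h
  define d where "d i j h = (if j < r then d0 j i h else 0)" for i j h
  have c_add: "c i j (x + y) = c i j x + c i j y" and c_scale: "c i j (scaleH k x) = scaleA k (c i j x)"
    and d_add: "d i j (x + y) = d i j x + d i j y" and d_scale: "d i j (scaleH k x) = scaleA k (d i j x)" for i j x y k
    by (simp_all add: c_def d_def lin_add[OF c0(1)] lin_scale[OF c0(1)] lin_add[OF d0(1)] lin_scale[OF d0(1)])
  have c: "act h (m j u) - (\<Sum>i<r. m i u * c i j h) \<in> X'"
    and d: "act (antipode h) (m j u) - (\<Sum>i<r. m i u * d i j h) \<in> X'" if "j < r" "u < n" for j u h
    using c0(2)[OF that] d0(2)[OF that] that by (simp_all add: c_def d_def)
  \<comment> \<open>Modulo \<open>X'\<close>, \<open>S(h2) m_k\<close> is the sum of the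
    \<open>m_j d_jk(h2)\<close>. Applying \<open>h1\<close> gives \<open>\<epsilon>(h) m_k\<close>
    on one side, and on the other the \<open>m_i\<close> with coefficients the convolution product
    of \<open>c\<close> and the matrix of all \<open>h1 d(h2)\<close>. That matrix is
    \<open>D\<close>.\<close>
  define D where "D i j x = sw (\<lambda>p q. act p (d i j q)) x" for i j x
  have D_add: "D i j (x + y) = D i j x + D i j y" and D_scale: "D i j (scaleH k x) = scaleA k (D i j x)" for i j x y k
  proof -
    have "bilin scaleH scaleA (\<lambda>p q. act p (d i j q))"
      by (simp add: lin_simps d_add d_scale)
    from H.sw_lin[OF VA this]
    show "D i j (x + y) = D i j x + D i j y" "D i j (scaleH k x) = scaleA k (D i j x)"
      by (simp_all add: D_def lin_def)
  qed
  define LIN where "LIN b \<longleftrightarrow> (\<forall>j. lin scaleH scaleA (b j))" for b :: "nat \<Rightarrow> 'h \<Rightarrow> 'a"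
  define InJ where "InJ b \<longleftrightarrow> (\<forall>j<r. \<forall>h. b j h \<in> J)" for b :: "nat \<Rightarrow> 'h \<Rightarrow> 'a"
  \<comment> \<open>Left multiplication by \<open>D\<close>, and below by \<open>c\<close>, on
    columns over the convolution ring.\<close>
  define \<theta> where "\<theta> b i h = (\<Sum>k<r. sw (\<lambda>x y. D i k x * b k y) h)" for b i h
  define \<kappa> where "\<kappa> b i h = (\<Sum>j<r. sw (\<lambda>x y. c i j x * b j y) h)" for b i h
  have LIN: "b j (x + y) = b j x + b j y" "b j (scaleH k x) = scaleA k (b j x)" if "LIN b" for b j x y k
    using that by (auto simp: LIN_def lin_def)
  have bil: "lin scaleH scaleA (sw \<beta>)" if "bilin scaleH scaleA \<beta>" for \<beta>
    using H.sw_lin[OF VA that] .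
  have \<theta>_LIN: "LIN (\<theta> b)" if "LIN b" for b
  proof -
    have "bilin scaleH scaleA (\<lambda>x y. D i k x * b k y)" for i k
      by (simp add: lin_simps D_add D_scale LIN[OF that])
    from lin_add[OF bil[OF this]] lin_scale[OF bil[OF this]] show ?thesis
      by (simp add: LIN_def \<theta>_def lin_def sum.distrib A.scale_sum_right)
  qed
  have \<theta>_add: "\<theta> (\<lambda>j h. b j h + b' j h) = (\<lambda>j h. \<theta> b j h + \<theta> b' j h)" for b b'
    by (intro ext) (simp add: \<theta>_def distrib_left sw_add_fun sum.distrib)
  have \<theta>_diff: "\<theta> (\<lambda>j h. b j h - b' j h) = (\<lambda>j h. \<theta> b j h - \<theta> b' j h)" for b b'
    by (intro ext) (simp add: \<theta>_def right_diff_distrib sw_diff_fun sum_subtractf)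
  have \<kappa>_diff: "\<kappa> (\<lambda>j h. b j h - b' j h) = (\<lambda>j h. \<kappa> b j h - \<kappa> b' j h)" for b b'
    by (intro ext) (simp add: \<kappa>_def right_diff_distrib sw_diff_fun sum_subtractf)
  have \<theta>_mult: "\<theta> (\<lambda>j h. b j h * q) = (\<lambda>j h. \<theta> b j h * q)" for b q
    by (intro ext) (simp add: \<theta>_def sum_distrib_right sw_mult_right mult.assoc)
  have \<theta>_J: "InJ (\<theta> b)" if "InJ b" for b
    unfolding InJ_def \<theta>_def using that
    by (intro allI impI right_ideal_sum[OF rJ] sw_in_right_ideal[OF rJ] left_ideal_mult[OF lJ]) (auto simp: InJ_def)
  have \<kappa>_J: "InJ (\<kappa> b)" if "InJ b" for b
    unfolding InJ_def \<kappa>_def using that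
    by (intro allI impI right_ideal_sum[OF rJ] sw_in_right_ideal[OF rJ] left_ideal_mult[OF lJ]) (auto simp: InJ_def)
  have InJ_diff: "InJ (\<lambda>j h. b j h - b' j h)" if "InJ b" "InJ b'" for b b'
    using that right_ideal_diff[OF rJ] by (simp add: InJ_def)
  have InJ_cong: "InJ b" if "InJ (\<lambda>j h. b j h - b' j h)" "InJ b'" for b b'
    using that right_ideal_iff_diff[OF rJ] unfolding InJ_def by blast
  \<comment> \<open>The error in \<open>c D = 1\<close>. Its columns are relations modulo
    \<open>X'\<close>, so its entries lie in \<open>J\<close>.\<close>
  define E where "E i k x = (\<Sum>j<r. sw (\<lambda>z w. c i j z * D j k w) x) - (if i = k then scaleA (counit x) 1 else 0)" for i k x
  have E_J: "E i k x \<in> J" if i: "i < r" and k: "k < r" for i k x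
  proof (rule JI[of "\<lambda>i. E i k x", OF _ i])
    fix u assume u: "u < n"
    have "(\<Sum>i<r. m i u * E i k x) =
        (\<Sum>i<r. \<Sum>j<r. sw (\<lambda>z w. m i u * c i j z * D j k w) x) - scaleA (counit x) (m k u)"
    proof -
      have "(\<Sum>i<r. m i u * (if i = k then scaleA (counit x) 1 else 0)) = scaleA (counit x) (m k u)"
        using k by (simp add: if_distrib[of "\<lambda>y. _ * y"] A.scale_mult_right[symmetric] cong: if_cong)
      then show ?thesis
        by (simp add: E_def right_diff_distrib sum_subtractf sum_distrib_left sw_mult_left mult.assoc)
    qed
    also have "(\<Sum>i<r. \<Sum>j<r. sw (\<lambda>z w. m i u * c i j z * D j k w) x) =
        (\<Sum>j<r. sw (\<lambda>z w. (\<Sum>i<r. m i u * c i j z) * D j k w) x)"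
      by (subst sum.swap) (simp add: sum_distrib_right sw_sum_fun)
    finally have eq1: "(\<Sum>i<r. m i u * E i k x) =
        (\<Sum>j<r. sw (\<lambda>z w. (\<Sum>i<r. m i u * c i j z) * D j k w) x) - scaleA (counit x) (m k u)" .
    let ?A1 = "\<Sum>j<r. sw (\<lambda>z w. act z (m j u) * D j k w) x"
    let ?A2 = "sw (\<lambda>z w. act z (act (antipode w) (m k u))) x"
    have "?A1 = (\<Sum>j<r. sw (\<lambda>z w. act z (m j u * d j k w)) x)"
    proof (rule sum.cong[OF refl])
      fix j
      have "trilin scaleH scaleA (\<lambda>z p q. act z (m j u) * act p (d j k q))"
        by (simp add: lin_simps d_add d_scale)
      from sw_coassoc[OF this, of x]
      show "sw (\<lambda>z w. act z (m j u) * D j k w) x = sw (\<lambda>z w. act z (m j u * d j k w)) x"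
        by (simp add: D_def sw_mult_left act_mult_sw)
    qed
    also have "\<dots> = sw (\<lambda>z w. act z (\<Sum>j<r. m j u * d j k w)) x"
      by (simp add: act_sum sw_sum_fun)
    finally have A1: "?A1 = sw (\<lambda>z w. act z (\<Sum>j<r. m j u * d j k w)) x" .
    have A2: "?A2 = scaleA (counit x) (m k u)"
      using H.sw_antipode_right[OF VA, of "\<lambda>z. act z (m k u)" x]
      by (simp add: act_lin_left act_mult act_one)
    have "?A1 - (\<Sum>j<r. sw (\<lambda>z w. (\<Sum>i<r. m i u * c i j z) * D j k w) x) =
        (\<Sum>j<r. sw (\<lambda>z w. (act z (m j u) - (\<Sum>i<r. m i u * c i j z)) * D j k w) x)"
      by (simp add: left_diff_distrib sw_diff_fun sum_subtractf)
    moreover have "\<dots> \<in> X'"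
      using c u by (intro right_ideal_sum[OF X'(1)] sw_in_right_ideal[OF X'(1)] right_ideal_mult[OF X'(1)]) auto
    moreover have "?A2 - ?A1 = sw (\<lambda>z w. act z (act (antipode w) (m k u) - (\<Sum>j<r. m j u * d j k w))) x"
      by (simp add: A1 act_diff sw_diff_fun)
    moreover have "\<dots> \<in> X'"
      using d[OF k u] X'(2) by (intro sw_in_right_ideal[OF X'(1)]) (auto simp: H_stable_def)
    ultimately have "(?A2 - ?A1) + (?A1 - (\<Sum>j<r. sw (\<lambda>z w. (\<Sum>i<r. m i u * c i j z) * D j k w) x)) \<in> X'"
      using right_ideal_add[OF X'(1)] by simp
    then have "- (\<Sum>i<r. m i u * E i k x) \<in> X'"
      by (simp add: eq1 A2)
    then show "(\<Sum>i<r. m i u * E i k x) \<in> X'"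
      using right_ideal_uminus[OF X'(1)] by fastforce
  qed
  have \<kappa>\<theta>: "InJ (\<lambda>i h. \<kappa> (\<theta> b) i h - b i h)" if b: "LIN b" for b
    unfolding InJ_def
  proof (intro allI impI)
    fix i h assume i: "i < r"
    have "\<kappa> (\<theta> b) i h = (\<Sum>j<r. \<Sum>k<r. sw (\<lambda>x y. sw (\<lambda>z w. c i j x * (D j k z * b k w)) y) h)"
      by (simp add: \<kappa>_def \<theta>_def sum_distrib_left sw_sum_fun sw_mult_left)
    also have "\<dots> = (\<Sum>j<r. \<Sum>k<r. sw (\<lambda>x y. sw (\<lambda>z w. c i j z * D j k w) x * b k y) h)"
    proof (intro sum.cong refl)
      fix j k
      have "trilin scaleH scaleA (\<lambda>x z w. c i j x * (D j k z * b k w))"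
        by (simp add: lin_simps c_add c_scale D_add D_scale LIN[OF b])
      from sw_coassoc[OF this, of h]
      show "sw (\<lambda>x y. sw (\<lambda>z w. c i j x * (D j k z * b k w)) y) h = sw (\<lambda>x y. sw (\<lambda>z w. c i j z * D j k w) x * b k y) h"
        by (simp add: sw_mult_right mult.assoc)
    qed
    also have "\<dots> = (\<Sum>k<r. sw (\<lambda>x y. (\<Sum>j<r. sw (\<lambda>z w. c i j z * D j k w) x) * b k y) h)"
      by (subst sum.swap) (simp add: sum_distrib_right sw_sum_fun)
    finally have 1: "\<kappa> (\<theta> b) i h = (\<Sum>k<r. sw (\<lambda>x y. (\<Sum>j<r. sw (\<lambda>z w. c i j z * D j k w) x) * b k y) h)" .
    have "(\<Sum>k<r. sw (\<lambda>x y. (if i = k then scaleA (counit x) 1 else 0) * b k y) h)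
        = (\<Sum>k<r. if i = k then sw (\<lambda>x y. scaleA (counit x) (b k y)) h else 0)"
      by (intro sum.cong refl)
        (use sw_sum_fun[of "\<lambda>_ _ _. 0" "{}"] in \<open>auto simp: A.scale_mult_left[symmetric]\<close>)
    also have "\<dots> = b i h"
      using i b sw_counit[of "b i" h] by (simp add: LIN_def)
    finally have "\<kappa> (\<theta> b) i h - b i h = (\<Sum>k<r. sw (\<lambda>x y. E i k x * b k y) h)"
      unfolding 1 E_def by (simp add: left_diff_distrib sw_diff_fun sum_subtractf)
    also have "\<dots> \<in> J"
      using E_J[OF i] by (intro right_ideal_sum[OF rJ] sw_in_right_ideal[OF rJ] right_ideal_mult[OF rJ]) auto
    finally show "\<kappa> (\<theta> b) i h - b i h \<in> J" .
  qed
  have inj: "InJ b" if b: "LIN b" and "InJ (\<theta> b)" for b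
  proof -
    have "InJ (\<lambda>i h. \<kappa> (\<theta> b) i h - (\<kappa> (\<theta> b) i h - b i h))"
      by (rule InJ_diff[OF \<kappa>_J \<kappa>\<theta>]) (fact that)+
    then show ?thesis
      by simp
  qed
  have pow_LIN: "LIN ((\<theta> ^^ n) b)" if "LIN b" for b n
    using that by (induction n) (auto intro: \<theta>_LIN)
  have pow_diff: "(\<theta> ^^ n) (\<lambda>j h. b j h - b' j h) = (\<lambda>j h. (\<theta> ^^ n) b j h - (\<theta> ^^ n) b' j h)" for b b' n
    by (induction n) (auto simp: \<theta>_diff)
  have pow_add: "(\<theta> ^^ n) (\<lambda>j h. b j h + b' j h) = (\<lambda>j h. (\<theta> ^^ n) b j h + (\<theta> ^^ n) b' j h)" for b b' n
    by (induction n) (auto simp: \<theta>_add)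
  have pow_mult: "(\<theta> ^^ n) (\<lambda>j h. b j h * q) = (\<lambda>j h. (\<theta> ^^ n) b j h * q)" for b q n
    by (induction n) (auto simp: \<theta>_mult)
  have pow_inj: "InJ b" if "LIN b" "InJ ((\<theta> ^^ n) b)" for b n
    using that by (induction n) (auto intro: inj pow_LIN)
  have LIN_diff: "LIN (\<lambda>j h. b j h - b' j h)" and LIN_add: "LIN (\<lambda>j h. b j h + b' j h)" if "LIN b" "LIN b'" for b b'
    using that by (simp_all add: LIN_def lin_def A.scale_right_diff_distrib A.scale_right_distrib algebra_simps)
  have LIN_mult: "LIN (\<lambda>j h. b j h * q)" if "LIN b" for b q
    using that by (simp add: LIN_def lin_def distrib_right A.scale_mult_left)
  have LIN_zero: "LIN (\<lambda>j h. 0)"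
    by (simp add: LIN_def lin_def)
  define N where "N s = {f. LIN (\<lambda>j h. f (j, h)) \<and> (\<exists>b. LIN b \<and> InJ (\<lambda>j h. f (j, h) - (\<theta> ^^ s) b j h))}" for s
  \<comment> \<open>An injective endomorphism of an artinian module is onto, here modulo
    \<open>J\<close>: the images of the powers of \<open>\<theta>\<close> stabilise, so
    \<open>(\<theta> ^^ s) \<beta>\<close> agrees with some \<open>(\<theta> ^^ Suc s) b\<close>,
    and \<open>\<theta> ^^ s\<close> cancels.\<close>
  have surj: "\<exists>b. LIN b \<and> InJ (\<lambda>j h. \<beta> j h - \<theta> b j h)" if \<beta>: "LIN \<beta>" for \<beta>
  proof -
    have fin: "finite ({..<r} \<times> B)"
      using B by (auto simp: H.coordinates_def)
    have "\<exists>s. \<forall>t\<ge>s. \<forall>f\<in>N s. \<exists>g\<in>N t. \<forall>b\<in>{..<r} \<times> B. f b = g b"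
    proof (rule right_artinian_functions[OF art fin])
      show "decseq N"
      proof (rule decseq_SucI, rule subsetI)
        fix s f assume "f \<in> N (Suc s)"
        then obtain b where "LIN (\<lambda>j h. f (j, h))" "LIN b" "InJ (\<lambda>j h. f (j, h) - (\<theta> ^^ Suc s) b j h)"
          by (auto simp: N_def)
        then show "f \<in> N s"
          using \<theta>_LIN unfolding N_def funpow_Suc_right by (auto intro!: exI[of _ "\<theta> b"])
      qed
      show "(\<lambda>_. 0) \<in> N s" for s
        using LIN_zero pow_mult[of s "\<lambda>_ _. 0" 0] right_ideal_zero[OF rJ]
        by (auto simp: N_def InJ_def intro!: exI[of _ "\<lambda>_ _. 0"])
      show "(\<lambda>i. f i + g i) \<in> N s" if f: "f \<in> N s" and g: "g \<in> N s" for s f g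
      proof -
        obtain b b' where "LIN (\<lambda>j h. f (j, h))" "LIN b" "InJ (\<lambda>j h. f (j, h) - (\<theta> ^^ s) b j h)"
          "LIN (\<lambda>j h. g (j, h))" "LIN b'" "InJ (\<lambda>j h. g (j, h) - (\<theta> ^^ s) b' j h)"
          using f g by (auto simp: N_def)
        moreover have "InJ (\<lambda>j h. f (j, h) + g (j, h) - ((\<theta> ^^ s) b j h + (\<theta> ^^ s) b' j h))"
          using calculation(3,6) unfolding InJ_def add_diff_add by (auto intro: right_ideal_add[OF rJ])
        ultimately show ?thesis
          unfolding N_def by (auto intro!: LIN_add exI[of _ "\<lambda>j h. b j h + b' j h"] simp: pow_add)
      qed
      show "(\<lambda>i. f i * q) \<in> N s" if f: "f \<in> N s" for s f q
      proof -
        obtain b where b: "LIN (\<lambda>j h. f (j, h))" "LIN b" "InJ (\<lambda>j h. f (j, h) - (\<theta> ^^ s) b j h)"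
          using f by (auto simp: N_def)
        moreover have "InJ (\<lambda>j h. f (j, h) * q - (\<theta> ^^ s) b j h * q)"
          using b(3) unfolding InJ_def left_diff_distrib[symmetric] by (auto intro: right_ideal_mult[OF rJ])
        ultimately show ?thesis
          unfolding N_def by (auto intro!: LIN_mult exI[of _ "\<lambda>j h. b j h * q"] simp: pow_mult)
      qed
    qed
    then obtain s where s: "\<And>t f. t \<ge> s \<Longrightarrow> f \<in> N s \<Longrightarrow> \<exists>g\<in>N t. \<forall>b\<in>{..<r} \<times> B. f b = g b"
      by blast
    have "(\<lambda>(j, h). (\<theta> ^^ s) \<beta> j h) \<in> N s"
      using pow_LIN[OF \<beta>, of s] \<beta> right_ideal_zero[OF rJ] by (auto simp: N_def InJ_def intro!: exI[of _ \<beta>])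
    from s[OF _ this, of "Suc s"]
    obtain g where g: "g \<in> N (Suc s)" "\<And>j b. j < r \<Longrightarrow> b \<in> B \<Longrightarrow> (\<theta> ^^ s) \<beta> j b = g (j, b)"
      by auto
    then obtain b where b: "LIN (\<lambda>j h. g (j, h))" "LIN b" "InJ (\<lambda>j h. g (j, h) - (\<theta> ^^ Suc s) b j h)"
      by (auto simp: N_def)
    have g_eq: "(\<theta> ^^ s) \<beta> j h = g (j, h)" if "j < r" for j h
    proof -
      have lins: "lin scaleH scaleA ((\<theta> ^^ s) \<beta> j)" "lin scaleH scaleA (\<lambda>h. g (j, h))"
        using pow_LIN[OF \<beta>, of s] b(1) by (auto simp: LIN_def)
      have rep: "h = (\<Sum>b\<in>B. scaleH (cf h b) b)"
        using B by (simp add: H.coordinates_def)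
      show ?thesis
        by (subst (1 2) rep)
          (use g(2)[OF that] in \<open>simp add: lin_sum[OF lins(1)] lin_sum[OF lins(2)] lin_scale[OF lins(1)] lin_scale[OF lins(2)]\<close>)
    qed
    have "InJ ((\<theta> ^^ s) (\<lambda>j h. \<beta> j h - \<theta> b j h))"
      using b(3) g_eq unfolding pow_diff InJ_def by (simp add: funpow_swap1)
    then have "InJ (\<lambda>j h. \<beta> j h - \<theta> b j h)"
      by (rule pow_inj[rotated]) (intro LIN_diff \<beta> \<theta>_LIN b)
    then show ?thesis
      using b by blast
  qed
  have act_J: "act h (a j) \<in> J" if a: "\<And>u. u < n \<Longrightarrow> (\<Sum>j<r. m j u * a j) \<in> X'" and j: "j < r" for h a j
  proof -
    \<comment> \<open>The orbit of the relation \<open>a\<close>. Here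
      \<open>\<kappa> \<beta>\<close> consists of relations, hence lies in \<open>J\<close>; writing
      \<open>\<beta>\<close> as \<open>\<theta> b\<close> modulo \<open>J\<close> and cancelling
      \<open>\<kappa>\<close> against \<open>\<theta>\<close> puts \<open>b\<close>, and so
      \<open>\<beta>\<close>, into \<open>J\<close>.\<close>
    define \<beta> where "\<beta> j h = act h (a j)" for j h
    have \<beta>: "LIN \<beta>"
      by (simp add: LIN_def lin_def \<beta>_def act_add_left act_scale_left)
    have "\<kappa> \<beta> i h \<in> J" if i: "i < r" for i h
    proof (rule JI[of "\<lambda>i. \<kappa> \<beta> i h", OF _ i])
      fix u assume u: "u < n"
      have "(\<Sum>i<r. m i u * \<kappa> \<beta> i h) = (\<Sum>i<r. \<Sum>j<r. sw (\<lambda>x y. m i u * c i j x * \<beta> j y) h)"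
        by (simp add: \<kappa>_def sum_distrib_left sw_mult_left mult.assoc)
      also have "\<dots> = (\<Sum>j<r. sw (\<lambda>x y. (\<Sum>i<r. m i u * c i j x) * \<beta> j y) h)"
        by (subst sum.swap) (simp add: sum_distrib_right sw_sum_fun)
      finally have "act h (\<Sum>j<r. m j u * a j) - (\<Sum>i<r. m i u * \<kappa> \<beta> i h) =
          (\<Sum>j<r. sw (\<lambda>x y. (act x (m j u) - (\<Sum>i<r. m i u * c i j x)) * \<beta> j y) h)"
        by (simp add: act_sum act_mult_sw \<beta>_def left_diff_distrib sw_diff_fun sum_subtractf)
      also have "\<dots> \<in> X'"
        using c u by (intro right_ideal_sum[OF X'(1)] sw_in_right_ideal[OF X'(1)] right_ideal_mult[OF X'(1)]) auto
      finally have "act h (\<Sum>j<r. m j u * a j) - (\<Sum>i<r. m i u * \<kappa> \<beta> i h) \<in> X'" .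
      moreover have "act h (\<Sum>j<r. m j u * a j) \<in> X'"
        using a[OF u] X'(2) by (simp add: H_stable_def)
      ultimately show "(\<Sum>i<r. m i u * \<kappa> \<beta> i h) \<in> X'"
        using right_ideal_iff_diff[OF X'(1)] by blast
    qed
    then have \<kappa>\<beta>: "InJ (\<kappa> \<beta>)"
      by (simp add: InJ_def)
    obtain b where b: "LIN b" "InJ (\<lambda>j h. \<beta> j h - \<theta> b j h)"
      using surj[OF \<beta>] by blast
    have "InJ (\<kappa> (\<lambda>j h. \<beta> j h - \<theta> b j h))"
      by (rule \<kappa>_J[OF b(2)])
    then have "InJ (\<lambda>j h. \<kappa> \<beta> j h - (\<kappa> \<beta> j h - \<kappa> (\<theta> b) j h))"
      using InJ_diff[OF \<kappa>\<beta>] unfolding \<kappa>_diff by blast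
    then have "InJ (\<kappa> (\<theta> b))"
      by simp
    then have "InJ (\<lambda>i h. \<kappa> (\<theta> b) i h - (\<kappa> (\<theta> b) i h - b i h))"
      by (rule InJ_diff[OF _ \<kappa>\<theta>[OF b(1)]])
    then have "InJ b"
      by simp
    then have "InJ (\<theta> b)"
      by (rule \<theta>_J)
    then have "InJ \<beta>"
      using InJ_cong[OF b(2)] by blast
    then show ?thesis
      using j by (simp add: InJ_def \<beta>_def)
  qed
  have "act h x \<in> J" if "x \<in> J" for h x
    using that unfolding J_def relation_ideal_def
  proof (induction arbitrary: h rule: set_product_induct)
    case zero
    then show ?case
      by (simp add: act_zero)
  next
    case (mult x y)
    then have "act q y \<in> J" for q
      using act_J by auto
    then have "sw (\<lambda>p q. act p x * act q y) h \<in> J"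
      by (intro sw_in_right_ideal[OF rJ] left_ideal_mult[OF lJ])
    then show ?case
      by (simp add: act_mult_sw J_def relation_ideal_def)
  next
    case (diff a b)
    then show ?case
      by (simp add: act_diff set_product_diff)
  qed
  then show ?thesis
    by (simp add: H_stable_def J_def)
qed

end

section \<open>Maximal \<open>H\<close>-stable ideals and their intersection\<close>

lemma chain_Union_left_ideal:
  assumes "\<C> \<noteq> {}" "\<And>X Y. X \<in> \<C> \<Longrightarrow> Y \<in> \<C> \<Longrightarrow> X \<subseteq> Y \<or> Y \<subseteq> X" "\<And>X. X \<in> \<C> \<Longrightarrow> left_ideal X"
  shows "left_ideal (\<Union>\<C>)"
  unfolding left_ideal_def
proof (intro conjI ballI allI)
  show "0 \<in> \<Union>\<C>"
    using assms left_ideal_zero by blast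
  show "x + y \<in> \<Union>\<C>" if xy: "x \<in> \<Union>\<C>" "y \<in> \<Union>\<C>" for x y
  proof -
    obtain X Y where "X \<in> \<C>" "Y \<in> \<C>" "x \<in> X" "y \<in> Y"
      using xy by blast
    then show ?thesis
      using assms(2)[of X Y] assms(3) left_ideal_add by blast
  qed
  show "r * x \<in> \<Union>\<C>" if "x \<in> \<Union>\<C>" for x r
    using that assms(3) left_ideal_mult by blast
qed

context module_algebra
begin

definition H_ideal :: "'a set \<Rightarrow> bool"
  where "H_ideal N \<longleftrightarrow> two_sided_ideal N \<and> H_stable act N"

definition maximal_H_ideal :: "'a set \<Rightarrow> bool"
  where "maximal_H_ideal C \<longleftrightarrow> H_ideal C \<and> 1 \<notin> C \<and> (\<forall>N. H_ideal N \<longrightarrow> C \<subseteq> N \<longrightarrow> 1 \<notin> N \<longrightarrow> N = C)"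

lemma maximal_H_ideal_exists:
  assumes "H_ideal N" "1 \<notin> N"
  shows "\<exists>C. maximal_H_ideal C \<and> N \<subseteq> C"
proof -
  let ?A = "{X. H_ideal X \<and> 1 \<notin> X \<and> N \<subseteq> X}"
  have "\<exists>M\<in>?A. \<forall>X\<in>?A. M \<subseteq> X \<longrightarrow> X = M"
  proof (rule subset_Zorn_nonempty)
    show "?A \<noteq> {}"
      using assms by blast
    fix \<C> assume C: "\<C> \<noteq> {}" "subset.chain ?A \<C>"
    then have mem: "H_ideal X" "1 \<notin> X" "N \<subseteq> X" if "X \<in> \<C>" for X
      using that by (auto simp: subset.chain_def)
    have chain: "X \<subseteq> Z \<or> Z \<subseteq> X" if "X \<in> \<C>" "Z \<in> \<C>" for X Z
      using C(2) that by (auto simp: subset.chain_def)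
    have "right_ideal (\<Union>\<C>)"
      by (rule chain_Union_right_ideal[OF C(1) chain]) (use mem in \<open>auto simp: H_ideal_def two_sided_ideal_def\<close>)
    moreover have "left_ideal (\<Union>\<C>)"
      by (rule chain_Union_left_ideal[OF C(1) chain]) (use mem in \<open>auto simp: H_ideal_def two_sided_ideal_def\<close>)
    moreover have "H_stable act (\<Union>\<C>)"
      using mem(1) unfolding H_ideal_def H_stable_def by blast
    moreover have "1 \<notin> \<Union>\<C>" "N \<subseteq> \<Union>\<C>"
      using mem(2,3) C(1) by auto
    ultimately show "\<Union>\<C> \<in> ?A"
      by (simp add: H_ideal_def two_sided_ideal_def)
  qed
  then obtain M where M: "H_ideal M" "1 \<notin> M" "N \<subseteq> M"
    and max: "\<And>X. H_ideal X \<Longrightarrow> 1 \<notin> X \<Longrightarrow> N \<subseteq> X \<Longrightarrow> M \<subseteq> X \<Longrightarrow> X = M"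
    by auto
  have "maximal_H_ideal M"
    unfolding maximal_H_ideal_def using M max[OF _ _ order.trans] by simp
  then show ?thesis
    using M by blast
qed

lemma H_stable_ideal_sum:
  assumes "H_stable act I" "H_stable act J"
  shows "H_stable act (ideal_sum I J)"
  using assms by (fastforce simp: H_stable_def ideal_sum_def act_add_right)

lemma H_stable_set_product:
  assumes "H_stable act S" "H_stable act T" "right_ideal T"
  shows "H_stable act (set_product S T)"
  unfolding H_stable_def
proof (intro allI ballI)
  fix h z assume "z \<in> set_product S T"
  then show "act h z \<in> set_product S T"
  proof (induction rule: set_product_induct)
    case (mult x y)
    then show ?case
      using assms unfolding act_mult_sw
      by (intro sw_in_right_ideal right_ideal_set_product set_product_intro) (auto simp: H_stable_def)
  qed (auto simp: act_zero act_diff set_product_diff)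
qed

text \<open>Some power of \<open>A / (X + C)\<close> is free over \<open>A / C\<close>, since its relation ideal equals \<open>C\<close> by maximality.\<close>

lemma projection_modulo_maximal_H_ideal:
  assumes fd: "finite_dimensional scaleH" and art: "right_artinian TYPE('a)"
    and X: "right_ideal X" "H_stable act X" and C: "maximal_H_ideal C"
  shows "\<exists>g\<in>X. \<forall>x\<in>X. x - g * x \<in> C"
proof -
  have rC: "right_ideal C" and lC: "left_ideal C" and C1: "1 \<notin> C" and sC: "H_stable act C"
    using C by (auto simp: maximal_H_ideal_def H_ideal_def two_sided_ideal_def)
  define X' where "X' = ideal_sum X C"
  have rX': "right_ideal X'" and sX': "H_stable act X'"
    unfolding X'_def using X rC sC by (auto intro: right_ideal_ideal_sum H_stable_ideal_sum)
  have XX': "X \<subseteq> X'" and CX': "C \<subseteq> X'"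
    unfolding X'_def using X(1) rC by (auto intro: ideal_sum_left[THEN subsetD] ideal_sum_right[THEN subsetD])
  have U: "right_ideal (UNIV :: 'a set)" "H_stable act (UNIV :: 'a set)"
    by (auto simp: right_ideal_def H_stable_def)
  have "(1::'a) \<noteq> 0"
    using C1 right_ideal_zero[OF rC] by metis
  moreover have "\<exists>a. y - (\<Sum>i<Suc 0. 1 * a i) \<in> X'" for y
    by (rule exI[of _ "\<lambda>_. y"]) (simp add: right_ideal_zero[OF rX'])
  ultimately obtain n r m P where "0 < n" and gen: "generates_mod UNIV X' n r m"
      and ind: "independent_mod X' P n r m" and P: "maximal_ideal P"
    using generators_with_proper_relations[OF art _ U(1) rX', of "Suc 0" "\<lambda>_. 1"] by auto
  define J where "J = relation_ideal X' n r m"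
  have "H_ideal J"
    unfolding J_def H_ideal_def using two_sided_ideal_relation_ideal[OF rX']
      H_stable_relation_ideal[OF fd art U(2) rX' sX' _ gen] by auto
  have "1 \<notin> J"
    using relation_ideal_subset[OF ind] P unfolding J_def maximal_ideal_def two_sided_ideal_def by blast
  \<comment> \<open>Elements of \<open>C\<close> are coefficients of relations because
    \<open>C \<subseteq> X'\<close>. For \<open>r = 0\<close> there are no coefficients at all, and
    \<open>p\<close> below is zero.\<close>
  have J_C: "J = C" if "0 < r"
  proof -
    have "C \<subseteq> J"
    proof
      fix c assume c: "c \<in> C"
      have "(\<lambda>_. c) (0::nat) \<in> J"
        unfolding J_def
        by (rule relation_idealI)
          (use c lC that CX' in \<open>auto intro!: right_ideal_sum[OF rX'] intro: left_ideal_mult\<close>)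
      then show "c \<in> J" .
    qed
    then show ?thesis
      using C \<open>H_ideal J\<close> \<open>1 \<notin> J\<close> by (auto simp: maximal_H_ideal_def)
  qed
  \<comment> \<open>The first unit vector, expanded in the generators. For \<open>q \<in> X\<close>
    the vector \<open>y q\<close> vanishes modulo \<open>X'\<close>, so its coefficients
    \<open>a j * q\<close> form a relation and lie in \<open>C\<close>. Thus \<open>p\<close> kills
    \<open>X\<close> modulo \<open>C\<close>, while \<open>1 - p \<in> X + C\<close>.\<close>
  define y where "y v = (if v = (0::nat) then 1 else 0 :: 'a)" for v
  obtain a where a: "\<And>v. v < n \<Longrightarrow> y v - (\<Sum>j<r. m j v * a j) \<in> X'"
    using gen[unfolded generates_mod_def, rule_format, of y] by auto
  define p where "p = (\<Sum>j<r. m j 0 * a j)"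
  have "1 - p \<in> X'"
    using a[OF \<open>0 < n\<close>] by (simp add: y_def p_def)
  then obtain g c where g: "g \<in> X" "c \<in> C" "1 - p = g + c"
    by (auto simp: X'_def ideal_sum_def)
  have pq: "p * q \<in> C" if q: "q \<in> X" for q
  proof -
    have "a j * q \<in> C" if j: "j < r" for j
    proof -
      have "a j * q \<in> J"
        unfolding J_def
      proof (rule relation_idealI[OF _ j])
        fix v assume v: "v < n"
        have "(y v - (\<Sum>j<r. m j v * a j)) * q \<in> X'"
          using a[OF v] by (rule right_ideal_mult[OF rX'])
        moreover have "y v * q \<in> X'"
          using q XX' right_ideal_zero[OF rX'] by (auto simp: y_def)
        ultimately have "y v * q - (y v - (\<Sum>j<r. m j v * a j)) * q \<in> X'"
          using right_ideal_diff[OF rX'] by blast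
        then show "(\<Sum>j<r. m j v * (a j * q)) \<in> X'"
          by (simp add: left_diff_distrib sum_distrib_right mult.assoc)
      qed
      then show ?thesis
        using J_C j by auto
    qed
    then show ?thesis
      unfolding p_def sum_distrib_right mult.assoc
      by (intro right_ideal_sum[OF rC]) (simp add: left_ideal_mult[OF lC])
  qed
  have "x - g * x \<in> C" if "x \<in> X" for x
  proof -
    have "x - g * x = p * x + c * x"
      using g(3) by (metis add_diff_cancel_left' diff_add_cancel diff_diff_eq2 distrib_right left_diff_distrib mult_1_left add.commute)
    then show ?thesis
      using pq[OF that] g(2) right_ideal_add[OF rC] right_ideal_mult[OF rC] by simp
  qed
  then show ?thesis
    using g(1) by blast
qed

lemma ideal_power_H_ideal:
  assumes "H_ideal Y"
  shows "H_ideal (ideal_power Y n)"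
proof (induction n)
  case 0
  then show ?case
    by (auto simp: H_ideal_def two_sided_ideal_def left_ideal_def right_ideal_def H_stable_def)
next
  case (Suc n)
  then show ?case
    using assms by (auto simp: H_ideal_def two_sided_ideal_def
        intro: H_stable_set_product left_ideal_set_product right_ideal_set_product)
qed

text \<open>If the intersection \<open>Y\<close> is not nilpotent, then there is a nonzero finitely generated \<open>H\<close>-stable right ideal
  \<open>U = U Y\<close>.  Its relation ideal is contained in some \<open>C\<close>, but it also contains \<open>1 - y\<close> for some \<open>y \<in> Y \<subseteq> C\<close>.\<close>

lemma Inter_maximal_H_ideals:
  assumes fd: "finite_dimensional scaleH" and art: "right_artinian TYPE('a)" and sp: "H_semiprime act"
  shows "\<Inter>(Collect maximal_H_ideal) = {0}"
proof (rule ccontr)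
  define Y where "Y = \<Inter>(Collect maximal_H_ideal)"
  assume "\<Inter>(Collect maximal_H_ideal) \<noteq> {0}"
  then have Y0: "Y \<noteq> {0}"
    by (simp add: Y_def)
  have Y: "H_ideal Y"
    unfolding Y_def H_ideal_def two_sided_ideal_def left_ideal_def right_ideal_def H_stable_def
    by (auto simp: maximal_H_ideal_def H_ideal_def two_sided_ideal_def H_stable_def
        intro: left_ideal_zero left_ideal_add left_ideal_mult right_ideal_mult)
  then have lY: "left_ideal Y" and rY: "right_ideal Y" and sY: "H_stable act Y"
    by (auto simp: H_ideal_def two_sided_ideal_def)
  let ?E = "ideal_power Y"
  have E: "left_ideal (?E n)" "right_ideal (?E n)" "H_stable act (?E n)" for n
    using ideal_power_H_ideal[OF Y] by (auto simp: H_ideal_def two_sided_ideal_def)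
  have "decseq ?E"
    by (rule decseq_SucI) (simp add: set_product_subset_right_ideal[OF E(2)])
  then have "\<exists>n. \<forall>m\<ge>n. ?E m = ?E n"
    using art[unfolded right_artinian_def, rule_format, of ?E] E(2) by simp
  then obtain n0 where n0: "\<forall>m\<ge>n0. ?E m = ?E n0"
    by blast
  define W where "W = ?E n0"
  have W: "left_ideal W" "right_ideal W" "H_stable act W"
    using E by (auto simp: W_def)
  have "?E (Suc n0) = W"
    unfolding W_def by (rule n0[rule_format]) simp
  then have WY: "set_product W Y = W"
    by (simp add: W_def)
  have "W \<noteq> {0}"
    using sp Y0 lY rY sY unfolding H_semiprime_def W_def by blast
  have "set_product W (?E n) = W" for n
    by (induction n) (simp_all add: set_product_UNIV_right[OF W(2)] set_product_assoc[symmetric] WY)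
  then have WW: "set_product W W = W"
    by (simp add: W_def)
  define \<S> where "\<S> = {U. right_ideal U \<and> H_stable act U \<and> set_product U W \<noteq> {0}}"
  have "UNIV \<in> \<S>"
    using \<open>W \<noteq> {0}\<close> by (simp add: \<S>_def set_product_UNIV_left[OF W(1)] right_ideal_def H_stable_def)
  then have "\<exists>U\<in>\<S>. \<forall>N\<in>\<S>. N \<subseteq> U \<longrightarrow> N = U"
    by (intro right_artinian_minimal[OF art]) (auto simp: \<S>_def)
  then obtain U where "U \<in> \<S>" and Umin: "\<forall>N\<in>\<S>. N \<subseteq> U \<longrightarrow> N = U"
    by (elim bexE)
  then have U: "right_ideal U" "H_stable act U" "set_product U W \<noteq> {0}"
    by (auto simp: \<S>_def)
  have "set_product U W \<in> \<S>"
    using U W by (simp add: \<S>_def right_ideal_set_product H_stable_set_product set_product_assoc WW)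
  then have UW: "set_product U W = U"
    using Umin set_product_subset_right_ideal[OF U(1)] by blast
  have UY: "set_product U Y = U"
  proof -
    have "set_product (set_product U W) Y = set_product U W"
      by (simp only: set_product_assoc WY)
    then show ?thesis
      by (simp only: UW)
  qed
  have "\<exists>u\<in>U. \<exists>w\<in>W. u * w \<noteq> 0"
  proof (rule ccontr)
    assume no: "\<not> ?thesis"
    have "z = 0" if "z \<in> set_product U W" for z
      using that by (induction rule: set_product_induct) (use no in auto)
    then show False
      using U(3) by auto
  qed
  then obtain u w where u: "u \<in> U" "w \<in> W" "u * w \<noteq> 0"
    by blast
  define U1 where "U1 = set_product (range (\<lambda>h. act h u)) UNIV"
  have U1u: "u \<in> U1"
  proof -
    have "act 1 u * 1 \<in> U1"
      unfolding U1_def by (intro set_product_intro rangeI UNIV_I)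
    then show ?thesis
      by (simp add: act_one)
  qed
  have "U1 \<in> \<S>"
  proof -
    have "right_ideal U1"
      unfolding U1_def by (rule right_ideal_set_product) (simp add: right_ideal_def)
    moreover have "H_stable act U1"
      unfolding U1_def by (rule H_stable_set_product) (auto simp: H_stable_def right_ideal_def act_mult[symmetric])
    moreover have "set_product U1 W \<noteq> {0}"
      using set_product_intro[OF U1u u(2)] u(3) by auto
    ultimately show ?thesis
      by (simp add: \<S>_def)
  qed
  moreover have "U1 \<subseteq> U"
  proof -
    have "range (\<lambda>h. act h u) \<subseteq> U"
      using u U(2) by (auto simp: H_stable_def)
    then have "U1 \<subseteq> set_product U UNIV"
      unfolding U1_def by (intro set_product_mono) auto
    then show ?thesis
      by (simp add: set_product_UNIV_right[OF U(1)])
  qed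
  ultimately have U1: "U1 = U"
    using Umin by blast
  obtain B cf where B: "H.coordinates B cf"
    using H.coordinates_exist[OF fd] by blast
  then have finB: "finite B" and rep: "(\<Sum>b\<in>B. scaleH (cf h b) b) = h" for h
    by (auto simp: H.coordinates_def)
  obtain e where e: "bij_betw e {..<card B} B"
    using ex_bij_betw_nat_finite[OF finB] by (auto simp: atLeast0LessThan)
  have fg: "\<exists>a. y - (\<Sum>i<card B. act (e i) u * a i) \<in> {0}" if "y \<in> U" for y
  proof -
    have "\<exists>a. y = (\<Sum>i<card B. act (e i) u * a i)"
      using that unfolding U1[symmetric] U1_def
    proof (induction rule: set_product_induct)
      case zero
      show ?case
        by (rule exI[of _ "\<lambda>_. 0"]) simp
    next
      case (mult x q)
      then obtain h where "x = act h u"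
        by blast
      then have "x = (\<Sum>b\<in>B. scaleA (cf h b) (act b u))"
        using lin_sum[OF act_lin_left, of "\<lambda>b. scaleH (cf h b) b" B u] by (simp add: rep act_scale_left)
      then have "x * q = (\<Sum>b\<in>B. act b u * scaleA (cf h b) q)"
        by (simp add: sum_distrib_right A.scale_mult_left[symmetric] A.scale_mult_right[symmetric])
      also have "\<dots> = (\<Sum>i<card B. act (e i) u * scaleA (cf h (e i)) q)"
        by (rule sum.reindex_bij_betw[OF e, symmetric])
      finally show ?case
        by (rule exI[of _ "\<lambda>i. scaleA (cf h (e i)) q"])
    next
      case (diff y z)
      then obtain a b where "y = (\<Sum>i<card B. act (e i) u * a i)" "z = (\<Sum>i<card B. act (e i) u * b i)"
        by blast
      then have "y - z = (\<Sum>i<card B. act (e i) u * (a i - b i))"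
        by (simp add: right_diff_distrib sum_subtractf)
      then show ?case
        by (rule exI[of _ "\<lambda>i. a i - b i"])
    qed
    then show ?thesis
      by auto
  qed
  have nontriv: "(1::'a) \<noteq> 0"
    using u(3) by (metis mult_1_left mult_zero_left)
  have r0: "right_ideal {0::'a}" "H_stable act {0}"
    by (auto simp: right_ideal_def H_stable_def act_zero)
  have "act (e i) u \<in> U" if "i < card B" for i
    using u U(2) by (simp add: H_stable_def)
  from generators_with_proper_relations[OF art nontriv U(1) r0(1) this fg]
  obtain n r m P where "0 < n" and mU: "\<And>j u. j < r \<Longrightarrow> u < n \<Longrightarrow> m j u \<in> U"
      and gen: "generates_mod U {0} n r m"
      and ind: "independent_mod {0} P n r m" and P: "maximal_ideal P"
    by blast
  define J where "J = relation_ideal {0} n r m"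
  have "H_ideal J"
    unfolding J_def H_ideal_def using two_sided_ideal_relation_ideal[OF r0(1)]
      H_stable_relation_ideal[OF fd art U(2) r0(1,2) mU gen] by auto
  moreover have "1 \<notin> J"
    using relation_ideal_subset[OF ind] P unfolding J_def maximal_ideal_def two_sided_ideal_def by blast
  ultimately obtain C where C: "maximal_H_ideal C" "J \<subseteq> C"
    using maximal_H_ideal_exists by blast
  then have rC: "right_ideal C" and "1 \<notin> C" and "Y \<subseteq> C"
    by (auto simp: maximal_H_ideal_def H_ideal_def two_sided_ideal_def Y_def)
  have "0 < r"
  proof (rule Nat.gr0I)
    assume "r = 0"
    then have "u = 0"
      using gen[unfolded generates_mod_def, rule_format, of "\<lambda>_. u"] u(1) \<open>0 < n\<close> by auto
    then show False
      using u(3) by simp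
  qed
  \<comment> \<open>As \<open>U = U Y\<close>, vectors over \<open>U\<close> can be written with
    coefficients in \<open>Y\<close>. Applied to the components of \<open>m 0\<close>, this gives a
    second expression of \<open>m 0\<close>; its difference from the trivial one is a relation with
    coefficient \<open>1 - y\<close> at \<open>0\<close>.\<close>
  have coeffs: "\<exists>y. (\<forall>j. y j \<in> Y) \<and> (\<forall>u<n. (if u = v then z else 0) = (\<Sum>j<r. m j u * y j))"
    if "z \<in> set_product U Y" "v < n" for z v
    using that(1)
  proof (induction rule: set_product_induct)
    case zero
    show ?case
      by (rule exI[of _ "\<lambda>_. 0"]) (simp add: left_ideal_zero[OF lY])
  next
    case (mult x q)
    have "\<exists>a. \<forall>u<n. (if u = v then x else 0) - (\<Sum>j<r. m j u * a j) \<in> {0}"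
      by (rule gen[unfolded generates_mod_def, rule_format])
        (use mult right_ideal_zero[OF U(1)] in auto)
    then obtain a where a: "\<forall>u<n. (if u = v then x else 0) - (\<Sum>j<r. m j u * a j) \<in> {0}"
      by (elim exE)
    have "(if u = v then x * q else 0) = (\<Sum>j<r. m j u * (a j * q))" if "u < n" for u
    proof -
      have "(if u = v then x * q else 0) = (if u = v then x else 0) * q"
        by simp
      also have "(if u = v then x else 0) = (\<Sum>j<r. m j u * a j)"
        using a that by auto
      finally show ?thesis
        by (simp add: sum_distrib_right mult.assoc)
    qed
    then show ?case
      by (intro exI[of _ "\<lambda>j. a j * q"]) (auto intro: left_ideal_mult[OF lY mult(2)])
  next
    case (diff a b)
    then obtain y y' where y: "\<forall>j. y j \<in> Y" "\<forall>u<n. (if u = v then a else 0) = (\<Sum>j<r. m j u * y j)"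
        "\<forall>j. y' j \<in> Y" "\<forall>u<n. (if u = v then b else 0) = (\<Sum>j<r. m j u * y' j)"
      by blast
    have "(if u = v then a - b else 0) = (\<Sum>j<r. m j u * (y j - y' j))" if "u < n" for u
    proof -
      have "(if u = v then a - b else 0) = (if u = v then a else 0) - (if u = v then b else 0)"
        by simp
      also have "\<dots> = (\<Sum>j<r. m j u * (y j - y' j))"
        using y(2,4) that by (simp only: right_diff_distrib sum_subtractf)
      finally show ?thesis .
    qed
    then show ?case
      using y(1,3) by (intro exI[of _ "\<lambda>j. y j - y' j"]) (auto intro: left_ideal_diff[OF lY])
  qed
  have "\<forall>v. v < n \<longrightarrow> (\<exists>y. (\<forall>j. y j \<in> Y) \<and> (\<forall>u<n. (if u = v then m 0 v else 0) = (\<Sum>j<r. m j u * y j)))"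
    using coeffs mU[OF \<open>0 < r\<close>] UY by blast
  then obtain y where yY: "\<And>v j. v < n \<Longrightarrow> y v j \<in> Y"
      and y: "\<And>v u. v < n \<Longrightarrow> u < n \<Longrightarrow> (if u = v then m 0 v else 0) = (\<Sum>j<r. m j u * y v j)"
    by metis
  define a where "a j = (if j = 0 then 1 else 0) - (\<Sum>v<n. y v j)" for j
  have "a 0 \<in> J"
    unfolding J_def
  proof (rule relation_idealI[OF _ \<open>0 < r\<close>])
    fix u assume u: "u < n"
    have "m 0 u = (\<Sum>v<n. if u = v then m 0 v else 0)"
      using u by simp
    also have "\<dots> = (\<Sum>v<n. \<Sum>j<r. m j u * y v j)"
      using y u by (intro sum.cong) auto
    also have "\<dots> = (\<Sum>j<r. m j u * (\<Sum>v<n. y v j))"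
      by (subst sum.swap) (simp add: sum_distrib_left)
    finally have "m 0 u = (\<Sum>j<r. m j u * (\<Sum>v<n. y v j))" .
    moreover have "(\<Sum>j<r. m j u * (if j = 0 then 1 else 0)) = m 0 u"
      using \<open>0 < r\<close> by (simp add: if_distrib[of "\<lambda>x. _ * x"] cong: if_cong)
    ultimately show "(\<Sum>j<r. m j u * a j) \<in> {0}"
      by (simp add: a_def right_diff_distrib sum_subtractf)
  qed
  then have "1 - (\<Sum>v<n. y v 0) \<in> C"
    using C(2) by (auto simp: a_def)
  moreover have "(\<Sum>v<n. y v 0) \<in> C"
    using yY \<open>Y \<subseteq> C\<close> by (intro right_ideal_sum[OF rC]) auto
  ultimately show False
    using \<open>1 \<notin> C\<close> right_ideal_iff_diff[OF rC] by blast
qed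

text \<open>All ideals \<open>C\<close> are treated at once by choosing \<open>g\<close> with
  \<open>(1 - g) X\<close> minimal. Replacing \<open>g\<close> by \<open>g + g' - g g'\<close>
  multiplies \<open>1 - g\<close> by \<open>1 - g'\<close> on the right; with \<open>g'\<close> the
  projection modulo \<open>C\<close>, minimality forces \<open>(1 - g) X\<close> into
  \<open>C\<close>.\<close>

lemma H_stable_right_ideal_left_unit:
  assumes fd: "finite_dimensional scaleH" and art: "right_artinian TYPE('a)" and sp: "H_semiprime act"
    and X: "right_ideal X" "H_stable act X"
  shows "\<exists>g\<in>X. \<forall>x\<in>X. g * x = x"
proof -
  define R where "R g = (\<lambda>x. x - g * x) ` X" for g
  have rR: "right_ideal (R g)" for g
  proof (rule right_idealI_diff)
    show "0 \<in> R g"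
      using right_ideal_zero[OF X(1)] by (auto simp: R_def intro!: image_eqI[of _ _ 0])
    show "x - y \<in> R g" if xy: "x \<in> R g" "y \<in> R g" for x y
    proof -
      obtain x' y' where "x = x' - g * x'" "y = y' - g * y'" "x' \<in> X" "y' \<in> X"
        using xy by (auto simp: R_def)
      then show ?thesis
        unfolding R_def
        by (intro image_eqI[of _ _ "x' - y'"]) (auto simp: right_diff_distrib right_ideal_diff[OF X(1)])
    qed
    show "x * q \<in> R g" if x: "x \<in> R g" for x q
    proof -
      obtain x' where "x = x' - g * x'" "x' \<in> X"
        using x by (auto simp: R_def)
      then show ?thesis
        unfolding R_def
        by (intro image_eqI[of _ _ "x' * q"]) (auto simp: left_diff_distrib mult.assoc right_ideal_mult[OF X(1)])
    qed
  qed
  have "\<exists>M\<in>R ` X. \<forall>N\<in>R ` X. N \<subseteq> M \<longrightarrow> N = M"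
    by (rule right_artinian_minimal[OF art]) (use right_ideal_zero[OF X(1)] rR in auto)
  then obtain g where g: "g \<in> X" and gmin: "\<And>g'. g' \<in> X \<Longrightarrow> R g' \<subseteq> R g \<Longrightarrow> R g' = R g"
    by auto
  have "x - g * x \<in> C" if x: "x \<in> X" and C: "maximal_H_ideal C" for x C
  proof -
    have lC: "left_ideal C"
      using C by (auto simp: maximal_H_ideal_def H_ideal_def two_sided_ideal_def)
    obtain g' where g': "g' \<in> X" "\<forall>x\<in>X. x - g' * x \<in> C"
      using projection_modulo_maximal_H_ideal[OF fd art X C] by blast
    define g2 where "g2 = g + g' - g * g'"
    have g2: "g2 \<in> X"
      unfolding g2_def using g g' right_ideal_add[OF X(1)] right_ideal_diff[OF X(1)] right_ideal_mult[OF X(1)] by blast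
    have eq: "x - g2 * x = (x - g' * x) - g * (x - g' * x)" for x
      by (simp add: g2_def algebra_simps)
    have "R g2 \<subseteq> R g"
      using g'(1) by (auto simp: R_def eq right_ideal_diff[OF X(1)] right_ideal_mult[OF X(1)] intro!: imageI)
    then have "R g2 = R g"
      by (rule gmin[OF g2])
    moreover have "R g2 \<subseteq> C"
      using g'(2) by (auto simp: R_def eq intro: left_ideal_diff[OF lC] left_ideal_mult[OF lC])
    ultimately show ?thesis
      using x by (auto simp: R_def)
  qed
  then have "x - g * x \<in> \<Inter>(Collect maximal_H_ideal)" if "x \<in> X" for x
    using that by blast
  then have "x - g * x = 0" if "x \<in> X" for x
    using that Inter_maximal_H_ideals[OF fd art sp] by blast
  then show ?thesis
    using g by force
qed

section \<open>Invariants and averaging by the integral\<close>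

abbreviation INV :: "'a set"
  where "INV \<equiv> invariants counit scaleA act"

lemma invD: "c \<in> INV \<Longrightarrow> act h c = scaleA (counit h) c"
  by (simp add: invariants_def)

lemma act_inv_left: "c \<in> INV \<Longrightarrow> act h (c * a) = c * act h a"
  using sw_counit[of "\<lambda>y. c * act y a" h]
  by (simp add: act_mult_sw invD lin_simps)

lemma act_inv_right: "c \<in> INV \<Longrightarrow> act h (a * c) = act h a * c"
  using H.sw_counit_right[OF VA, of "\<lambda>y. act y a * c" h]
  by (simp add: act_mult_sw invD lin_simps)

text \<open>The right-hand side expands to \<open>(h1 a) (h2 S(h3) x)\<close>, and
  \<open>h2 S(h3)\<close> collapses to a counit.\<close>

lemma act_mult_antipode: "act h a * x = sw (\<lambda>p q. act p (a * act (antipode q) x)) h"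
proof -
  have "trilin scaleH scaleA (\<lambda>y z q. act y a * act z (act (antipode q) x))"
    by (simp add: lin_simps)
  from sw_coassoc[OF this, of h]
  have "sw (\<lambda>p q. act p (a * act (antipode q) x)) h =
      sw (\<lambda>p q. sw (\<lambda>y z. act p a * act y (act (antipode z) x)) q) h"
    by (simp add: act_mult_sw)
  also have "\<dots> = sw (\<lambda>p q. scaleA (counit q) (act p a * x)) h"
    using H.sw_antipode_right[OF VA act_lin_left, of x]
    by (simp add: sw_mult_left[symmetric] act_mult act_one A.scale_mult_right)
  also have "\<dots> = act h a * x"
    by (rule H.sw_counit_right[OF VA]) (simp add: lin_simps)
  finally show ?thesis
    by simp
qed

lemma inv_one: "1 \<in> INV"
proof -
  have "act h 1 = scaleA (counit h) 1" for h
    using act_mult_antipode[of h 1 1] H.sw_antipode_right[OF VA act_lin_left, of 1 h]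
    by (simp add: act_mult act_one)
  then show ?thesis
    by (simp add: invariants_def)
qed

lemma inv_zero: "0 \<in> INV"
  by (simp add: invariants_def act_zero)

lemma inv_diff: "a \<in> INV \<Longrightarrow> b \<in> INV \<Longrightarrow> a - b \<in> INV"
  by (simp add: invariants_def act_diff A.scale_right_diff_distrib)

lemma inv_mult:
  assumes "a \<in> INV" "b \<in> INV"
  shows "a * b \<in> INV"
proof -
  have "act h (a * b) = scaleA (counit h) (a * b)" for h
    using assms by (simp add: act_inv_left invD[OF assms(2)] A.scale_mult_right)
  then show ?thesis
    by (simp add: invariants_def)
qed

lemma integral_act_inv:
  assumes "\<And>h. h * t = scaleH (counit h) t"
  shows "act t a \<in> INV"
  using assms by (simp add: invariants_def act_mult[symmetric] act_scale_left)

text \<open>Maschke's argument: for a left unit \<open>g\<close> of \<open>X\<close>,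
  \<open>(t g) x\<close> is the sum of the \<open>t1 (g (S(t2) x))\<close>, where \<open>g\<close>
  may be dropped since \<open>S(t2) x \<in> X\<close>; what remains is
  \<open>\<epsilon>(t) x = x\<close>.\<close>

theorem H_stable_right_ideal_idempotent:
  assumes fd: "finite_dimensional scaleH" and ss: "semisimple_ring TYPE('h)"
    and art: "right_artinian TYPE('a)" and sp: "H_semiprime act"
    and X: "right_ideal X" "H_stable act X"
  shows "\<exists>e\<in>X \<inter> INV. \<forall>x\<in>X. e * x = x"
proof -
  obtain t where t: "\<And>h. h * t = scaleH (counit h) t" "counit t = 1"
    using H.left_integral_exists[OF ss] by blast
  obtain g where g: "g \<in> X" "\<And>x. x \<in> X \<Longrightarrow> g * x = x"
    using H_stable_right_ideal_left_unit[OF fd art sp X] by blast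
  have "act t g * x = x" if "x \<in> X" for x
  proof -
    have "act h x \<in> X" for h
      using X(2) that by (simp add: H_stable_def)
    then show ?thesis
      using act_mult_antipode[of t g x] H.sw_antipode_right[OF VA act_lin_left, of x t] t(2)
      by (simp add: g(2) act_mult act_one)
  qed
  moreover have "act t g \<in> X"
    using X(2) g(1) by (simp add: H_stable_def)
  ultimately show ?thesis
    using integral_act_inv[OF t(1)] by blast
qed

section \<open>Descending chains of right modules over the invariants\<close>

text \<open>The right-hand side expands to \<open>S(g1) g2 (q (S(g3) a))\<close>, and
  \<open>S(g1) g2\<close> collapses to a counit.\<close>

lemma mult_act_antipode: "q * act (antipode g) a = sw (\<lambda>x y. act (antipode x) (act y q * a)) g"
proof -
  have "trilin scaleH scaleA (\<lambda>x p r. act (antipode x * p) (q * act (antipode r) a))"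
    by (simp add: lin_simps)
  from sw_coassoc[OF this, of g]
  have "sw (\<lambda>x y. act (antipode x) (act y q * a)) g =
      sw (\<lambda>x y. sw (\<lambda>p r. act (antipode p * r) (q * act (antipode y) a)) x) g"
    by (simp add: act_mult_antipode[of _ q a] act_sw act_mult)
  also have "\<dots> = sw (\<lambda>x y. scaleA (counit x) (q * act (antipode y) a)) g"
    using H.sw_antipode_left[OF VA act_lin_left] by (simp add: act_one)
  also have "\<dots> = q * act (antipode g) a"
    by (rule sw_counit) (simp add: lin_simps)
  finally show ?thesis
    by simp
qed

text \<open>Surjectivity of the antipode allows \<open>h = antipode g\<close>. Since the
  \<open>w b\<close> do not depend on \<open>a\<close>, the map sending \<open>a\<close> to
  \<open>q * act h a\<close> is recorded by a vector in a finite power of \<open>Q\<close>;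
  composing it with left multiplication by \<open>r\<close> replaces \<open>w b\<close> by
  \<open>w b * r\<close>.\<close>

lemma mult_act_decomposition:
  assumes surj: "surj antipode" and B: "H.coordinates B cf"
  shows "\<exists>w. \<forall>a. q * act h a = (\<Sum>b\<in>B. act (antipode b) (w b * a))"
proof -
  obtain g where g: "h = antipode g"
    using surj by blast
  have cf: "lin scaleH (*) (\<lambda>h. cf h b)" and rep: "(\<Sum>b\<in>B. scaleH (cf h b) b) = h" for b h
    using B by (auto simp: H.coordinates_def)
  have ant: "act (antipode x) z = (\<Sum>b\<in>B. act (antipode b) (scaleA (cf x b) z))" for x z
  proof -
    have "lin scaleH scaleA (\<lambda>x. act (antipode x) z)"
      by (simp add: lin_simps)
    from lin_sum[OF this, of "\<lambda>b. scaleH (cf x b) b" B] show ?thesis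
      by (simp add: rep lin_scale[OF H.antipode_lin] act_scale_left act_scale_right)
  qed
  have "q * act h a = (\<Sum>b\<in>B. act (antipode b) (sw (\<lambda>x y. scaleA (cf x b) (act y q)) g * a))" for a
    unfolding g mult_act_antipode
    by (subst ant) (simp add: sw_sum_fun act_sw sw_mult_right A.scale_mult_left)
  then show ?thesis
    by (intro exI[of _ "\<lambda>b. sw (\<lambda>x y. scaleA (cf x b) (act y q)) g"] allI)
qed

text \<open>A right \<open>Q\<^sup>H\<close>-submodule \<open>V\<close> is recorded by the right
  \<open>Q\<close>-module of functions on \<open>B\<close> generated by the \<open>w y\<close> with
  \<open>y \<in> V\<close>. The function \<open>w y b * q\<close> evaluates to
  \<open>y * act t q\<close>, which stays in \<open>V\<close> as \<open>act t q\<close> is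
  invariant, and is \<open>y\<close> for \<open>q = 1\<close>. So \<open>V\<close> is recovered, and
  the chain condition transfers.\<close>

lemma invariant_submodules_dcc:
  fixes V :: "nat \<Rightarrow> 'a set"
  assumes fd: "finite_dimensional scaleH" and ss: "semisimple_ring TYPE('h)" and art: "right_artinian TYPE('a)"
    and dec: "decseq V" and zero: "\<And>n. 0 \<in> V n" and add: "\<And>n x y. x \<in> V n \<Longrightarrow> y \<in> V n \<Longrightarrow> x + y \<in> V n"
    and mult: "\<And>n x c. x \<in> V n \<Longrightarrow> c \<in> INV \<Longrightarrow> x * c \<in> V n"
  shows "\<exists>n. \<forall>m\<ge>n. V m = V n"
proof -
  obtain t where t: "\<And>h. h * t = scaleH (counit h) t" "counit t = 1"
    using H.left_integral_exists[OF ss] by blast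
  obtain B cf where B: "H.coordinates B cf"
    using H.coordinates_exist[OF fd] by blast
  have "\<forall>y. \<exists>w. \<forall>a. y * act t a = (\<Sum>b\<in>B. act (antipode b) (w b * a))"
    using mult_act_decomposition[OF H.antipode_surj[OF fd ss] B] by blast
  then obtain w where w: "\<And>y a. y * act t a = (\<Sum>b\<in>B. act (antipode b) (w y b * a))"
    by metis
  define F where "F ps b = (\<Sum>(y, q)\<leftarrow>ps. w y b * q)" for ps b
  define N where "N n = {F ps | ps. set ps \<subseteq> V n \<times> UNIV}" for n
  have "\<exists>n. \<forall>m\<ge>n. \<forall>f\<in>N n. \<exists>g\<in>N m. \<forall>b\<in>B. f b = g b"
  proof (rule right_artinian_functions[OF art])
    show "finite B"
      using B by (simp add: H.coordinates_def)
    show "decseq N"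
      using dec by (fastforce simp: decseq_def N_def)
    show "(\<lambda>_. 0) \<in> N n" for n
      unfolding N_def by (intro CollectI exI[of _ "[]"]) (auto simp: F_def)
    show "(\<lambda>i. f i + g i) \<in> N n" if "f \<in> N n" "g \<in> N n" for n f g
    proof -
      from that obtain ps qs where "f = F ps" "g = F qs" "set ps \<subseteq> V n \<times> UNIV" "set qs \<subseteq> V n \<times> UNIV"
        by (auto simp: N_def)
      then show ?thesis
        unfolding N_def by (intro CollectI exI[of _ "ps @ qs"]) (auto simp: F_def)
    qed
    show "(\<lambda>i. f i * q) \<in> N n" if "f \<in> N n" for n f q
    proof -
      from that obtain ps where ps: "f = F ps" "set ps \<subseteq> V n \<times> UNIV"
        by (auto simp: N_def)
      have "F (map (\<lambda>(y, r). (y, r * q)) ps) b = F ps b * q" for b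
        unfolding F_def by (induction ps) (auto simp: distrib_right mult.assoc)
      then show ?thesis
        unfolding N_def using ps
        by (intro CollectI exI[of _ "map (\<lambda>(y, r). (y, r * q)) ps"]) (auto intro!: ext)
    qed
  qed
  then obtain n where n: "\<And>m f. m \<ge> n \<Longrightarrow> f \<in> N n \<Longrightarrow> \<exists>g\<in>N m. \<forall>b\<in>B. f b = g b"
    by blast
  have eval: "(\<Sum>b\<in>B. act (antipode b) (F ps b)) = (\<Sum>(y, q)\<leftarrow>ps. y * act t q)" for ps
    by (induction ps) (auto simp: F_def w act_zero act_add_right sum.distrib)
  have t1: "act t 1 = 1"
    using invD[OF inv_one, of t] t(2) by simp
  have "V n \<subseteq> V m" if m: "m \<ge> n" for m
  proof
    fix y assume y: "y \<in> V n"
    then have "F [(y, 1)] \<in> N n"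
      by (auto simp: N_def)
    then obtain g where "g \<in> N m" "\<forall>b\<in>B. F [(y, 1)] b = g b"
      using n[OF m] by blast
    then obtain ps where ps: "set ps \<subseteq> V m \<times> UNIV" "\<forall>b\<in>B. F [(y, 1)] b = F ps b"
      by (auto simp: N_def)
    have "y = (\<Sum>b\<in>B. act (antipode b) (F [(y, 1)] b))"
      by (simp only: eval) (simp add: t1)
    also have "\<dots> = (\<Sum>(y, q)\<leftarrow>ps. y * act t q)"
      using ps(2) by (simp add: eval[symmetric])
    also have "\<dots> \<in> V m"
      using ps(1) by (induction ps) (auto intro: zero add mult integral_act_inv t)
    finally show "y \<in> V m" .
  qed
  then show ?thesis
    using decseqD[OF dec] by (intro exI[of _ n] allI impI antisym) auto
qed

end

section \<open>The classical right quotient ring\<close>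

locale module_algebra_quotient =
  A: module_algebra scaleH comult counit antipode scaleA actA +
  Q: module_algebra scaleH comult counit antipode scaleQ actQ
  for scaleH :: "'k::field \<Rightarrow> 'h::ring_1 \<Rightarrow> 'h" and comult counit antipode
    and scaleA :: "'k \<Rightarrow> 'a::{ring,monoid_mult} \<Rightarrow> 'a" and actA
    and scaleQ :: "'k \<Rightarrow> 'q::{ring,monoid_mult} \<Rightarrow> 'q" and actQ +
  fixes \<iota> :: "'a \<Rightarrow> 'q"
  assumes fd: "finite_dimensional scaleH" and ss: "semisimple_ring TYPE('h)"
    and sp: "H_semiprime actA" and quotient: "classical_right_quotient_ring \<iota>"
    and art: "right_artinian TYPE('q)" and \<iota>_act: "\<And>h a. \<iota> (actA h a) = actQ h (\<iota> a)"
begin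

lemma \<iota>_inj: "\<iota> a = \<iota> b \<Longrightarrow> a = b"
  and \<iota>_one: "\<iota> 1 = 1"
  and \<iota>_add: "\<iota> (a + b) = \<iota> a + \<iota> b"
  and \<iota>_mult: "\<iota> (a * b) = \<iota> a * \<iota> b"
  and regular_invertible: "regular s \<Longrightarrow> \<exists>t. \<iota> s * t = 1 \<and> t * \<iota> s = 1"
  and fraction: "\<exists>a s t. regular s \<and> \<iota> s * t = 1 \<and> t * \<iota> s = 1 \<and> q = \<iota> a * t"
  using quotient by (auto simp: classical_right_quotient_ring_def inj_eq)

lemma \<iota>_zero: "\<iota> 0 = 0"
  using \<iota>_add[of 0 0] by simp

lemma \<iota>_diff: "\<iota> (a - b) = \<iota> a - \<iota> b"
  using \<iota>_add[of "a - b" b] by (simp add: algebra_simps)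

lemma \<iota>_sum: "\<iota> (sum f F) = (\<Sum>i\<in>F. \<iota> (f i))"
  by (induction F rule: infinite_finite_induct) (auto simp: \<iota>_zero \<iota>_add)

text \<open>Linearity of the embedding follows from its compatibility with the action: the scalar
  \<open>c\<close> acts as \<open>scaleH c 1\<close>.\<close>

lemma \<iota>_scale: "\<iota> (scaleA c a) = scaleQ c (\<iota> a)"
  using \<iota>_act[of "scaleH c 1" a] by (simp add: A.act_scale_left Q.act_scale_left A.act_one Q.act_one)

lemma \<iota>_inv: "\<iota> a \<in> Q.INV \<longleftrightarrow> a \<in> A.INV"
  using \<iota>_inj by (auto simp: invariants_def \<iota>_act[symmetric] \<iota>_scale[symmetric])

lemma regular_cancel: "regular s \<Longrightarrow> q * \<iota> s = 0 \<Longrightarrow> q = 0"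
  by (metis regular_invertible mult.assoc mult_1_right mult_zero_left)

lemma regular_one: "regular 1"
  by (simp add: regular_def)

lemma regular_mult:
  assumes "regular a" "regular b"
  shows "regular (a * b)"
  unfolding regular_def
proof (intro conjI allI impI)
  fix x
  show "x = 0" if "a * b * x = 0"
    using assms that unfolding regular_def mult.assoc by blast
  show "x = 0" if "x * (a * b) = 0"
    using assms that unfolding regular_def mult.assoc[symmetric] by blast
qed

lemma common_denominator:
  assumes "finite F"
  shows "\<exists>s. regular s \<and> (\<forall>q\<in>F. \<exists>a. q * \<iota> s = \<iota> a)"
  using assms
proof (induction F)
  case empty
  show ?case
    using regular_one by blast
next
  case (insert q F)
  then obtain s where s: "regular s" "\<forall>q\<in>F. \<exists>a. q * \<iota> s = \<iota> a"
    by blast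
  obtain b s' t where b: "regular s'" "t * \<iota> s' = 1" "q * \<iota> s = \<iota> b * t"
    using fraction[of "q * \<iota> s"] by blast
  have "\<exists>a. p * \<iota> (s * s') = \<iota> a" if "p \<in> insert q F" for p
  proof (cases "p = q")
    case True
    then have "p * \<iota> (s * s') = \<iota> b * (t * \<iota> s')"
      by (simp add: \<iota>_mult b(3) mult.assoc[symmetric])
    then show ?thesis
      by (simp add: b(2)) blast
  next
    case False
    then have "\<exists>a. p * \<iota> s = \<iota> a"
      using s(2) that by simp
    then obtain a where "p * \<iota> s = \<iota> a"
      by blast
    then have "p * \<iota> (s * s') = \<iota> (a * s')"
      by (simp add: \<iota>_mult mult.assoc[symmetric])
    then show ?thesis
      by blast
  qed
  then show ?case
    using regular_mult[OF s(1) b(1)] by (intro exI[of _ "s * s'"]) simp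
qed

text \<open>Contraction to \<open>A\<close> preserves nilpotency and stability, and no nonzero right
  ideal of \<open>Q\<close> contracts to zero, because denominators are cleared by multiplication on
  the right.\<close>

lemma H_semiprime_quotient: "H_semiprime actQ"
  unfolding H_semiprime_def
proof (intro allI impI)
  fix N assume "left_ideal N \<and> right_ideal N \<and> H_stable actQ N \<and> (\<exists>n. ideal_power N n = {0})"
  then obtain n where N: "left_ideal N" "right_ideal N" "H_stable actQ N" "ideal_power N n = {0}"
    by blast
  let ?M = "{a. \<iota> a \<in> N}"
  have M: "left_ideal ?M" "right_ideal ?M" "H_stable actA ?M"
    using N by (auto simp: left_ideal_def right_ideal_def H_stable_def \<iota>_zero \<iota>_add \<iota>_mult \<iota>_act)
  have pow: "\<iota> a \<in> ideal_power N k" if "a \<in> ideal_power ?M k" for a k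
    using that
  proof (induction k arbitrary: a)
    case (Suc k)
    from Suc.prems show ?case
      unfolding ideal_power.simps
      by (induction rule: set_product_induct)
        (auto simp: \<iota>_zero \<iota>_mult \<iota>_diff intro: set_product_diff set_product_intro Suc.IH)
  qed simp
  have "a = 0" if "a \<in> ideal_power ?M n" for a
    using pow[OF that] N(4) \<iota>_inj[of a 0] by (simp add: \<iota>_zero)
  moreover have "0 \<in> ideal_power ?M n"
    by (cases n) auto
  ultimately have "ideal_power ?M n = {0}"
    by blast
  then have M0: "?M = {0}"
    using sp M unfolding H_semiprime_def by blast
  have "q = 0" if "q \<in> N" for q
  proof -
    obtain s a where s: "regular s" "q * \<iota> s = \<iota> a"
      using common_denominator[of "{q}"] by auto
    then have "a \<in> ?M"
      using right_ideal_mult[OF N(2) that, of "\<iota> s"] by simp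
    then have "a = 0"
      using M0 by blast
    then show ?thesis
      using s regular_cancel by (simp add: \<iota>_zero)
  qed
  then show "N = {0}"
    using right_ideal_zero[OF N(2)] by blast
qed

lemmas right_ideal_idempotent = Q.H_stable_right_ideal_idempotent[OF fd ss art H_semiprime_quotient]

section \<open>Dense right ideals\<close>

definition dense :: "'a set \<Rightarrow> bool"
  where "dense K \<longleftrightarrow> right_ideal K \<and> H_stable actA K \<and> (\<exists>s\<in>K. regular s)"

text \<open>Wanted is a regular \<open>s'\<close> with \<open>actA b s' \<in> s A\<close> for all
  \<open>b \<in> B\<close>. Moving \<open>t = s\<inverse>\<close> past the action turns
  \<open>t * actQ b s'\<close> into a sum of terms \<open>S(b') (w b b' * s')\<close>, so a common
  denominator \<open>s'\<close> of the finitely many \<open>w b b'\<close> will do.\<close>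

lemma dense_core:
  assumes D: "right_ideal D" "s \<in> D" "regular s"
  shows "\<exists>K. dense K \<and> K \<subseteq> D"
proof -
  define K where "K = {a. \<forall>h. actA h a \<in> D}"
  obtain t where t: "\<iota> s * t = 1"
    using regular_invertible[OF D(3)] by blast
  obtain B cf where B: "A.H.coordinates B cf"
    using A.H.coordinates_exist[OF fd] by blast
  have "\<forall>b. \<exists>w. \<forall>a. t * actQ b a = (\<Sum>b'\<in>B. actQ (antipode b') (w b' * a))"
    using Q.mult_act_decomposition[OF A.H.antipode_surj[OF fd ss] B] by blast
  then obtain w where w: "\<And>b a. t * actQ b a = (\<Sum>b'\<in>B. actQ (antipode b') (w b b' * a))"
    by metis
  have "finite B"
    using B by (simp add: A.H.coordinates_def)
  then have "finite ((\<lambda>(b, b'). w b b') ` (B \<times> B))"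
    by simp
  from common_denominator[OF this] obtain s' where s': "regular s'"
      "\<forall>b\<in>B. \<forall>b'\<in>B. \<exists>a. w b b' * \<iota> s' = \<iota> a"
    by auto
  then obtain v where v: "\<And>b b'. b \<in> B \<Longrightarrow> b' \<in> B \<Longrightarrow> w b b' * \<iota> s' = \<iota> (v b b')"
    by metis
  have b_D: "actA b s' \<in> D" if b: "b \<in> B" for b
  proof -
    have "\<iota> s * (t * actQ b (\<iota> s')) = \<iota> s * (\<Sum>b'\<in>B. actQ (antipode b') (\<iota> (v b b')))"
      unfolding w using v[OF b] by simp
    then have "\<iota> (actA b s') = \<iota> (s * (\<Sum>b'\<in>B. actA (antipode b') (v b b')))"
      by (simp add: mult.assoc[symmetric] t \<iota>_mult \<iota>_sum \<iota>_act)
    then have "actA b s' = s * (\<Sum>b'\<in>B. actA (antipode b') (v b b'))"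
      by (rule \<iota>_inj)
    then show ?thesis
      using right_ideal_mult[OF D(1,2)] by simp
  qed
  have "actA h s' \<in> D" for h
  proof -
    have "h = (\<Sum>b\<in>B. scaleH (cf h b) b)"
      using B by (simp add: A.H.coordinates_def)
    then have "actA h s' = (\<Sum>b\<in>B. scaleA (cf h b) (actA b s'))"
      using lin_sum[OF A.act_lin_left, of "\<lambda>b. scaleH (cf h b) b" B s'] by (simp add: A.act_scale_left)
    also have "\<dots> \<in> D"
      using b_D by (intro right_ideal_sum[OF D(1)] A.right_ideal_scale[OF D(1)])
    finally show ?thesis .
  qed
  then have "s' \<in> K"
    by (simp add: K_def)
  moreover have "right_ideal K"
    unfolding right_ideal_def
  proof (intro conjI ballI allI)
    show "0 \<in> K"
      by (simp add: K_def A.act_zero right_ideal_zero[OF D(1)])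
    show "x + y \<in> K" if "x \<in> K" "y \<in> K" for x y
      using that by (simp add: K_def A.act_add_right right_ideal_add[OF D(1)])
    show "x * r \<in> K" if "x \<in> K" for x r
      using that by (simp add: K_def A.act_mult_sw A.sw_in_right_ideal[OF D(1)] right_ideal_mult[OF D(1)])
  qed
  moreover have "H_stable actA K"
    by (simp add: H_stable_def K_def A.act_mult[symmetric])
  moreover have "K \<subseteq> D"
    using A.act_one by (auto simp: K_def) metis
  ultimately show ?thesis
    using s'(1) by (auto simp: dense_def)
qed

text \<open>With \<open>t = s\<inverse>\<close>, a common denominator \<open>s'\<close> of
  \<open>t\<close> and \<open>t * x\<close> has both \<open>s'\<close> and \<open>x s'\<close> in
  \<open>s A \<subseteq> K\<close>. So the \<open>k \<in> K\<close> with \<open>x k \<in> K\<close>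
  form a right ideal \<open>D\<close> with a regular element, which contains a dense one.\<close>

lemma dense_multiplier:
  assumes "dense K"
  shows "\<exists>K'. dense K' \<and> K' \<subseteq> K \<and> (\<forall>k\<in>K'. \<exists>a\<in>K. x * \<iota> k = \<iota> a)"
proof -
  have rK: "right_ideal K"
    using assms by (simp add: dense_def)
  obtain s where s: "s \<in> K" "regular s"
    using assms by (auto simp: dense_def)
  obtain t where t: "\<iota> s * t = 1"
    using regular_invertible[OF s(2)] by blast
  obtain s' a b where s': "regular s'" "t * \<iota> s' = \<iota> a" "t * x * \<iota> s' = \<iota> b"
    using common_denominator[of "{t, t * x}"] by auto
  define D where "D = {k \<in> K. \<exists>a\<in>K. x * \<iota> k = \<iota> a}"
  have "\<iota> s' = \<iota> (s * a)"
    by (simp add: \<iota>_mult s'(2)[symmetric] mult.assoc[symmetric] t)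
  then have "s' \<in> K"
    using \<iota>_inj right_ideal_mult[OF rK s(1)] by blast
  moreover have "x * \<iota> s' = \<iota> (s * b)"
    by (simp add: \<iota>_mult s'(3)[symmetric] mult.assoc[symmetric] t)
  ultimately have "s' \<in> D"
    using right_ideal_mult[OF rK s(1)] by (auto simp: D_def)
  moreover have "right_ideal D"
    unfolding right_ideal_def
  proof (intro conjI ballI allI)
    show "0 \<in> D"
      using right_ideal_zero[OF rK] \<iota>_zero by (auto simp: D_def intro!: bexI[of _ 0])
    show "k + k' \<in> D" if kk': "k \<in> D" "k' \<in> D" for k k'
    proof -
      obtain a a' where "a \<in> K" "a' \<in> K" "x * \<iota> k = \<iota> a" "x * \<iota> k' = \<iota> a'" "k \<in> K" "k' \<in> K"
        using kk' by (auto simp: D_def)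
      then show ?thesis
        using right_ideal_add[OF rK] by (auto simp: D_def \<iota>_add distrib_left intro!: bexI[of _ "a + a'"])
    qed
    show "k * r \<in> D" if k: "k \<in> D" for k r
    proof -
      obtain a where "a \<in> K" "x * \<iota> k = \<iota> a" "k \<in> K"
        using k by (auto simp: D_def)
      then show ?thesis
        using right_ideal_mult[OF rK] by (auto simp: D_def \<iota>_mult mult.assoc[symmetric] intro!: bexI[of _ "a * r"])
    qed
  qed
  ultimately obtain K' where "dense K'" "K' \<subseteq> D"
    using dense_core s'(1) by blast
  then show ?thesis
    by (intro exI[of _ K']) (auto simp: D_def)
qed

text \<open>Among the dense \<open>K \<subseteq> K\<^sub>0\<close> one with \<open>K g Q\<^sup>H\<close> minimal contains a unit \<open>s\<close> of \<open>Q\<close>; shrinking \<open>K\<close> to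
  \<open>K'\<close> with \<open>s\<inverse> K' \<subseteq> K\<close> does not change \<open>K g Q\<^sup>H\<close>, so that \<open>s g \<in> K' g Q\<^sup>H\<close>.\<close>

lemma dense_trace:
  assumes t: "\<And>h. h * t = scaleH (counit h) t" "counit t = 1"
    and K0: "dense K0" and cg: "c \<in> Q.INV" "g \<in> Q.INV"
    and zero: "\<And>k. k \<in> K0 \<Longrightarrow> c * actQ t (\<iota> k) * g = 0"
  shows "c * g = 0"
proof -
  \<comment> \<open>Only invariant factors are allowed on the right, since these can be taken out of
    \<open>actQ t\<close>; hence the need for the chain condition over
    \<open>Q\<^sup>H\<close>.\<close>
  define V where "V K = set_product ((\<lambda>k. \<iota> k * g) ` K) Q.INV" for K
  have V_mult: "x * d \<in> V K" if "x \<in> V K" "d \<in> Q.INV" for x d K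
    using that(1) unfolding V_def
    by (induction rule: set_product_induct)
      (auto simp: mult.assoc[of _ _ d] left_diff_distrib that(2) intro!: set_product_intro set_product_diff Q.inv_mult)
  have V_mono: "V K \<subseteq> V K'" if "K \<subseteq> K'" for K K'
    unfolding V_def using that by (intro set_product_mono) auto
  have "\<exists>M\<in>V ` {K. dense K \<and> K \<subseteq> K0}. \<forall>N\<in>V ` {K. dense K \<and> K \<subseteq> K0}. N \<subseteq> M \<longrightarrow> N = M"
  proof (rule dcc_minimal)
    fix W assume W: "\<And>n::nat. W n \<in> V ` {K. dense K \<and> K \<subseteq> K0}" "decseq W"
    have W': "\<exists>K. W n = V K" for n
      using W(1) by blast
    show "\<exists>n. \<forall>m\<ge>n. W m = W n"
    proof (rule Q.invariant_submodules_dcc[OF fd ss art W(2)])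
      show "0 \<in> W n" for n
        using W'[of n] by (elim exE) (simp add: V_def)
      show "x + y \<in> W n" if "x \<in> W n" "y \<in> W n" for n x y
        using W'[of n] that by (elim exE) (simp add: V_def set_product_add)
      show "x * d \<in> W n" if "x \<in> W n" "d \<in> Q.INV" for n x d
        using W'[of n] that by (elim exE) (simp add: V_mult)
    qed
  qed (use K0 in auto)
  then obtain K1 where K1: "dense K1" "K1 \<subseteq> K0"
      and min: "\<And>K. dense K \<Longrightarrow> K \<subseteq> K0 \<Longrightarrow> V K \<subseteq> V K1 \<Longrightarrow> V K = V K1"
    by auto
  obtain s where s: "s \<in> K1" "regular s"
    using K1 by (auto simp: dense_def)
  obtain x where x: "x * \<iota> s = 1"
    using regular_invertible[OF s(2)] by blast
  obtain K' where K': "dense K'" "K' \<subseteq> K1" "\<forall>k\<in>K'. \<exists>a\<in>K1. x * \<iota> k = \<iota> a"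
    using dense_multiplier[OF K1(1)] by blast
  have "\<iota> s * g * 1 \<in> V K1"
    unfolding V_def using s Q.inv_one by (intro set_product_intro) auto
  then have "\<iota> s * g \<in> V K'"
    using min[of K'] K' K1 V_mono by auto
  \<comment> \<open>For \<open>k \<in> K'\<close>, \<open>x * \<iota> k\<close> comes from
    \<open>K1 \<subseteq> K0\<close>, where the assumption applies. At \<open>z = s g\<close> the
    factor \<open>x s = 1\<close> leaves \<open>c * actQ t g = c * g\<close>.\<close>
  moreover have "c * actQ t (x * z) = 0" if "z \<in> V K'" for z
    using that unfolding V_def
  proof (induction rule: set_product_induct)
    case (mult y d)
    then obtain k where k: "k \<in> K'" "y = \<iota> k * g"
      by blast
    then obtain a where a: "a \<in> K1" "x * \<iota> k = \<iota> a"
      using K'(3) by blast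
    have "x * (y * d) = \<iota> a * (g * d)"
      by (simp add: k a(2)[symmetric] mult.assoc)
    then have "c * actQ t (x * (y * d)) = c * actQ t (\<iota> a) * g * d"
      using Q.act_inv_right[OF Q.inv_mult[OF cg(2) mult(2)]] by (simp add: mult.assoc)
    then show ?case
      using zero a K1 by auto
  qed (auto simp: Q.act_zero Q.act_diff right_diff_distrib)
  ultimately have "c * actQ t (x * (\<iota> s * g)) = 0"
    by blast
  then show ?thesis
    using Q.invD[OF cg(2), of t] t(2) by (simp add: mult.assoc[symmetric] x)
qed

text \<open>\<open>z Q\<close> is an \<open>H\<close>-stable right ideal, so it has an invariant
  left unit \<open>f = z q\<close>. Averaging replaces \<open>q\<close> by \<open>actQ t q\<close>,
  and \<open>f z = z\<close> is the claim.\<close>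

lemma invariants_von_Neumann_regular:
  assumes "z \<in> Q.INV"
  shows "\<exists>y\<in>Q.INV. z * y * z = z"
proof -
  obtain t where t: "\<And>h. h * t = scaleH (counit h) t" "counit t = 1"
    using A.H.left_integral_exists[OF ss] by blast
  have "right_ideal (range ((*) z))"
    by (rule right_idealI_diff)
      (auto simp: mult.assoc right_diff_distrib[symmetric] intro: image_eqI[of _ _ 0])
  moreover have "H_stable actQ (range ((*) z))"
    using assms by (auto simp: H_stable_def Q.act_inv_left)
  ultimately obtain f where f: "f \<in> range ((*) z)" "f \<in> Q.INV" "\<forall>x\<in>range ((*) z). f * x = x"
    using right_ideal_idempotent by blast
  then obtain q where q: "f = z * q"
    by blast
  have "f = actQ t f"
    using Q.invD[OF f(2), of t] t(2) by simp
  then have "f = z * actQ t q"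
    by (simp add: q Q.act_inv_left[OF assms])
  moreover have "f * (z * 1) = z * 1"
    using f(3) by blast
  ultimately have "z * actQ t q * z = z"
    by simp
  then show ?thesis
    using Q.integral_act_inv[OF t(1)] by blast
qed

section \<open>The given right ideal \<open>I\<close> and its extension to \<open>Q\<close>\<close>

context
  fixes I :: "'a set"
  assumes I: "right_ideal I" "H_stable actA I"
begin

definition extension :: "'q set"
  where "extension = set_product (\<iota> ` I) UNIV"

lemma right_ideal_extension: "right_ideal extension"
  unfolding extension_def by (rule right_ideal_set_product) (simp add: right_ideal_def)

lemma H_stable_extension: "H_stable actQ extension"
proof -
  have "H_stable actQ (\<iota> ` I)"
    using I(2) by (auto simp: H_stable_def \<iota>_act[symmetric])
  then show ?thesis
    unfolding extension_def by (intro Q.H_stable_set_product) (auto simp: H_stable_def right_ideal_def)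
qed

lemma \<iota>_in_extension: "a \<in> I \<Longrightarrow> \<iota> a \<in> extension"
  unfolding extension_def using set_product_intro[of "\<iota> a" "\<iota> ` I" 1 UNIV] by simp

lemma extension_fraction: "q \<in> extension \<Longrightarrow> \<exists>s a. regular s \<and> a \<in> I \<and> q * \<iota> s = \<iota> a"
  unfolding extension_def
proof (induction rule: set_product_induct)
  case zero
  show ?case
    using regular_one right_ideal_zero[OF I(1)] \<iota>_zero by (intro exI[of _ 1] exI[of _ 0]) auto
next
  case (mult y q)
  obtain s b where sb: "regular s" "q * \<iota> s = \<iota> b"
    using common_denominator[of "{q}"] by auto
  obtain a where "a \<in> I" "y = \<iota> a"
    using mult by blast
  then show ?case
    using sb right_ideal_mult[OF I(1)] by (intro exI[of _ s] exI[of _ "a * b"]) (auto simp: mult.assoc \<iota>_mult)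
next
  case (diff q1 q2)
  then obtain s1 a1 s2 a2 where 1: "regular s1" "a1 \<in> I" "q1 * \<iota> s1 = \<iota> a1"
      and 2: "regular s2" "a2 \<in> I" "q2 * \<iota> s2 = \<iota> a2"
    by blast
  obtain t1 t2 where t: "\<iota> s1 * t1 = 1" "\<iota> s2 * t2 = 1"
    using regular_invertible 1(1) 2(1) by blast
  \<comment> \<open>A common denominator of the inverses \<open>t1\<close>, \<open>t2\<close> is a
    common right multiple of \<open>s1\<close> and \<open>s2\<close>: the Ore condition.\<close>
  obtain s b1 b2 where s: "regular s" "t1 * \<iota> s = \<iota> b1" "t2 * \<iota> s = \<iota> b2"
    using common_denominator[of "{t1, t2}"] by auto
  have "\<iota> s = \<iota> s1 * \<iota> b1" "\<iota> s = \<iota> s2 * \<iota> b2"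
    by (simp_all add: s(2,3)[symmetric] mult.assoc[symmetric] t)
  then have "q1 * \<iota> s = \<iota> (a1 * b1)" "q2 * \<iota> s = \<iota> (a2 * b2)"
    by (metis 1(3) \<iota>_mult mult.assoc, metis 2(3) \<iota>_mult mult.assoc)
  then have "(q1 - q2) * \<iota> s = \<iota> (a1 * b1 - a2 * b2)"
    by (simp add: left_diff_distrib \<iota>_diff)
  moreover have "a1 * b1 - a2 * b2 \<in> I"
    using right_ideal_mult[OF I(1) 1(2)] right_ideal_mult[OF I(1) 2(2)] right_ideal_diff[OF I(1)] by blast
  ultimately show ?case
    using s(1) by blast
qed

lemma integral_act_I:
  assumes "\<And>h. h * t = scaleH (counit h) t" "k \<in> I"
  shows "actQ t (\<iota> k) \<in> \<iota> ` (I \<inter> A.INV)"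
  using I(2) A.integral_act_inv[OF assms(1)] assms(2) by (auto simp: \<iota>_act[symmetric] H_stable_def)

text \<open>The invariant left unit \<open>e\<close> of \<open>I Q\<close> is a fraction with
  numerator in \<open>I\<close>, so the \<open>k\<close> with \<open>e k \<in> I\<close> form a
  dense right ideal \<open>K\<close>. There \<open>e * actQ t k = actQ t (e k)\<close> lies in
  \<open>I\<^sup>H = 0\<close>, which forces \<open>e = 0\<close>, hence
  \<open>I Q = 0\<close>.\<close>

theorem trivial_invariants:
  assumes I0: "I \<inter> A.INV = {0}"
  shows "I = {0}"
proof -
  obtain t where t: "\<And>h. h * t = scaleH (counit h) t" "counit t = 1"
    using A.H.left_integral_exists[OF ss] by blast
  obtain e where e: "e \<in> extension" "e \<in> Q.INV" "\<forall>x\<in>extension. e * x = x"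
    using right_ideal_idempotent[OF right_ideal_extension H_stable_extension] by blast
  obtain s b where s: "regular s" "b \<in> I" "e * \<iota> s = \<iota> b"
    using extension_fraction[OF e(1)] by blast
  define K where "K = {k. \<exists>a\<in>I. e * \<iota> k = \<iota> a}"
  have "right_ideal K"
    unfolding right_ideal_def
  proof (intro conjI ballI allI)
    show "0 \<in> K"
      using right_ideal_zero[OF I(1)] by (auto simp: K_def \<iota>_zero intro!: bexI[of _ 0])
    show "k + k' \<in> K" if kk': "k \<in> K" "k' \<in> K" for k k'
    proof -
      obtain a a' where "a \<in> I" "a' \<in> I" "e * \<iota> k = \<iota> a" "e * \<iota> k' = \<iota> a'"
        using kk' by (auto simp: K_def)
      then show ?thesis
        using right_ideal_add[OF I(1)] by (auto simp: K_def \<iota>_add distrib_left intro!: bexI[of _ "a + a'"])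
    qed
    show "k * r \<in> K" if k: "k \<in> K" for k r
    proof -
      obtain a where "a \<in> I" "e * \<iota> k = \<iota> a"
        using k by (auto simp: K_def)
      then show ?thesis
        using right_ideal_mult[OF I(1)] by (auto simp: K_def \<iota>_mult mult.assoc[symmetric] intro!: bexI[of _ "a * r"])
    qed
  qed
  moreover have "H_stable actA K"
    unfolding H_stable_def
  proof (intro allI ballI)
    fix h k assume "k \<in> K"
    then obtain a where a: "a \<in> I" "e * \<iota> k = \<iota> a"
      by (auto simp: K_def)
    have "e * \<iota> (actA h k) = \<iota> (actA h a)"
      by (simp add: \<iota>_act Q.act_inv_left[OF e(2), symmetric] a(2))
    then show "actA h k \<in> K"
      using a(1) I(2) by (auto simp: K_def H_stable_def)
  qed
  moreover have "s \<in> K"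
    using s by (auto simp: K_def)
  ultimately have "dense K"
    using s(1) by (auto simp: dense_def)
  moreover have "e * actQ t (\<iota> k) * 1 = 0" if "k \<in> K" for k
  proof -
    obtain a where a: "a \<in> I" "e * \<iota> k = \<iota> a"
      using \<open>k \<in> K\<close> by (auto simp: K_def)
    have "e * actQ t (\<iota> k) = actQ t (\<iota> a)"
      by (simp add: Q.act_inv_left[OF e(2), symmetric] a(2))
    then show ?thesis
      using integral_act_I[OF t(1) a(1)] I0 by (simp add: \<iota>_zero)
  qed
  ultimately have "e * 1 = 0"
    using dense_trace[OF t _ e(2) Q.inv_one] by blast
  then have "\<iota> a = 0" if "a \<in> I" for a
    using e(3) \<iota>_in_extension[OF that] by (metis mult_1_right mult_zero_left)
  then have "a = 0" if "a \<in> I" for a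
    using that \<iota>_inj[of a 0] by (simp add: \<iota>_zero)
  then show ?thesis
    using right_ideal_zero[OF I(1)] by blast
qed

text \<open>For the left unit \<open>e\<close> of \<open>I Q\<close>, the right annihilator of
  \<open>e\<close> in \<open>A\<close> meets \<open>I\<close> in zero, so it vanishes by
  essentiality. It contains a numerator of \<open>1 - e\<close>; hence \<open>e = 1\<close>, and
  writing \<open>1\<close> as a fraction over \<open>I\<close> yields a regular element of
  \<open>I\<close>.\<close>

lemma essential_dense:
  assumes ess: "essential_right_ideal I"
  shows "dense I"
proof -
  obtain e where e: "e \<in> extension" "\<forall>x\<in>extension. e * x = x"
    using right_ideal_idempotent[OF right_ideal_extension H_stable_extension] by blast
  define J where "J = {a. e * \<iota> a = 0}"
  have "right_ideal J"
    by (auto simp: right_ideal_def J_def \<iota>_zero \<iota>_add \<iota>_mult distrib_left mult.assoc[symmetric])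
  moreover have "I \<inter> J = {0}"
  proof -
    have "a = 0" if "a \<in> I" "a \<in> J" for a
      using e(2) \<iota>_in_extension[OF that(1)] that(2) \<iota>_inj[of a 0] by (simp add: J_def \<iota>_zero)
    then show ?thesis
      using right_ideal_zero[OF I(1)] right_ideal_zero[OF \<open>right_ideal J\<close>] by blast
  qed
  ultimately have J0: "J = {0}"
    using ess unfolding essential_right_ideal_def by blast
  obtain s a where s: "regular s" "(1 - e) * \<iota> s = \<iota> a"
    using common_denominator[of "{1 - e}"] by auto
  have "e * \<iota> a = (e - e * e) * \<iota> s"
    by (simp add: s(2)[symmetric] algebra_simps)
  also have "\<dots> = 0"
    using e by simp
  finally have "a = 0"
    using J0 by (auto simp: J_def)
  then have "1 - e = 0"
    using regular_cancel[OF s(1)] s(2) by (simp only: \<iota>_zero)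
  then have "1 \<in> extension"
    using e(1) by simp
  then obtain s b where "regular s" "b \<in> I" "1 * \<iota> s = \<iota> b"
    using extension_fraction by blast
  then have "regular s" "s \<in> I"
    using \<iota>_inj[of s b] by auto
  then show ?thesis
    using I by (auto simp: dense_def)
qed

lemma invariants_subset: "\<iota> ` (I \<inter> A.INV) \<subseteq> Q.INV"
  using \<iota>_inv by auto

text \<open>Let \<open>f\<close> be the invariant left unit of the right ideal
  \<open>I\<^sup>H Q\<close>. Averaging shows \<open>f \<in> I\<^sup>H Q\<^sup>H\<close>, and
  \<open>1 - f\<close> kills \<open>T(I)\<close>; as \<open>I\<close> is dense,
  \<open>f = 1\<close>.\<close>

theorem essential_right_product:
  assumes ess: "essential_right_ideal I"
  shows "set_product (\<iota> ` (I \<inter> A.INV)) Q.INV = Q.INV"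
proof
  let ?P = "\<iota> ` (I \<inter> A.INV)"
  let ?R = "set_product ?P Q.INV"
  show "?R \<subseteq> Q.INV"
  proof
    fix z assume "z \<in> ?R"
    then show "z \<in> Q.INV"
      by (induction rule: set_product_induct) (use invariants_subset in \<open>auto intro: Q.inv_zero Q.inv_mult Q.inv_diff\<close>)
  qed
  obtain t where t: "\<And>h. h * t = scaleH (counit h) t" "counit t = 1"
    using A.H.left_integral_exists[OF ss] by blast
  define X where "X = set_product ?P (UNIV :: 'q set)"
  have "right_ideal X"
    unfolding X_def by (rule right_ideal_set_product) (simp add: right_ideal_def)
  moreover have "H_stable actQ X"
    unfolding H_stable_def
  proof (intro allI ballI)
    fix h z assume "z \<in> X"
    then show "actQ h z \<in> X"
      unfolding X_def
    proof (induction rule: set_product_induct)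
      case (mult x y)
      then have "actQ h (x * y) = x * actQ h y"
        using invariants_subset by (intro Q.act_inv_left) auto
      then show ?case
        using mult by (auto intro: set_product_intro)
    qed (auto simp: Q.act_zero Q.act_diff intro: set_product_diff)
  qed
  ultimately obtain f where f: "f \<in> X" "f \<in> Q.INV" "\<forall>x\<in>X. f * x = x"
    using right_ideal_idempotent by blast
  have "actQ t z \<in> ?R" if "z \<in> X" for z
    using that unfolding X_def
  proof (induction rule: set_product_induct)
    case (mult x y)
    then have "actQ t (x * y) = x * actQ t y"
      using invariants_subset by (intro Q.act_inv_left) auto
    then show ?case
      using mult Q.integral_act_inv[OF t(1)] by (auto intro: set_product_intro)
  qed (auto simp: Q.act_zero Q.act_diff intro: set_product_diff)
  then have fR: "f \<in> ?R"
    using f(1) Q.invD[OF f(2), of t] t(2) by fastforce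
  have "(1 - f) * actQ t (\<iota> k) * 1 = 0" if "k \<in> I" for k
  proof -
    have "actQ t (\<iota> k) * 1 \<in> X"
      unfolding X_def by (rule set_product_intro[OF integral_act_I[OF t(1) that] UNIV_I])
    then show ?thesis
      using f(3) by (simp add: left_diff_distrib)
  qed
  from dense_trace[OF t essential_dense[OF ess] Q.inv_diff[OF Q.inv_one f(2)] Q.inv_one this]
  have "f = 1"
    by simp
  have "z * c \<in> ?R" if "z \<in> ?R" "c \<in> Q.INV" for z c
    using that(1)
    by (induction rule: set_product_induct)
      (auto simp: mult.assoc[of _ _ c] left_diff_distrib that(2) intro!: set_product_intro set_product_diff Q.inv_mult)
  from this[OF fR] show "Q.INV \<subseteq> ?R"
    by (auto simp: \<open>f = 1\<close>)
qed

text \<open>If \<open>p\<close> is an idempotent of the left ideal \<open>L = Q\<^sup>H I\<^sup>H\<close> of \<open>Q\<^sup>H\<close> with \<open>(1 - p) Q\<close> minimal, then \<open>L (1 - p) = 0\<close>.\<close>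

theorem essential_left_product:
  assumes ess: "essential_right_ideal I"
  shows "set_product Q.INV (\<iota> ` (I \<inter> A.INV)) = Q.INV"
proof
  let ?P = "\<iota> ` (I \<inter> A.INV)"
  let ?L = "set_product Q.INV ?P"
  show LI: "?L \<subseteq> Q.INV"
  proof
    fix z assume "z \<in> ?L"
    then show "z \<in> Q.INV"
      by (induction rule: set_product_induct) (use invariants_subset in \<open>auto intro: Q.inv_zero Q.inv_mult Q.inv_diff\<close>)
  qed
  have L_mult: "c * z \<in> ?L" if "z \<in> ?L" "c \<in> Q.INV" for z c
    using that(1)
    by (induction rule: set_product_induct)
      (auto simp: mult.assoc[of c, symmetric] right_diff_distrib that(2) intro!: set_product_intro set_product_diff Q.inv_mult)
  obtain t where t: "\<And>h. h * t = scaleH (counit h) t" "counit t = 1"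
    using A.H.left_integral_exists[OF ss] by blast
  \<comment> \<open>The chain condition concerns right ideals of \<open>Q\<close>, while
    \<open>?L\<close> is a left ideal of \<open>Q\<^sup>H\<close>. Passing to
    \<open>(1 - p) Q\<close> translates: enlarging the idempotent \<open>p\<close> shrinks
    \<open>R p\<close>.\<close>
  define R where "R p = range ((*) (1 - p))" for p :: 'q
  have rR: "right_ideal (R p)" for p
    unfolding R_def by (rule right_idealI_diff)
      (auto simp: mult.assoc right_diff_distrib[symmetric] intro: image_eqI[of _ _ 0])
  have "\<exists>M\<in>R ` {p \<in> ?L. p * p = p}. \<forall>N\<in>R ` {p \<in> ?L. p * p = p}. N \<subseteq> M \<longrightarrow> N = M"
    by (rule right_artinian_minimal[OF art]) (use rR in \<open>auto intro: exI[of _ 0]\<close>)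
  then obtain p where p: "p \<in> ?L" "p * p = p"
      and min: "\<And>p'. p' \<in> ?L \<Longrightarrow> p' * p' = p' \<Longrightarrow> R p' \<subseteq> R p \<Longrightarrow> R p' = R p"
    by auto
  have Lp: "x * p = x" if x: "x \<in> ?L" for x
  proof -
    \<comment> \<open>If \<open>z\<close> were nonzero, von Neumann regularity would give a nonzero
      idempotent \<open>q \<in> ?L\<close> with \<open>q p = 0\<close>, and
      \<open>p' = p + q - p q\<close> would contradict minimality, as
      \<open>1 - p' = (1 - p) (1 - q)\<close>.\<close>
    define z where "z = x - x * p"
    have z: "z \<in> ?L"
      unfolding z_def using x p LI by (intro set_product_diff L_mult) auto
    obtain y where y: "y \<in> Q.INV" "z * y * z = z"
      using invariants_von_Neumann_regular z LI by blast
    define q where "q = y * z"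
    have q: "q \<in> ?L"
      unfolding q_def using z y(1) by (rule L_mult)
    have "z * p = 0"
      by (simp add: z_def left_diff_distrib mult.assoc p(2))
    then have qp: "q * p = 0"
      by (simp add: q_def mult.assoc)
    have qq: "q * q = q"
      using y(2) by (simp add: q_def mult.assoc)
    define p' where "p' = p + q - p * q"
    have pp: "p * (p * r) = p * r" "q * (p * r) = 0" "q * (q * r) = q * r" for r
      by (simp_all add: mult.assoc[symmetric] p(2) qp qq)
    have p': "p' \<in> ?L" "p' * p' = p'"
    proof -
      show "p' \<in> ?L"
        unfolding p'_def using p q LI by (intro set_product_diff set_product_add L_mult) auto
      show "p' * p' = p'"
        by (simp add: p'_def algebra_simps p(2) qq qp pp)
    qed
    have "1 - p' = (1 - p) * (1 - q)"
      by (simp add: p'_def algebra_simps)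
    then have "R p' \<subseteq> R p"
      by (auto simp: R_def mult.assoc)
    then have "R p' = R p"
      by (rule min[OF p'])
    moreover have "(1 - p) * 1 \<in> R p"
      unfolding R_def by blast
    ultimately obtain v where v: "1 - p = (1 - p') * v"
      by (auto simp: R_def)
    have "p' * (1 - p) = (p' - p' * p') * v"
      by (simp add: v algebra_simps)
    then have "p' * (1 - p) = 0"
      by (simp add: p'(2))
    then have "q = p * q"
      by (simp add: p'_def algebra_simps p(2) qp pp)
    then have "q = 0"
      using pp(2)[of q] qq by simp
    then have "z = 0"
      using y(2) by (simp add: q_def mult.assoc)
    then show ?thesis
      by (simp add: z_def)
  qed
  have "1 * actQ t (\<iota> k) * (1 - p) = 0" if "k \<in> I" for k
  proof -
    have "1 * actQ t (\<iota> k) \<in> ?L"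
      by (rule set_product_intro[OF Q.inv_one integral_act_I[OF t(1) that]])
    then show ?thesis
      using Lp by (simp add: right_diff_distrib)
  qed
  from dense_trace[OF t essential_dense[OF ess] Q.inv_one Q.inv_diff[OF Q.inv_one] this]
  have "p = 1"
    using p LI by auto
  then show "Q.INV \<subseteq> ?L"
    using L_mult[OF p(1)] by auto
qed

end

end

theorem lemma4p2:
  fixes scaleH :: "'k::field \<Rightarrow> 'h::ring_1 \<Rightarrow> 'h"
    and comult :: "'h \<Rightarrow> ('h \<times> 'h \<Rightarrow>\<^sub>0 'k)"
    and counit :: "'h \<Rightarrow> 'k"
    and antipode :: "'h \<Rightarrow> 'h"
    and scaleA :: "'k \<Rightarrow> 'a::{ring,monoid_mult} \<Rightarrow> 'a"
    and actA :: "'h \<Rightarrow> 'a \<Rightarrow> 'a"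
    and scaleQ :: "'k \<Rightarrow> 'q::{ring,monoid_mult} \<Rightarrow> 'q"
    and actQ :: "'h \<Rightarrow> 'q \<Rightarrow> 'q"
    and \<iota> :: "'a \<Rightarrow> 'q"
    and I :: "'a set"
  assumes "hopf_algebra scaleH comult counit antipode"
    and "finite_dimensional scaleH"
    and "semisimple_ring TYPE('h)"
    and "module_algebra scaleH comult counit antipode scaleA actA"
    and "H_semiprime actA"
    and "classical_right_quotient_ring \<iota>"
    and "right_artinian TYPE('q)"
    and "module_algebra scaleH comult counit antipode scaleQ actQ"
    and "\<And>h a. \<iota> (actA h a) = actQ h (\<iota> a)"
    and "right_ideal I"
    and "H_stable actA I"
  defines "AH \<equiv> invariants counit scaleA actA"
    and "QH \<equiv> invariants counit scaleQ actQ"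
  shows "(I \<inter> AH = {0} \<longrightarrow> I = {0}) \<and>
    (essential_right_ideal I \<longrightarrow>
      set_product QH (\<iota> ` (I \<inter> AH)) = QH \<and> set_product (\<iota> ` (I \<inter> AH)) QH = QH)"
proof -
  interpret module_algebra_quotient scaleH comult counit antipode scaleA actA scaleQ actQ \<iota>
    by (intro module_algebra_quotient.intro module_algebra_quotient_axioms.intro assms)
  show ?thesis
    unfolding AH_def QH_def
    using trivial_invariants essential_left_product essential_right_product assms(10,11) by blast
qed

end
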